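(* Let $\beta\in\mathbb{Z}_+$. Given $(n_1,\ldots,n_6)\in\mathbb{Z}_+^6$, there is a constant $C>0$, independent of $k$ and $\mathbf d$, such that for all $k\ge k_0$ and $\mathbf{d}=(d_1,\ldots,d_6)\in\mathbb{N}^6$ with $d_j\ge n_j-1$ for every $j$, $$\|\eta-\hat\eta_\beta\|_{L^2(\partial K)}\le C\,\frac{C_k}{c_k}\,k^{-\frac{\beta}{3}}\sqrt{\log k}\,\Big(\sum_{j=1}^{4}(\log k)^{n_j}(d_j)^{-n_j}+\sum_{j=5}^{6}(d_j)^{-n_j}\Big)$$ for the $\beta$-asymptotic Galerkin approximation $\hat\eta_\beta\in\sigma_\beta+\mathcal{C}_{\mathbf d}$ to $\eta$ based on frequency dependent changes of variables.
   Context: Notation: $\mathbb{Z}_+=\{0,1,2,\ldots\}$, $\mathbb{N}=\{1,2,\ldots\}$, $-\mathbb{N}=\{-1,-2,\ldots\}$, $t_-=\min\{t,0\}$; an empty sum is zero. Scattering problem. $K\subset\mathbb{R}^2$ is a compact, strictly convex obstacle with smooth boundary of length $2P$ and exterior unit normal $\nu$; $u^{\rm inc}(x)=e^{ik\alpha\cdot x}$ with $|\alpha|=1$, $k>0$; $u$ is the solution of $(\Delta+k^2)u=0$ in $\mathbb{R}^2\setminus K$, $\partial_\nu u=-\partial_\nu u^{\rm inc}$ on $\partial K$, $\lim_{r=|x|\to\infty}\sqrt r(\partial_r u-iku)=0$. The total field on $\partial K$ is $\eta=u+u^{\rm inc}$. $\gamma$ is the $2P$-periodic counterclockwise arc length parametrization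 of $\partial K$ for which $\alpha\cdot\nu(\gamma(s))$ vanishes on $[0,2P]$ exactly at $s=t_1,t_2$, with $0<t_1<t_2<2P$, $t_1+t_2=2P$, is negative on $(t_1,t_2)$ (illuminated region) and positive on $[0,t_1)\cup(t_2,2P]$ (shadow region). Functions on $\partial K$ are identified via $\gamma$ with $2P$-periodic functions of $s$; $\eta^{\rm slow}(s,k)=e^{-ik\alpha\cdot\gamma(s)}\eta(s,k)$. Hörmander class: a $C^\infty$ function $a(s,k)$ on $[0,2P]\times(0,\infty)$ belongs to $S^{\mu}_{\varrho,\delta}$ if for all $n,m\in\mathbb{Z}_+$ and every $\kappa>0$ there is $C$ with $|D_s^nD_k^m a(s,k)|\le C k^{\mu+\delta n-\varrho m}$ for $s\in[0,2P]$, $k\ge\kappa$. Asymptotic expansion (a known fact). $\eta^{\rm slow}\in S^0_{\frac23,\frac13}$ and $\eta^{\rm slow}\sim\sum_{p,q,r\in\mathbb{Z}_+,\,\ell\in-\mathbb{N}}a_{p,q,r,\ell}$ with $$a_{p,q,r,\ell}(s,k)=k^{-\frac{1+2p+3q+r+\ell}{3}+(\ell+1)_-}\,b_{p,q,r,\ell}(s)\,(\Psi^{r,\ell})^{(p)}(k^{\frac13}Z(s)),$$ where $b_{p,q,r,\ell}$ are $2P$-periodic complex-valued $C^\infty$ functions; $Z$ is a $2P$-periodic real-valued $C^\infty$ function, positive on the illuminated region, negative on the shadow region, vanishing precisely to first order at $t_1,t_2$; $\Psi^{r,\ell}$ are complex-valued $C^\infty$ functions on $\mathbb{R}$ with $\Psi^{r,\ell}(\tau)\sim\sum_{j\in\mathbb{Z}_+}a_{r,\ell,j}\tau^{1+\ell-2r-3j}$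 as $\tau\to+\infty$ (in the sense of symbols) and rapidly decreasing with all derivatives as $\tau\to-\infty$. The relation $\sim$ means: for every $M>0$ there is a finite index set $F_M$ such that $\eta^{\rm slow}-\sum_{F}a_{p,q,r,\ell}\in S^{-M}_{\frac23,\frac13}$ for every finite $F\supseteq F_M$. Definition of $\sigma_\beta$. $$\vartheta(p,q,r,\ell)=-\frac{1+2p+3q+r+\ell}{3}+(\ell+1)_-+\begin{cases}0, & 1+\ell-2r-p<0,\\ \frac{1+\ell-2r-p}{3}, & 1+\ell-2r-p\ge 0,\end{cases}$$ $\mathcal{F}_\beta=\{(p,q,r,\ell)\in\mathbb{Z}_+^3\times(-\mathbb{N}):\vartheta(p,q,r,\ell)>-\beta/3\}$, $\sigma_\beta^{\rm slow}=\sum_{\mathcal{F}_\beta}a_{p,q,r,\ell}$, $\sigma_\beta=e^{ik\alpha\cdot\gamma}\sigma_\beta^{\rm slow}$, $\rho_\beta=\eta-\sigma_\beta$. Integral equation. For some $k_0>1$ and all $k\ge k_0$, $\eta$ solves an integral equation $\mathcal{R}_k\eta=f$ on $L^2(\partial K)$ where the linear operator $\mathcal{R}_k$ is continuous and coercive with constants $C_k,c_k>0$: $|\langle\mu,\mathcal{R}_k\phi\rangle|\le C_k\|\mu\|\|\phi\|$ and $|\langle\mu,\mathcal{R}_k\mu\rangle|\ge c_k\|\mu\|^2$ for all $\mu,\phi\in L^2(\partial K)$. Put $f_\beta=f-\mathcal{R}_k\sigma_\beta$, so that $\mathcal{R}_k\rho_\beta=f_\beta$. Regions. Fix positive constants $\xi_j,\xi_j',\zeta_j,\zeta_j'$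 ($j=1,2$) with $t_1+\xi_1\le t_1+\xi_1'=t_2-\xi_2'\le t_2-\xi_2$ and $t_2+\zeta_2\le t_2+\zeta_2'=2P+t_1-\zeta_1'\le 2P+t_1-\zeta_1$. Intervals $\mathcal{I}_j=[a_j,b_j]$ (in the parameter domain, modulo $2P$): $\mathcal{I}_1=[t_1+\xi_1k^{-\frac13},t_1+\xi_1']$, $\mathcal{I}_2=[t_2-\xi_2',t_2-\xi_2k^{-\frac13}]$, $\mathcal{I}_3=[t_1-\zeta_1',t_1-\zeta_1k^{-\frac13}]$, $\mathcal{I}_4=[t_2+\zeta_2k^{-\frac13},t_2+\zeta_2']$, $\mathcal{I}_5=[t_1-\zeta_1k^{-\frac13},t_1+\xi_1k^{-\frac13}]$, $\mathcal{I}_6=[t_2-\xi_2k^{-\frac13},t_2+\zeta_2k^{-\frac13}]$. Changes of variables $\phi_j:\mathcal{I}_j\to\mathcal{I}_j$ (bijections): $\phi_1=t_1+\varphi_1k^{\psi_1}$, $\phi_2=t_2-\varphi_2k^{\psi_2}$, $\phi_3=t_1-\varphi_3k^{\psi_3}$, $\phi_4=t_2+\varphi_4k^{\psi_4}$, $\phi_5(s)=s$, $\phi_6(s)=s$, where $\psi_1(s)=-\frac13\frac{b_1-s}{b_1-a_1}$, $\varphi_1(s)=\xi_1+(\xi_1'-\xi_1)\frac{s-a_1}{b_1-a_1}$; $\psi_2(s)=-\frac13\frac{s-a_2}{b_2-a_2}$, $\varphi_2(s)=\xi_2'+(\xi_2-\xi_2')\frac{s-a_2}{b_2-a_2}$;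 $\psi_3(s)=-\frac13\frac{s-a_3}{b_3-a_3}$, $\varphi_3(s)=\zeta_1'+(\zeta_1-\zeta_1')\frac{s-a_3}{b_3-a_3}$; $\psi_4(s)=-\frac13\frac{b_4-s}{b_4-a_4}$, $\varphi_4(s)=\zeta_2+(\zeta_2'-\zeta_2)\frac{s-a_4}{b_4-a_4}$. Galerkin method. $\mathbb{P}_d$ is the space of polynomials of degree at most $d$, $\mathbf{1}_{\mathcal I}$ the characteristic function of $\mathcal I$, and $\mathcal{C}_{\mathbf d}=e^{ik\alpha\cdot\gamma}\bigoplus_{j=1}^{6}\mathbf{1}_{\mathcal{I}_j}\,(\mathbb{P}_{d_j}\circ\phi_j^{-1})\subset L^2(\partial K)$. The $\beta$-asymptotic Galerkin approximation based on frequency dependent changes of variables is $\hat\eta_\beta=\sigma_\beta+\hat\rho_\beta$, where $\hat\rho_\beta\in\mathcal{C}_{\mathbf d}$ is the unique solution of $\langle\hat\mu,\mathcal{R}_k\hat\rho_\beta\rangle=\langle\hat\mu,f_\beta\rangle$ for all $\hat\mu\in\mathcal{C}_{\mathbf d}$. *)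

theory Defs
  imports
    "HOL-Analysis.Analysis"
    "HOL-Library.Landau_Symbols"
    "HOL-Computational_Algebra.Polynomial"
begin

section \<open>Smooth functions of one real variable\<close>

definition nderiv :: "nat \<Rightarrow> (real \<Rightarrow> 'a::real_normed_vector) \<Rightarrow> real \<Rightarrow> 'a" where
  "nderiv n f = ((\<lambda>g x. vector_derivative g (at x)) ^^ n) f"

definition smooth_fun :: "(real \<Rightarrow> 'a::real_normed_vector) \<Rightarrow> bool" where
  "smooth_fun f \<longleftrightarrow> (\<forall>n x. nderiv n f differentiable (at x))"

definition periodic_fun :: "real \<Rightarrow> (real \<Rightarrow> 'a) \<Rightarrow> bool" where
  "periodic_fun T f \<longleftrightarrow> (\<forall>s. f (s + T) = f s)"


section \<open>The obstacle and the scattering problem\<close>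

definition right_normal :: "(real \<Rightarrow> real^2) \<Rightarrow> real \<Rightarrow> real^2" where
  "right_normal \<gamma> s = (let v = vector_derivative \<gamma> (at s) in vector [v $ 2, - v $ 1])"

text \<open>
  The last conjunct says that the tangent of \<open>\<gamma>\<close>, rotated by a right angle to the right, points out
  of the convex set \<open>K\<close>.  This expresses that \<open>\<gamma>\<close> runs counterclockwise, and it makes
  \<^term>\<open>right_normal \<gamma> s\<close> the exterior unit normal of \<open>K\<close> at \<open>\<gamma> s\<close>.
\<close>

definition obstacle :: "(real^2) set \<Rightarrow> real \<Rightarrow> (real \<Rightarrow> real^2) \<Rightarrow> bool" where
  "obstacle K P \<gamma> \<longleftrightarrow>
     compact K \<and>
     (\<forall>x\<in>K. \<forall>y\<in>K. x \<noteq> y \<longrightarrow> open_segment x y \<subseteq> interior K) \<and>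
     P > 0 \<and> smooth_fun \<gamma> \<and> periodic_fun (2 * P) \<gamma> \<and>
     (\<forall>s. norm (vector_derivative \<gamma> (at s)) = 1) \<and>
     inj_on \<gamma> {0..<2 * P} \<and> \<gamma> ` {0..2 * P} = frontier K \<and>
     (\<forall>s. \<forall>x\<in>K. right_normal \<gamma> s \<bullet> (x - \<gamma> s) \<le> 0)"

text \<open>\<open>t 1\<close> and \<open>t 2\<close> are the parameters of the two shadow boundary points.\<close>

definition shadow_boundaries ::
    "real \<Rightarrow> (real \<Rightarrow> real^2) \<Rightarrow> real^2 \<Rightarrow> (nat \<Rightarrow> real) \<Rightarrow> bool" where
  "shadow_boundaries P \<gamma> \<alpha> t \<longleftrightarrow>
     0 < t 1 \<and> t 1 < t 2 \<and> t 2 < 2 * P \<and> t 1 + t 2 = 2 * P \<and>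
     \<alpha> \<bullet> right_normal \<gamma> (t 1) = 0 \<and> \<alpha> \<bullet> right_normal \<gamma> (t 2) = 0 \<and>
     (\<forall>s\<in>{t 1<..<t 2}. \<alpha> \<bullet> right_normal \<gamma> s < 0) \<and>
     (\<forall>s\<in>{0..<t 1} \<union> {t 2<..2 * P}. \<alpha> \<bullet> right_normal \<gamma> s > 0)"

definition dir_deriv :: "real^2 \<Rightarrow> (real^2 \<Rightarrow> complex) \<Rightarrow> real^2 \<Rightarrow> complex" where
  "dir_deriv v w x = vector_derivative (\<lambda>h. w (x + h *\<^sub>R v)) (at 0)"

abbreviation partial_deriv :: "2 \<Rightarrow> (real^2 \<Rightarrow> complex) \<Rightarrow> real^2 \<Rightarrow> complex" where
  "partial_deriv i \<equiv> dir_deriv (axis i 1)"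

definition laplacian :: "(real^2 \<Rightarrow> complex) \<Rightarrow> real^2 \<Rightarrow> complex" where
  "laplacian w x = (\<Sum>i\<in>UNIV. partial_deriv i (partial_deriv i w) x)"

definition C2_on :: "(real^2) set \<Rightarrow> (real^2 \<Rightarrow> complex) \<Rightarrow> bool" where
  "C2_on S w \<longleftrightarrow>
     (\<forall>x\<in>S. w differentiable (at x)) \<and>
     (\<forall>i. \<forall>x\<in>S. partial_deriv i w differentiable (at x)) \<and>
     (\<forall>i j. continuous_on S (partial_deriv j (partial_deriv i w)))"

definition incident_field :: "real^2 \<Rightarrow> real \<Rightarrow> real^2 \<Rightarrow> complex" where
  "incident_field \<alpha> k x = exp (\<i> * complex_of_real (k * (\<alpha> \<bullet> x)))"

definition total_field ::
    "(real \<Rightarrow> real^2) \<Rightarrow> real^2 \<Rightarrow> (real \<Rightarrow> real^2 \<Rightarrow> complex) \<Rightarrow> real \<Rightarrow> real \<Rightarrow> complex" where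
  "total_field \<gamma> \<alpha> u s k = u k (\<gamma> s) + incident_field \<alpha> k (\<gamma> s)"

text \<open>
  Solutions are classical and regular up to the boundary: \<open>w\<close> is \<open>C\<^sup>2\<close> in the exterior, \<open>w\<close> and its
  first derivatives extend continuously to the closed exterior, and the boundary values, viewed as a
  function on the closed curve \<open>\<partial>K\<close> (including the point where the parametrization closes up), are
  smooth.  The normal derivative of \<open>w\<close> at the boundary is one-sided, from the exterior.
\<close>

definition scattering_solution ::
    "(real^2) set \<Rightarrow> (real \<Rightarrow> real^2) \<Rightarrow> real^2 \<Rightarrow> real \<Rightarrow> (real^2 \<Rightarrow> complex) \<Rightarrow> bool" where
  "scattering_solution K \<gamma> \<alpha> k w \<longleftrightarrow>
     C2_on (- K) w \<and>
     continuous_on (- interior K) w \<and>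
     (\<forall>i. \<exists>g. continuous_on (- interior K) g \<and> (\<forall>x\<in>- K. g x = partial_deriv i w x)) \<and>
     smooth_fun (\<lambda>s. w (\<gamma> s)) \<and>
     (\<forall>x\<in>- K. laplacian w x + complex_of_real (k\<^sup>2) * w x = 0) \<and>
     (\<forall>s. ((\<lambda>h. w (\<gamma> s + h *\<^sub>R right_normal \<gamma> s)) has_vector_derivative
            - dir_deriv (right_normal \<gamma> s) (incident_field \<alpha> k) (\<gamma> s)) (at 0 within {0..})) \<and>
     ((\<lambda>x. complex_of_real (sqrt (norm x)) *
            (dir_deriv (x /\<^sub>R norm x) w x - \<i> * complex_of_real k * w x)) \<longlongrightarrow> 0) at_infinity"

definition slow_field ::
    "(real \<Rightarrow> real^2) \<Rightarrow> real^2 \<Rightarrow> (real \<Rightarrow> real^2 \<Rightarrow> complex) \<Rightarrow> real \<Rightarrow> real \<Rightarrow> complex" where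
  "slow_field \<gamma> \<alpha> u s k =
     exp (- \<i> * complex_of_real (k * (\<alpha> \<bullet> \<gamma> s))) * total_field \<gamma> \<alpha> u s k"


section \<open>Symbol classes and the asymptotic expansion\<close>

text \<open>
  \<open>D n m\<close> is the mixed derivative of order \<open>n\<close> in \<open>s\<close> and \<open>m\<close> in \<open>k\<close>; on \<open>[0, 2P] \<times> (0, \<infinity>)\<close> it is
  determined by \<open>a\<close>.  The existence of such a family of continuous functions is smoothness of \<open>a\<close>.
\<close>

definition mixed_derivs ::
    "real \<Rightarrow> (real \<Rightarrow> real \<Rightarrow> complex) \<Rightarrow> (nat \<Rightarrow> nat \<Rightarrow> real \<Rightarrow> real \<Rightarrow> complex) \<Rightarrow> bool" where
  "mixed_derivs P a D \<longleftrightarrow>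
     (\<forall>s\<in>{0..2 * P}. \<forall>k>0. D 0 0 s k = a s k) \<and>
     (\<forall>n m. continuous_on ({0..2 * P} \<times> {0<..}) (\<lambda>(s, k). D n m s k)) \<and>
     (\<forall>n m. \<forall>s\<in>{0..2 * P}. \<forall>k>0.
        ((\<lambda>s. D n m s k) has_vector_derivative D (Suc n) m s k) (at s within {0..2 * P}) \<and>
        ((\<lambda>k. D n m s k) has_vector_derivative D n (Suc m) s k) (at k))"

definition symbol_class ::
    "real \<Rightarrow> real \<Rightarrow> real \<Rightarrow> real \<Rightarrow> (real \<Rightarrow> real \<Rightarrow> complex) set" where
  "symbol_class P \<mu> \<rho> \<delta> =
     {a. \<exists>D. mixed_derivs P a D \<and>
           (\<forall>n m. \<forall>\<kappa>>0. \<exists>C. \<forall>s\<in>{0..2 * P}. \<forall>k\<ge>\<kappa>.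
              norm (D n m s k) \<le> C * k powr (\<mu> + \<delta> * real n - \<rho> * real m))}"

type_synonym index = "nat \<times> nat \<times> nat \<times> int"

definition indices :: "index set" where
  "indices = {(p, q, r, l). l < 0}"

definition term_order :: "index \<Rightarrow> real" where
  "term_order = (\<lambda>(p, q, r, l).
     - (1 + 2 * real p + 3 * real q + real r + real_of_int l) / 3 + min (real_of_int l + 1) 0)"

definition expansion_term ::
    "(index \<Rightarrow> real \<Rightarrow> complex) \<Rightarrow> (real \<Rightarrow> real) \<Rightarrow> (nat \<Rightarrow> int \<Rightarrow> real \<Rightarrow> complex) \<Rightarrow>
     index \<Rightarrow> real \<Rightarrow> real \<Rightarrow> complex" where
  "expansion_term b Z \<Psi> = (\<lambda>(p, q, r, l) s k.
     complex_of_real (k powr term_order (p, q, r, l)) * b (p, q, r, l) s *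
     nderiv p (\<Psi> r l) (k powr (1/3) * Z s))"

text \<open>
  The \<open>N\<close>-th remainder of the expansion is a symbol of the order of the first omitted term: each
  derivative lowers the order by one.
\<close>

definition symbol_expansion_at_top ::
    "(real \<Rightarrow> complex) \<Rightarrow> (nat \<Rightarrow> complex) \<Rightarrow> (nat \<Rightarrow> int) \<Rightarrow> bool" where
  "symbol_expansion_at_top f c e \<longleftrightarrow>
     (\<forall>N n. (\<lambda>\<tau>. norm (nderiv n (\<lambda>x. f x - (\<Sum>j<N. c j * complex_of_real (x powi e j))) \<tau>))
              \<in> O[at_top](\<lambda>\<tau>. \<tau> powi (e N - int n)))"

definition rapidly_decreasing_at_bot :: "(real \<Rightarrow> complex) \<Rightarrow> bool" where
  "rapidly_decreasing_at_bot f \<longleftrightarrow>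
     (\<forall>n N. (\<lambda>\<tau>. norm (nderiv n f \<tau>)) \<in> O[at_bot](\<lambda>\<tau>. \<bar>\<tau>\<bar> powi (- int N)))"

definition expansion_data ::
    "real \<Rightarrow> (nat \<Rightarrow> real) \<Rightarrow> (index \<Rightarrow> real \<Rightarrow> complex) \<Rightarrow> (real \<Rightarrow> real) \<Rightarrow>
     (nat \<Rightarrow> int \<Rightarrow> real \<Rightarrow> complex) \<Rightarrow> bool" where
  "expansion_data P t b Z \<Psi> \<longleftrightarrow>
     (\<forall>i\<in>indices. smooth_fun (b i) \<and> periodic_fun (2 * P) (b i)) \<and>
     smooth_fun Z \<and> periodic_fun (2 * P) Z \<and>
     (\<forall>s\<in>{t 1<..<t 2}. Z s > 0) \<and>
     (\<forall>s\<in>{0..<t 1} \<union> {t 2<..2 * P}. Z s < 0) \<and>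
     (\<forall>j\<in>{1, 2}. Z (t j) = 0 \<and> vector_derivative Z (at (t j)) \<noteq> 0) \<and>
     (\<forall>r l. l < 0 \<longrightarrow>
        smooth_fun (\<Psi> r l) \<and>
        (\<exists>c. symbol_expansion_at_top (\<Psi> r l) c (\<lambda>j. 1 + l - 2 * int r - 3 * int j)) \<and>
        rapidly_decreasing_at_bot (\<Psi> r l))"

definition asymptotic_expansion ::
    "real \<Rightarrow> (real \<Rightarrow> real \<Rightarrow> complex) \<Rightarrow> (index \<Rightarrow> real \<Rightarrow> real \<Rightarrow> complex) \<Rightarrow> bool" where
  "asymptotic_expansion P g a \<longleftrightarrow>
     (\<forall>M>0. \<exists>F\<^sub>M. finite F\<^sub>M \<and> F\<^sub>M \<subseteq> indices \<and>
        (\<forall>F. finite F \<and> F\<^sub>M \<subseteq> F \<and> F \<subseteq> indices \<longrightarrow>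
           (\<lambda>s k. g s k - (\<Sum>i\<in>F. a i s k)) \<in> symbol_class P (- M) (2/3) (1/3)))"

definition vartheta :: "index \<Rightarrow> real" where
  "vartheta = (\<lambda>(p, q, r, l). term_order (p, q, r, l) +
     (if 1 + l - 2 * int r - int p < 0 then 0
      else real_of_int (1 + l - 2 * int r - int p) / 3))"

definition leading_indices :: "nat \<Rightarrow> index set" where
  "leading_indices \<beta> = {i \<in> indices. vartheta i > - real \<beta> / 3}"

lemma finite_leading_indices: "finite (leading_indices \<beta>)"
proof (rule finite_subset)
  show "leading_indices \<beta> \<subseteq> {..\<beta>} \<times> {..\<beta>} \<times> {..\<beta>} \<times> {- int \<beta> - 1..0}"
  proof
    fix i assume i: "i \<in> leading_indices \<beta>"
    obtain p q r l where pqrl: "i = (p, q, r, l)"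
      by (cases i)
    from i have l: "l < 0" and v: "vartheta (p, q, r, l) > - real \<beta> / 3"
      by (auto simp: pqrl leading_indices_def indices_def)
    have "1 + l - 2 * int r - int p \<le> 0"
      using l by linarith
    then have "(if 1 + l - 2 * int r - int p < 0 then 0
      else real_of_int (1 + l - 2 * int r - int p) / 3) = (0 :: real)"
      by auto
    moreover have "min (real_of_int l + 1) 0 = real_of_int l + 1"
      using l by (simp add: min_def)
    ultimately have "vartheta (p, q, r, l) =
        - real_of_int (2 * int p + 3 * int q + int r - 2 * (l + 1)) / 3"
      unfolding vartheta_def term_order_def by (simp add: field_simps)
    with v have "real_of_int (2 * int p + 3 * int q + int r - 2 * (l + 1)) < real_of_int (int \<beta>)"
      by simp
    then have "2 * int p + 3 * int q + int r - 2 * (l + 1) < int \<beta>"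
      by (simp only: of_int_less_iff)
    with l show "i \<in> {..\<beta>} \<times> {..\<beta>} \<times> {..\<beta>} \<times> {- int \<beta> - 1..0}"
      by (auto simp: pqrl)
  qed
qed auto

definition sigma ::
    "(real \<Rightarrow> real^2) \<Rightarrow> real^2 \<Rightarrow> (index \<Rightarrow> real \<Rightarrow> real \<Rightarrow> complex) \<Rightarrow> nat \<Rightarrow>
     real \<Rightarrow> real \<Rightarrow> complex" where
  "sigma \<gamma> \<alpha> a \<beta> s k =
     exp (\<i> * complex_of_real (k * (\<alpha> \<bullet> \<gamma> s))) * (\<Sum>i\<in>leading_indices \<beta>. a i s k)"


section \<open>Square integrable functions on the boundary\<close>

text \<open>
  Elements of \<open>L\<^sup>2(\<partial>K)\<close> are represented by \<open>2P\<close>-periodic functions of the arc length parameter, and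
  equality in \<open>L\<^sup>2(\<partial>K)\<close> is equality almost everywhere.
\<close>

definition L2 :: "real \<Rightarrow> (real \<Rightarrow> complex) set" where
  "L2 P = {f. f \<in> borel_measurable borel \<and> periodic_fun (2 * P) f \<and>
              set_integrable lborel {0..2 * P} (\<lambda>s. (norm (f s))\<^sup>2)}"

definition L2_inner :: "real \<Rightarrow> (real \<Rightarrow> complex) \<Rightarrow> (real \<Rightarrow> complex) \<Rightarrow> complex" where
  "L2_inner P f g = (LINT s:{0..2 * P}|lborel. cnj (f s) * g s)"

definition L2_norm :: "real \<Rightarrow> (real \<Rightarrow> complex) \<Rightarrow> real" where
  "L2_norm P f = sqrt (LINT s:{0..2 * P}|lborel. (norm (f s))\<^sup>2)"

text \<open>
  Compatibility of the operator \<open>R\<close> with equality almost everywhere need not be required: it follows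
  from linearity and continuity.
\<close>

definition continuous_coercive ::
    "real \<Rightarrow> ((real \<Rightarrow> complex) \<Rightarrow> real \<Rightarrow> complex) \<Rightarrow> real \<Rightarrow> real \<Rightarrow> bool" where
  "continuous_coercive P R C c \<longleftrightarrow>
     C > 0 \<and> c > 0 \<and>
     (\<forall>\<phi>\<in>L2 P. R \<phi> \<in> L2 P) \<and>
     (\<forall>\<phi>\<in>L2 P. \<forall>\<psi>\<in>L2 P. \<forall>z.
        AE s in lborel. R (\<lambda>x. \<phi> x + z * \<psi> x) s = R \<phi> s + z * R \<psi> s) \<and>
     (\<forall>\<mu>\<in>L2 P. \<forall>\<phi>\<in>L2 P. norm (L2_inner P \<mu> (R \<phi>)) \<le> C * L2_norm P \<mu> * L2_norm P \<phi>) \<and>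
     (\<forall>\<mu>\<in>L2 P. norm (L2_inner P \<mu> (R \<mu>)) \<ge> c * (L2_norm P \<mu>)\<^sup>2)"


section \<open>Regions, changes of variables and the Galerkin method\<close>

text \<open>
  \<open>\<xi>, \<xi>', \<zeta>, \<zeta>'\<close> and \<open>t\<close> are indexed by \<open>1, 2\<close>, the regions by \<open>1, \<dots>, 6\<close>.
\<close>

definition region_parameters ::
    "real \<Rightarrow> (nat \<Rightarrow> real) \<Rightarrow> (nat \<Rightarrow> real) \<Rightarrow> (nat \<Rightarrow> real) \<Rightarrow> (nat \<Rightarrow> real) \<Rightarrow> (nat \<Rightarrow> real) \<Rightarrow> bool"
  where
  "region_parameters P t \<xi> \<xi>' \<zeta> \<zeta>' \<longleftrightarrow>
     (\<forall>j\<in>{1, 2}. \<xi> j > 0 \<and> \<xi>' j > 0 \<and> \<zeta> j > 0 \<and> \<zeta>' j > 0) \<and>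
     t 1 + \<xi> 1 \<le> t 1 + \<xi>' 1 \<and> t 1 + \<xi>' 1 = t 2 - \<xi>' 2 \<and> t 2 - \<xi>' 2 \<le> t 2 - \<xi> 2 \<and>
     t 2 + \<zeta> 2 \<le> t 2 + \<zeta>' 2 \<and> t 2 + \<zeta>' 2 = 2 * P + t 1 - \<zeta>' 1 \<and>
     2 * P + t 1 - \<zeta>' 1 \<le> 2 * P + t 1 - \<zeta> 1"

definition left_end ::
    "(nat \<Rightarrow> real) \<Rightarrow> (nat \<Rightarrow> real) \<Rightarrow> (nat \<Rightarrow> real) \<Rightarrow> (nat \<Rightarrow> real) \<Rightarrow> (nat \<Rightarrow> real) \<Rightarrow>
     real \<Rightarrow> nat \<Rightarrow> real" where
  "left_end t \<xi> \<xi>' \<zeta> \<zeta>' k j =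
     (if j = 1 then t 1 + \<xi> 1 * k powr (- 1/3)
      else if j = 2 then t 2 - \<xi>' 2
      else if j = 3 then t 1 - \<zeta>' 1
      else if j = 4 then t 2 + \<zeta> 2 * k powr (- 1/3)
      else if j = 5 then t 1 - \<zeta> 1 * k powr (- 1/3)
      else t 2 - \<xi> 2 * k powr (- 1/3))"

definition right_end ::
    "(nat \<Rightarrow> real) \<Rightarrow> (nat \<Rightarrow> real) \<Rightarrow> (nat \<Rightarrow> real) \<Rightarrow> (nat \<Rightarrow> real) \<Rightarrow> (nat \<Rightarrow> real) \<Rightarrow>
     real \<Rightarrow> nat \<Rightarrow> real" where
  "right_end t \<xi> \<xi>' \<zeta> \<zeta>' k j =
     (if j = 1 then t 1 + \<xi>' 1
      else if j = 2 then t 2 - \<xi> 2 * k powr (- 1/3)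
      else if j = 3 then t 1 - \<zeta> 1 * k powr (- 1/3)
      else if j = 4 then t 2 + \<zeta>' 2
      else if j = 5 then t 1 + \<xi> 1 * k powr (- 1/3)
      else t 2 + \<zeta> 2 * k powr (- 1/3))"

definition region ::
    "(nat \<Rightarrow> real) \<Rightarrow> (nat \<Rightarrow> real) \<Rightarrow> (nat \<Rightarrow> real) \<Rightarrow> (nat \<Rightarrow> real) \<Rightarrow> (nat \<Rightarrow> real) \<Rightarrow>
     real \<Rightarrow> nat \<Rightarrow> real set" where
  "region t \<xi> \<xi>' \<zeta> \<zeta>' k j = {left_end t \<xi> \<xi>' \<zeta> \<zeta>' k j .. right_end t \<xi> \<xi>' \<zeta> \<zeta>' k j}"

definition change_of_var ::
    "(nat \<Rightarrow> real) \<Rightarrow> (nat \<Rightarrow> real) \<Rightarrow> (nat \<Rightarrow> real) \<Rightarrow> (nat \<Rightarrow> real) \<Rightarrow> (nat \<Rightarrow> real) \<Rightarrow>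
     real \<Rightarrow> nat \<Rightarrow> real \<Rightarrow> real" where
  "change_of_var t \<xi> \<xi>' \<zeta> \<zeta>' k j s =
     (let a = left_end t \<xi> \<xi>' \<zeta> \<zeta>' k j; b = right_end t \<xi> \<xi>' \<zeta> \<zeta>' k j in
      if j = 1 then
        t 1 + (\<xi> 1 + (\<xi>' 1 - \<xi> 1) * ((s - a) / (b - a))) * k powr (- (1/3) * ((b - s) / (b - a)))
      else if j = 2 then
        t 2 - (\<xi>' 2 + (\<xi> 2 - \<xi>' 2) * ((s - a) / (b - a))) * k powr (- (1/3) * ((s - a) / (b - a)))
      else if j = 3 then
        t 1 - (\<zeta>' 1 + (\<zeta> 1 - \<zeta>' 1) * ((s - a) / (b - a))) * k powr (- (1/3) * ((s - a) / (b - a)))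
      else if j = 4 then
        t 2 + (\<zeta> 2 + (\<zeta>' 2 - \<zeta> 2) * ((s - a) / (b - a))) * k powr (- (1/3) * ((b - s) / (b - a)))
      else s)"

text \<open>
  For \<open>k > 1\<close> the six regions cover \<open>[t\<^sub>1 - \<zeta>'\<^sub>1, t\<^sub>2 + \<zeta>'\<^sub>2]\<close>, an interval of length \<open>2P\<close>, and
  overlap only at end points.  Prescribing a periodic function almost everywhere on this interval
  therefore determines it as an element of \<open>L\<^sup>2(\<partial>K)\<close>, also where a region leaves \<open>[0, 2P]\<close>.
\<close>

definition galerkin_space ::
    "real \<Rightarrow> (real \<Rightarrow> real^2) \<Rightarrow> real^2 \<Rightarrow> (nat \<Rightarrow> real) \<Rightarrow> (nat \<Rightarrow> real) \<Rightarrow> (nat \<Rightarrow> real) \<Rightarrow>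
     (nat \<Rightarrow> real) \<Rightarrow> (nat \<Rightarrow> real) \<Rightarrow> real \<Rightarrow> (nat \<Rightarrow> nat) \<Rightarrow> (real \<Rightarrow> complex) set" where
  "galerkin_space P \<gamma> \<alpha> t \<xi> \<xi>' \<zeta> \<zeta>' k d =
     {v \<in> L2 P. \<exists>p :: nat \<Rightarrow> complex poly. (\<forall>j\<in>{1..6}. degree (p j) \<le> d j) \<and>
        (AE s in lborel. s \<in> {t 1 - \<zeta>' 1 .. t 2 + \<zeta>' 2} \<longrightarrow>
           v s = exp (\<i> * complex_of_real (k * (\<alpha> \<bullet> \<gamma> s))) *
             (\<Sum>j\<in>{1..6}. indicator (region t \<xi> \<xi>' \<zeta> \<zeta>' k j) s *
                poly (p j) (complex_of_real
                  (the_inv_into (region t \<xi> \<xi>' \<zeta> \<zeta>' k j) (change_of_var t \<xi> \<xi>' \<zeta> \<zeta>' k j) s))))}"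

definition galerkin_solution ::
    "real \<Rightarrow> (real \<Rightarrow> complex) set \<Rightarrow> ((real \<Rightarrow> complex) \<Rightarrow> real \<Rightarrow> complex) \<Rightarrow>
     (real \<Rightarrow> complex) \<Rightarrow> (real \<Rightarrow> complex) \<Rightarrow> bool" where
  "galerkin_solution P V R g v \<longleftrightarrow>
     v \<in> V \<and> (\<forall>\<mu>\<in>V. L2_inner P \<mu> (R v) = L2_inner P \<mu> g)"

end

theory Submission
  imports Defs
begin

text \<open>
  By the lemma of Cea (\<open>galerkin_quasi_optimal\<close>) the error of the method is at most
  \<open>C\<^sub>R k / c\<^sub>R k\<close> times the distance from \<open>\<eta> - \<sigma>\<close> to the trial space. So it suffices to exhibit one
  trial function that is close to \<open>\<eta> - \<sigma> = exp (\<i> k \<alpha> \<bullet> \<gamma>) \<cdot> g\<close>, where \<open>g\<close> is the slowly varying part of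
  the remainder. This is done on each of the six regions separately
  (\<open>galerkin_region_approximation\<close>), and the pieces are glued to a periodic function
  (\<open>piecewise_approximation\<close>).

  The derivatives of \<open>g\<close>. Each omitted term of the expansion has order at most \<open>- \<beta> / 3\<close> in \<open>k\<close>, and
  it depends on \<open>s\<close> through \<open>\<Psi> (k powr (1/3) * Z s)\<close>, where the \<open>m\<close>-th derivative of \<open>\<Psi>\<close> decays at
  least like \<open>(1 + \<bar>\<tau>\<bar>) powr (- m)\<close>. A derivative in \<open>s\<close> therefore costs a factor
  \<open>k powr (1/3) / (1 + k powr (1/3) * \<bar>Z s\<bar>)\<close>. As \<open>Z\<close> has simple zeros exactly at the shadow boundary
  points, this factor is comparable to the reciprocal of the distance \<open>w\<close> from \<open>s\<close> to the nearest of
  them, cut off at \<open>k powr (1/3)\<close>. Together with a remainder in a symbol class of very negative order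
  this gives \<open>\<bar>D\<^sup>m g\<bar> \<le> C k powr (- \<beta> / 3) w powr (- m)\<close> (\<open>slow_remainder_bound_on_period\<close>).

  The changes of variables. On the regions one to four the change of variables, written on the unit
  interval, is \<open>\<Phi> x = t \<plusminus> w x\<close> with \<open>w\<close> the product of a linear function and an exponential function
  of rate \<open>ln k / 3\<close>. Its \<open>i\<close>-th derivative is of size \<open>w (ln k) ^ i\<close>, so in the chain rule for
  \<open>g \<circ> \<Phi>\<close> every factor \<open>1 / w\<close> produced by \<open>g\<close> is compensated by a factor \<open>w\<close> produced by \<open>\<Phi>\<close>, and the
  \<open>n\<close>-th derivative of \<open>g \<circ> \<Phi>\<close> is of size \<open>k powr (- \<beta> / 3) (ln k) ^ n\<close> (\<open>layer_approximation\<close>). The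
  Jacobian, of size \<open>ln k\<close>, enters the norm through its square root. Around the shadow boundary points
  the interval has length of order \<open>k powr (- 1/3)\<close>, which compensates the factors \<open>k powr (1/3)\<close> in
  the same way (\<open>transition_approximation\<close>).

  Polynomials. A function on an interval with bounded \<open>n\<close>-th derivative is approximated in mean square
  by polynomials of degree \<open>d\<close> with an error of order \<open>d powr (- n)\<close> (\<open>complex_jackson\<close>). Under the
  substitution \<open>x = cos \<theta>\<close> a polynomial becomes a finite cosine sum, and cutting the sum off at
  frequency \<open>M\<close> leaves an error that is at most \<open>1 / M\<close> times the norm of its derivative
  (\<open>poly_truncation\<close>). Iterating this gives the rate for polynomials, and Weierstrass' theorem carries
  it over to smooth functions.
\<close>


section \<open>Smooth functions and the size of their derivatives\<close>

lemma nderiv_0 [simp]: "nderiv 0 f = f"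
  by (simp add: nderiv_def)

lemma nderiv_Suc: "nderiv (Suc n) f = (\<lambda>x. vector_derivative (nderiv n f) (at x))"
  by (simp add: nderiv_def)

lemma nderiv_nderiv: "nderiv m (nderiv n f) = nderiv (m + n) f"
  by (simp add: nderiv_def funpow_add)

lemma nderiv_Suc_inner: "nderiv (Suc n) f = nderiv n (nderiv 1 f)"
  by (simp add: nderiv_nderiv)

lemma smooth_fun_nderiv: "smooth_fun f \<Longrightarrow> smooth_fun (nderiv n f)"
  by (simp add: smooth_fun_def nderiv_nderiv)

lemma smooth_fun_has_deriv:
  assumes "smooth_fun f"
  shows "(nderiv n f has_vector_derivative nderiv (Suc n) f x) (at x)"
  using assms vector_derivative_works by (auto simp: smooth_fun_def nderiv_Suc)

lemma smooth_fun_has_deriv_1: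
  assumes "smooth_fun f"
  shows "(f has_vector_derivative nderiv 1 f x) (at x)"
  using smooth_fun_has_deriv[OF assms, of 0 x] by simp

lemma nderiv_1_eqI:
  assumes "\<And>x. (f has_vector_derivative f' x) (at x)"
  shows "nderiv 1 f = f'"
  using assms by (auto simp: nderiv_Suc vector_derivative_at)

lemma smooth_fun_continuous_on:
  assumes "smooth_fun f"
  shows "continuous_on S (nderiv n f)"
  by (meson assms continuous_at_imp_continuous_on has_vector_derivative_continuous
      smooth_fun_has_deriv)

lemma smooth_fun_continuous_on_0: "smooth_fun f \<Longrightarrow> continuous_on S f"
  using smooth_fun_continuous_on[of f S 0] by simp

text \<open>
  Concrete functions are handled by writing down all their derivatives at once: any sequence in which
  each member is the derivative of its predecessor is the sequence of iterated derivatives.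
\<close>
lemma derivative_sequence_nderiv:
  assumes "\<And>n x. (D n has_vector_derivative D (Suc n) x) (at x)"
  shows "nderiv n (D 0) = D n"
proof (induction n)
  case (Suc n)
  then show ?case
    using assms by (auto simp: nderiv_Suc vector_derivative_at)
qed simp

lemma derivative_sequence_smooth:
  assumes "\<And>n x. (D n has_vector_derivative D (Suc n) x) (at x)"
  shows "smooth_fun (D 0)"
  unfolding smooth_fun_def derivative_sequence_nderiv[where D = D, OF assms]
  using assms differentiableI_vector by blast

text \<open>
  A set of functions that is closed under differentiation consists of smooth functions. This gives
  closure under products and compositions without formulas for their higher derivatives.
\<close>
lemma smooth_fun_coinduct:
  assumes "f \<in> S"
    and step: "\<And>f. f \<in> S \<Longrightarrow> \<exists>f'\<in>S. \<forall>x. (f has_vector_derivative f' x) (at x)"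
  shows "smooth_fun f"
proof -
  obtain d where d: "\<forall>g\<in>S. d g \<in> S \<and> (\<forall>x. (g has_vector_derivative d g x) (at x))"
    using bchoice[of S "\<lambda>g g'. g' \<in> S \<and> (\<forall>x. (g has_vector_derivative g' x) (at x))"] step
    by blast
  have S: "(d ^^ n) f \<in> S" for n
    by (induction n) (auto simp: assms(1) d)
  then have "smooth_fun ((d ^^ 0) f)"
    using d by (intro derivative_sequence_smooth) simp
  then show ?thesis by simp
qed

lemma nderiv_bounded_linear:
  assumes L: "bounded_linear L" and f: "smooth_fun f"
  shows "nderiv n (\<lambda>x. L (f x)) = (\<lambda>x. L (nderiv n f x))"
  using derivative_sequence_nderiv[of "\<lambda>n x. L (nderiv n f x)" n]
    bounded_linear.has_vector_derivative[OF L smooth_fun_has_deriv[OF f]] by simp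

lemma smooth_fun_bounded_linear:
  assumes L: "bounded_linear L" and f: "smooth_fun f"
  shows "smooth_fun (\<lambda>x. L (f x))"
  using derivative_sequence_smooth[of "\<lambda>n x. L (nderiv n f x)"]
    bounded_linear.has_vector_derivative[OF L smooth_fun_has_deriv[OF f]] by simp

lemma
  assumes "smooth_fun f" "smooth_fun g"
  shows nderiv_add: "nderiv n (\<lambda>x. f x + g x) = (\<lambda>x. nderiv n f x + nderiv n g x)"
    and smooth_fun_add: "smooth_fun (\<lambda>x. f x + g x)"
  using derivative_sequence_nderiv[of "\<lambda>n x. nderiv n f x + nderiv n g x" n]
    derivative_sequence_smooth[of "\<lambda>n x. nderiv n f x + nderiv n g x"]
    has_vector_derivative_add[OF smooth_fun_has_deriv[OF assms(1)] smooth_fun_has_deriv[OF assms(2)]]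
  by simp_all

lemma smooth_fun_diff:
  assumes "smooth_fun f" "smooth_fun g"
  shows "smooth_fun (\<lambda>x. f x - g x)"
  using derivative_sequence_smooth[of "\<lambda>n x. nderiv n f x - nderiv n g x"]
    has_vector_derivative_diff[OF smooth_fun_has_deriv[OF assms(1)] smooth_fun_has_deriv[OF assms(2)]]
  by simp

lemma smooth_fun_const: "smooth_fun (\<lambda>x. c)"
  using derivative_sequence_smooth[of "\<lambda>n x. if n = 0 then c else 0"] by simp

lemma
  assumes "finite F" "\<And>i. i \<in> F \<Longrightarrow> smooth_fun (f i)"
  shows nderiv_sum: "nderiv n (\<lambda>x. \<Sum>i\<in>F. f i x) = (\<lambda>x. \<Sum>i\<in>F. nderiv n (f i) x)"
    and smooth_fun_sum: "smooth_fun (\<lambda>x. \<Sum>i\<in>F. f i x)"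
proof -
  have *: "((\<lambda>x. \<Sum>i\<in>F. nderiv n (f i) x) has_vector_derivative (\<Sum>i\<in>F. nderiv (Suc n) (f i) x)) (at x)"
    for n x
    using assms by (intro has_vector_derivative_sum smooth_fun_has_deriv) auto
  show "nderiv n (\<lambda>x. \<Sum>i\<in>F. f i x) = (\<lambda>x. \<Sum>i\<in>F. nderiv n (f i) x)"
    "smooth_fun (\<lambda>x. \<Sum>i\<in>F. f i x)"
    using derivative_sequence_nderiv[of "\<lambda>n x. \<Sum>i\<in>F. nderiv n (f i) x" n]
      derivative_sequence_smooth[of "\<lambda>n x. \<Sum>i\<in>F. nderiv n (f i) x"] * by simp_all
qed

inductive_set smooth_algebra :: "(real \<Rightarrow> complex) set" where
  base: "smooth_fun f \<Longrightarrow> f \<in> smooth_algebra"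
| add: "\<lbrakk>f \<in> smooth_algebra; g \<in> smooth_algebra\<rbrakk> \<Longrightarrow> (\<lambda>x. f x + g x) \<in> smooth_algebra"
| mult: "\<lbrakk>f \<in> smooth_algebra; g \<in> smooth_algebra\<rbrakk> \<Longrightarrow> (\<lambda>x. f x * g x) \<in> smooth_algebra"
| comp: "\<lbrakk>smooth_fun f; smooth_fun A\<rbrakk> \<Longrightarrow> (\<lambda>x. f (A x)) \<in> smooth_algebra"

lemma chain_rule_smooth:
  fixes G :: "real \<Rightarrow> complex" and A :: "real \<Rightarrow> real"
  assumes "smooth_fun G" "smooth_fun A"
  shows "((\<lambda>x. G (A x)) has_vector_derivative nderiv 1 G (A x) * complex_of_real (nderiv 1 A x)) (at x)"
  using vector_diff_chain_at[OF smooth_fun_has_deriv_1[OF assms(2)] smooth_fun_has_deriv_1[OF assms(1)]]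
  by (simp add: o_def scaleR_conv_of_real mult.commute)

text \<open>
  The sum, product and chain rules keep the derivative of every member inside the set. Sums are among
  its generators because the product rule produces them.
\<close>
lemma smooth_algebra_smooth:
  assumes "f \<in> smooth_algebra"
  shows "smooth_fun f"
  using assms
proof (rule smooth_fun_coinduct)
  fix f assume "f \<in> smooth_algebra"
  then show "\<exists>f'\<in>smooth_algebra. \<forall>x. (f has_vector_derivative f' x) (at x)"
  proof induction
    case (base f)
    then show ?case
      using smooth_fun_has_deriv_1 smooth_fun_nderiv smooth_algebra.base by blast
  next
    case (add f g)
    then obtain f' g' where "f' \<in> smooth_algebra" "\<forall>x. (f has_vector_derivative f' x) (at x)"
      "g' \<in> smooth_algebra" "\<forall>x. (g has_vector_derivative g' x) (at x)" by blast
    then show ?case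
      by (intro bexI[of _ "\<lambda>x. f' x + g' x"])
        (auto intro: smooth_algebra.add has_vector_derivative_add)
  next
    case (mult f g)
    then obtain f' g' where "f' \<in> smooth_algebra" "\<forall>x. (f has_vector_derivative f' x) (at x)"
      "g' \<in> smooth_algebra" "\<forall>x. (g has_vector_derivative g' x) (at x)" by blast
    with mult show ?case
      by (intro bexI[of _ "\<lambda>x. f x * g' x + f' x * g x"])
        (auto intro: smooth_algebra.add smooth_algebra.mult has_vector_derivative_mult)
  next
    case (comp f A)
    let ?A = "\<lambda>x. complex_of_real (nderiv 1 A x)" and ?G = "\<lambda>x. nderiv 1 f (A x)"
    have "?A \<in> smooth_algebra"
      by (rule smooth_algebra.base, rule smooth_fun_bounded_linear[OF bounded_linear_of_real],
          rule smooth_fun_nderiv, rule comp)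
    moreover have "?G \<in> smooth_algebra"
      by (rule smooth_algebra.comp, rule smooth_fun_nderiv, rule comp, rule comp)
    ultimately have *: "(\<lambda>x. ?G x * ?A x) \<in> smooth_algebra"
      by (rule smooth_algebra.mult[rotated])
    show ?case
      by (rule bexI[OF _ *]) (rule allI, rule chain_rule_smooth[OF comp])
  qed
qed

lemma smooth_fun_mult:
  fixes f g :: "real \<Rightarrow> complex"
  assumes "smooth_fun f" "smooth_fun g"
  shows "smooth_fun (\<lambda>x. f x * g x)"
  using assms by (rule smooth_algebra_smooth[OF smooth_algebra.mult[OF smooth_algebra.base smooth_algebra.base]])

lemma smooth_fun_compose:
  fixes f :: "real \<Rightarrow> complex" and A :: "real \<Rightarrow> real"
  assumes "smooth_fun f" "smooth_fun A"
  shows "smooth_fun (\<lambda>x. f (A x))"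
  using assms by (rule smooth_algebra_smooth[OF smooth_algebra.comp])

text \<open>
  Derivative bounds that grow geometrically are stable under products. One differentiation splits the
  product into two summands, each of which satisfies bounds of the same form with one more factor \<open>\<mu>\<close>;
  hence the constant doubles with every derivative, as the sum of the binomial coefficients does in
  the Leibniz rule.
\<close>
lemma nderiv_mult_bound:
  fixes f g :: "real \<Rightarrow> complex"
  assumes "smooth_fun f" "smooth_fun g" "a \<ge> 0" "b \<ge> 0" "\<mu> \<ge> 0"
    and "\<And>i. i \<le> n \<Longrightarrow> norm (nderiv i f x) \<le> a * \<mu> ^ i"
    and "\<And>i. i \<le> n \<Longrightarrow> norm (nderiv i g x) \<le> b * \<mu> ^ i"
  shows "norm (nderiv n (\<lambda>x. f x * g x) x) \<le> 2 ^ n * (a * b) * \<mu> ^ n"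
  using assms
proof (induction n arbitrary: f g a b)
  case 0
  show ?case
    using "0.prems"(6,7)[of 0] by (auto simp: norm_mult intro!: mult_mono \<open>a \<ge> 0\<close>)
next
  case (Suc n)
  let ?f = "nderiv 1 f" and ?g = "nderiv 1 g"
  have "nderiv 1 (\<lambda>x. f x * g x) = (\<lambda>x. f x * ?g x + ?f x * g x)"
    by (intro nderiv_1_eqI has_vector_derivative_mult smooth_fun_has_deriv_1 Suc.prems(1,2))
  then have eq: "nderiv (Suc n) (\<lambda>x. f x * g x) =
      (\<lambda>x. nderiv n (\<lambda>x. f x * ?g x) x + nderiv n (\<lambda>x. ?f x * g x) x)"
    by (simp only: nderiv_Suc_inner[of n] nderiv_add smooth_fun_mult smooth_fun_nderiv Suc.prems(1,2))
  have "norm (nderiv n (\<lambda>x. f x * ?g x) x) \<le> 2 ^ n * (a * (b * \<mu>)) * \<mu> ^ n"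
  proof (rule Suc.IH)
    show "norm (nderiv i ?g x) \<le> b * \<mu> * \<mu> ^ i" if "i \<le> n" for i
      using Suc.prems(7)[of "Suc i"] that by (simp add: nderiv_nderiv mult_ac)
  qed (use Suc.prems in \<open>auto intro: smooth_fun_nderiv\<close>)
  moreover have "norm (nderiv n (\<lambda>x. ?f x * g x) x) \<le> 2 ^ n * ((a * \<mu>) * b) * \<mu> ^ n"
  proof (rule Suc.IH)
    show "norm (nderiv i ?f x) \<le> a * \<mu> * \<mu> ^ i" if "i \<le> n" for i
      using Suc.prems(6)[of "Suc i"] that by (simp add: nderiv_nderiv mult_ac)
  qed (use Suc.prems in \<open>auto intro: smooth_fun_nderiv\<close>)
  ultimately show ?case
    unfolding eq by (intro order_trans[OF norm_triangle_ineq]) (simp add: algebra_simps)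
qed

primrec compose_const :: "real \<Rightarrow> nat \<Rightarrow> real" where
  "compose_const c 0 = 1"
| "compose_const c (Suc n) = compose_const c n + 2 ^ n * (compose_const c n * c)"

lemma compose_const_ge_1: "c \<ge> 0 \<Longrightarrow> compose_const c n \<ge> 1"
  by (induction n) (auto intro!: add_increasing2)

text \<open>
  A quantitative form of the formula of Faa di Bruno. A derivative that falls on the outer function
  costs \<open>\<nu>\<close> and comes with a derivative of the inner function, which is of size \<open>c * \<mu> ^ i / \<nu>\<close>; so
  \<open>\<nu>\<close> cancels. The rates \<open>\<nu>\<close> and \<open>\<mu>\<close> may depend on the point \<open>y\<close> and on parameters of \<open>G\<close> and \<open>A\<close>,
  since the constant depends on \<open>c\<close> and \<open>n\<close> only.
\<close>
lemma nderiv_compose_bound: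
  fixes G :: "real \<Rightarrow> complex" and A :: "real \<Rightarrow> real"
  assumes c: "c > 0" and A: "smooth_fun A" and \<nu>: "\<nu> > 0" and \<mu>: "\<mu> \<ge> 0"
    and "smooth_fun G" "B \<ge> 0" "m \<le> n"
    and "\<And>i. i \<le> m \<Longrightarrow> norm (nderiv i G (A y)) \<le> B * \<nu> ^ i"
    and "\<And>i. 1 \<le> i \<Longrightarrow> i \<le> m \<Longrightarrow> \<bar>nderiv i A y\<bar> * \<nu> \<le> c * \<mu> ^ i"
  shows "norm (nderiv m (\<lambda>x. G (A x)) y) \<le> compose_const c n * B * \<mu> ^ m"
  using assms(5-)
proof (induction n arbitrary: m G B)
  case 0
  then show ?case by fastforce
next
  case (Suc n)
  note G = Suc.prems(1) and B = Suc.prems(2) and hG = Suc.prems(4) and hA = Suc.prems(5)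
  let ?K = "compose_const c n" and ?K' = "compose_const c (Suc n)"
  have K: "?K \<ge> 1" using c by (intro compose_const_ge_1) simp
  show ?case
  proof (cases "m = Suc n")
    case False
    then have "norm (nderiv m (\<lambda>x. G (A x)) y) \<le> ?K * B * \<mu> ^ m"
      using Suc.prems by (intro Suc.IH[OF G B]) auto
    also have "\<dots> \<le> ?K' * B * \<mu> ^ m"
      using K c B \<mu> by (intro mult_right_mono) auto
    finally show ?thesis .
  next
    case True
    let ?G = "\<lambda>x. nderiv 1 G (A x)" and ?A = "\<lambda>x. complex_of_real (nderiv 1 A x)"
    have sG: "smooth_fun ?G"
      using smooth_fun_compose[OF smooth_fun_nderiv[OF G] A] .
    have sA: "smooth_fun ?A"
      using smooth_fun_bounded_linear[OF bounded_linear_of_real smooth_fun_nderiv[OF A]] .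
    have eq: "nderiv m (\<lambda>x. G (A x)) = nderiv n (\<lambda>x. ?G x * ?A x)"
      by (simp only: True nderiv_Suc_inner[of n] nderiv_1_eqI[OF chain_rule_smooth[OF G A]])
    have "norm (nderiv n (\<lambda>x. ?G x * ?A x) y) \<le> 2 ^ n * ((?K * (B * \<nu>)) * (c * \<mu> / \<nu>)) * \<mu> ^ n"
    proof (rule nderiv_mult_bound[OF sG sA])
      fix i assume i: "i \<le> n"
      show "norm (nderiv i ?G y) \<le> ?K * (B * \<nu>) * \<mu> ^ i"
      proof (rule Suc.IH[OF smooth_fun_nderiv[OF G] _ i])
        show "norm (nderiv j (nderiv 1 G) (A y)) \<le> B * \<nu> * \<nu> ^ j" if "j \<le> i" for j
          using hG[of "Suc j"] that i True by (simp add: nderiv_nderiv mult_ac)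
      qed (use B \<nu> hA True i in auto)
      have "\<bar>nderiv (Suc i) A y\<bar> * \<nu> \<le> c * \<mu> ^ Suc i"
        using hA[of "Suc i"] i True by simp
      then show "norm (nderiv i ?A y) \<le> c * \<mu> / \<nu> * \<mu> ^ i"
        using \<nu> by (simp add: nderiv_bounded_linear[OF bounded_linear_of_real smooth_fun_nderiv[OF A]]
            nderiv_nderiv field_simps)
    qed (use K B \<nu> c \<mu> in auto)
    also have "\<dots> = 2 ^ n * (?K * c) * B * \<mu> ^ m"
      using \<nu> by (simp add: True)
    also have "\<dots> \<le> ?K' * B * \<mu> ^ m"
      using K B \<mu> by (intro mult_right_mono) auto
    finally show ?thesis unfolding eq .
  qed
qed


section \<open>Polynomial approximation of smooth functions\<close>

text \<open>
  The integral of \<open>f\<^sup>2\<close> over \<open>[-1, 1]\<close> with the Chebyshev weight \<open>1 / sqrt (1 - x\<^sup>2)\<close>, in the variable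
  \<open>x = cos \<theta>\<close>.
\<close>
definition cheb_energy :: "(real \<Rightarrow> real) \<Rightarrow> real" where
  "cheb_energy f = integral {0..pi} (\<lambda>\<theta>. (f (cos \<theta>))\<^sup>2)"

lemma integral_cos_multiple:
  assumes "m \<noteq> (0::int)"
  shows "((\<lambda>\<theta>. cos (of_int m * \<theta>)) has_integral 0) {0..pi}"
proof -
  have "((\<lambda>\<theta>. cos (of_int m * \<theta>)) has_integral
      (sin (of_int m * pi) / of_int m - sin (of_int m * 0) / of_int m)) {0..pi}"
    using assms by (intro fundamental_theorem_of_calculus)
      (auto intro!: derivative_eq_intros simp: has_real_derivative_iff_has_vector_derivative[symmetric])
  moreover have "sin (of_int m * pi) = (0::real)"
    using sin_zero_iff_int2 by auto
  ultimately show ?thesis by simp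
qed

lemma cos_orthogonal:
  fixes m l :: nat
  assumes "m > 0" "l > 0"
  shows "((\<lambda>\<theta>. cos (real m * \<theta>) * cos (real l * \<theta>)) has_integral (if m = l then pi/2 else 0)) {0..pi}"
    and "((\<lambda>\<theta>. sin (real m * \<theta>) * sin (real l * \<theta>)) has_integral (if m = l then pi/2 else 0)) {0..pi}"
proof -
  have 1: "((\<lambda>\<theta>. cos (real m * \<theta> - real l * \<theta>)) has_integral (if m = l then pi else 0)) {0..pi}"
    using integral_cos_multiple[of "int m - int l"] has_integral_const_real[of "1::real" 0 pi]
    by (auto simp: algebra_simps)
  have 2: "((\<lambda>\<theta>. cos (real m * \<theta> + real l * \<theta>)) has_integral 0) {0..pi}"
    using integral_cos_multiple[of "int m + int l"] assms by (auto simp: algebra_simps)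
  show "((\<lambda>\<theta>. cos (real m * \<theta>) * cos (real l * \<theta>)) has_integral (if m = l then pi/2 else 0)) {0..pi}"
    using has_integral_divide[OF has_integral_add[OF 1 2], of 2]
    by (auto simp: cos_times_cos)
  show "((\<lambda>\<theta>. sin (real m * \<theta>) * sin (real l * \<theta>)) has_integral (if m = l then pi/2 else 0)) {0..pi}"
    using has_integral_divide[OF has_integral_diff[OF 1 2], of 2]
    by (auto simp: sin_times_sin)
qed

text \<open>Parseval's identity for finite sums.\<close>
lemma has_integral_square_orthogonal:
  fixes e :: "nat \<Rightarrow> real \<Rightarrow> real"
  assumes "finite S"
    and e: "\<And>m l. m \<in> S \<Longrightarrow> l \<in> S \<Longrightarrow>
      ((\<lambda>\<theta>. e m \<theta> * e l \<theta>) has_integral (if m = l then I else 0)) X"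
  shows "((\<lambda>\<theta>. (\<Sum>m\<in>S. c m * e m \<theta>)\<^sup>2) has_integral (\<Sum>m\<in>S. (c m)\<^sup>2 * I)) X"
proof -
  have "((\<lambda>\<theta>. \<Sum>m\<in>S. \<Sum>l\<in>S. (c m * c l) * (e m \<theta> * e l \<theta>)) has_integral
      (\<Sum>m\<in>S. \<Sum>l\<in>S. (c m * c l) * (if m = l then I else 0))) X"
    by (intro has_integral_sum has_integral_mult_right e assms(1))
  also have "(\<Sum>m\<in>S. \<Sum>l\<in>S. (c m * c l) * (if m = l then I else 0)) = (\<Sum>m\<in>S. (c m)\<^sup>2 * I)"
    using assms(1) by (intro sum.cong) (auto simp: if_distrib power2_eq_square cong: if_cong)
  also have "(\<lambda>\<theta>. \<Sum>m\<in>S. \<Sum>l\<in>S. (c m * c l) * (e m \<theta> * e l \<theta>)) = (\<lambda>\<theta>. (\<Sum>m\<in>S. c m * e m \<theta>)\<^sup>2)"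
    by (simp add: power2_eq_square sum_product mult_ac)
  finally show ?thesis .
qed

lemma chebyshev_poly_exists:
  "\<exists>T :: real poly. degree T \<le> m \<and> (\<forall>\<theta>. poly T (cos \<theta>) = cos (real m * \<theta>))"
proof (induction m rule: less_induct)
  case (less m)
  consider "m = 0" | "m = 1" | l where "m = Suc (Suc l)"
    by (metis One_nat_def not0_implies_Suc)
  then show ?case
  proof cases
    case 1 then show ?thesis by (intro exI[of _ 1]) auto
  next
    case 2 then show ?thesis by (intro exI[of _ "[:0,1:]"]) auto
  next
    case 3
    obtain T1 T0 :: "real poly" where
      T1: "degree T1 \<le> Suc l" "\<And>\<theta>. poly T1 (cos \<theta>) = cos (real (Suc l) * \<theta>)" and
      T0: "degree T0 \<le> l" "\<And>\<theta>. poly T0 (cos \<theta>) = cos (real l * \<theta>)"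
      using less.IH[of "Suc l"] less.IH[of l] 3 by auto
    show ?thesis
    proof (intro exI[of _ "pCons 0 (smult 2 T1) - T0"] conjI allI)
      show "degree (pCons 0 (smult 2 T1) - T0) \<le> m"
        using T1(1) T0(1) 3 by (intro degree_diff_le order_trans[OF degree_pCons_le]) auto
      fix \<theta>
      have "cos (real m * \<theta>) + cos (real l * \<theta>) = 2 * (cos \<theta> * cos (real (Suc l) * \<theta>))"
        by (simp add: 3 cos_times_cos algebra_simps)
      then show "poly (pCons 0 (smult 2 T1) - T0) (cos \<theta>) = cos (real m * \<theta>)"
        by (simp add: T1(2) T0(2))
    qed
  qed
qed

text \<open>
  The functions of this form are closed under addition and under multiplication by \<open>cos \<theta>\<close>, which is
  all that Horner's scheme needs.
\<close>
lemma poly_cos_expansion: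
  fixes p :: "real poly"
  shows "\<exists>c N. \<forall>\<theta>. poly p (cos \<theta>) = (\<Sum>m\<le>N. c m * cos (real m * \<theta>))"
proof -
  define X where "X = {f :: real \<Rightarrow> real. \<exists>c N. \<forall>\<theta>. f \<theta> = (\<Sum>m\<le>N. c m * cos (real m * \<theta>))}"
  have add: "(\<lambda>\<theta>. f \<theta> + g \<theta>) \<in> X" if "f \<in> X" "g \<in> X" for f g
  proof -
    obtain c N where f: "\<And>\<theta>. f \<theta> = (\<Sum>m\<le>N. c m * cos (real m * \<theta>))"
      using \<open>f \<in> X\<close> unfolding X_def by blast
    obtain c' N' where g: "\<And>\<theta>. g \<theta> = (\<Sum>m\<le>N'. c' m * cos (real m * \<theta>))"
      using \<open>g \<in> X\<close> unfolding X_def by blast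
    define d where "d = (\<lambda>m. (if m \<le> N then c m else 0) + (if m \<le> N' then c' m else 0))"
    have "f \<theta> + g \<theta> = (\<Sum>m\<le>max N N'. d m * cos (real m * \<theta>))" for \<theta>
    proof -
      have "f \<theta> = (\<Sum>m\<le>max N N'. (if m \<le> N then c m else 0) * cos (real m * \<theta>))"
        unfolding f by (rule sum.mono_neutral_cong_left) auto
      moreover have "g \<theta> = (\<Sum>m\<le>max N N'. (if m \<le> N' then c' m else 0) * cos (real m * \<theta>))"
        unfolding g by (rule sum.mono_neutral_cong_left) auto
      ultimately show ?thesis
        by (simp add: d_def distrib_right sum.distrib)
    qed
    then show ?thesis unfolding X_def by blast
  qed
  have one: "(\<lambda>\<theta>. a * cos (real m * \<theta>)) \<in> X" for a m
  proof -
    have "a * cos (real m * \<theta>) = (\<Sum>l\<le>m. (if l = m then a else 0) * cos (real l * \<theta>))" for \<theta>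
    proof -
      have "(\<Sum>l\<le>m. (if l = m then a else 0) * cos (real l * \<theta>)) =
          (\<Sum>l\<le>m. if l = m then a * cos (real m * \<theta>) else 0)"
        by (rule sum.cong) auto
      then show ?thesis by simp
    qed
    then show ?thesis unfolding X_def by (intro CollectI exI allI)
  qed
  have sum: "(\<lambda>\<theta>. \<Sum>m\<in>S. f m \<theta>) \<in> X" if "finite S" "\<And>m. f m \<in> X" for S :: "nat set" and f
    using that
  proof (induction S)
    case empty
    show ?case using one[of 0 0] by simp
  next
    case (insert x S)
    then show ?case using add[of "f x" "\<lambda>\<theta>. \<Sum>m\<in>S. f m \<theta>"] by simp
  qed
  have mult_cos: "(\<lambda>\<theta>. cos \<theta> * f \<theta>) \<in> X" if "f \<in> X" for f
  proof -
    obtain c N where f: "\<And>\<theta>. f \<theta> = (\<Sum>m\<le>N. c m * cos (real m * \<theta>))"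
      using \<open>f \<in> X\<close> unfolding X_def by blast
    have "(\<lambda>\<theta>. c m * (cos \<theta> * cos (real m * \<theta>))) \<in> X" for m
    proof (cases m)
      case 0
      then show ?thesis using one[of "c m" 1] by simp
    next
      case (Suc l)
      have "c m * (cos \<theta> * cos (real m * \<theta>)) =
          c m / 2 * cos (real l * \<theta>) + c m / 2 * cos (real (Suc m) * \<theta>)" for \<theta>
        by (simp add: Suc cos_times_cos algebra_simps add_divide_distrib)
           (simp add: cos_minus[symmetric, of \<theta>] algebra_simps)?
      then show ?thesis
        using add[OF one[of "c m / 2" l] one[of "c m / 2" "Suc m"]] by simp
    qed
    then have "(\<lambda>\<theta>. \<Sum>m\<le>N. c m * (cos \<theta> * cos (real m * \<theta>))) \<in> X"
      by (intro sum) auto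
    then show ?thesis
      by (simp add: f sum_distrib_left mult_ac)
  qed
  have "(\<lambda>\<theta>. poly p (cos \<theta>)) \<in> X"
  proof (induction p)
    case 0
    show ?case using one[of 0 0] by simp
  next
    case (pCons a p)
    then show ?case
      using add[OF one[of a 0] mult_cos[OF pCons.IH]] by simp
  qed
  then show ?thesis unfolding X_def by blast
qed

lemma continuous_on_imp_cheb_integrable:
  fixes f :: "real \<Rightarrow> real"
  assumes "continuous_on {-1..1} f"
  shows "(\<lambda>\<theta>. (f (cos \<theta>))\<^sup>2) integrable_on {0..pi}"
proof -
  have "continuous_on {0..pi} (\<lambda>\<theta>. f (cos \<theta>))"
    by (rule continuous_on_compose2[OF assms]) (auto intro!: continuous_intros)
  then show ?thesis
    by (intro integrable_continuous_real continuous_on_power)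
qed

lemma cheb_energy_mono:
  assumes "continuous_on {-1..1} f" "continuous_on {-1..1} g"
    and "\<And>x. x \<in> {-1..1} \<Longrightarrow> \<bar>f x\<bar> \<le> \<bar>g x\<bar>"
  shows "cheb_energy f \<le> cheb_energy g"
  unfolding cheb_energy_def
  using assms(3) by (intro integral_le continuous_on_imp_cheb_integrable assms(1,2))
    (auto simp: abs_le_square_iff[symmetric])

text \<open>
  Cut the cosine expansion of \<open>p\<close> with coefficients \<open>c m\<close> off at frequency \<open>M\<close>. The energy of the tail
  is a multiple of the sum of \<open>(c m)\<^sup>2\<close> over \<open>m \<ge> M\<close>, hence at most \<open>1 / M\<^sup>2\<close> times the same multiple of the sum of
  \<open>(m * c m)\<^sup>2\<close> over all \<open>m\<close>. By orthogonality of the sines the latter is the square integral of the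
  derivative of \<open>p (cos \<theta>)\<close>, which is \<open>- sin \<theta>\<close> times \<open>p'\<close> at \<open>cos \<theta>\<close>. Here and below, vanishing of
  the coefficients from \<open>M\<close> on expresses that the degree is less than \<open>M\<close>, including \<open>M = 0\<close>.
\<close>
lemma poly_truncation:
  fixes p :: "real poly"
  assumes "M \<ge> 1"
  shows "\<exists>q. (\<forall>i\<ge>M. coeff q i = 0) \<and>
    cheb_energy (poly (p - q)) \<le> cheb_energy (poly (pderiv p)) / (real M)\<^sup>2"
proof -
  obtain c N where c: "\<And>\<theta>. poly p (cos \<theta>) = (\<Sum>m\<le>N. c m * cos (real m * \<theta>))"
    using poly_cos_expansion by blast
  obtain T :: "nat \<Rightarrow> real poly" where T: "\<And>m. degree (T m) \<le> m"
    "\<And>m \<theta>. poly (T m) (cos \<theta>) = cos (real m * \<theta>)"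
    using chebyshev_poly_exists by metis
  define q where "q = (\<Sum>m\<in>{..N} \<inter> {..<M}. smult (c m) (T m))"
  have q: "coeff q i = 0" if "i \<ge> M" for i
    unfolding q_def coeff_sum
    using that by (intro sum.neutral) (auto intro!: coeff_eq_0 le_less_trans[OF T(1)])
  let ?S = "{M..N}"
  have diff: "poly (p - q) (cos \<theta>) = (\<Sum>m\<in>?S. c m * cos (real m * \<theta>))" for \<theta>
  proof -
    have "(\<Sum>m\<le>N. c m * cos (real m * \<theta>)) =
        (\<Sum>m\<in>{..N} \<inter> {..<M}. c m * cos (real m * \<theta>)) + (\<Sum>m\<in>?S. c m * cos (real m * \<theta>))"
      by (subst sum.union_disjoint[symmetric]) (auto intro!: sum.cong)
    then show ?thesis
      by (simp add: c q_def poly_sum T(2))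
  qed
  have E1: "cheb_energy (poly (p - q)) = (\<Sum>m\<in>?S. (c m)\<^sup>2 * (pi/2))"
    unfolding cheb_energy_def diff
    using assms by (intro integral_unique has_integral_square_orthogonal cos_orthogonal) auto
  have deriv: "sin \<theta> * poly (pderiv p) (cos \<theta>) = (\<Sum>m\<in>{1..N}. (c m * real m) * sin (real m * \<theta>))" for \<theta>
  proof -
    have "((\<lambda>\<theta>. poly p (cos \<theta>)) has_real_derivative (poly (pderiv p) (cos \<theta>) * - sin \<theta>)) (at \<theta>)"
      by (auto intro!: derivative_eq_intros DERIV_chain'[OF _ poly_DERIV])
    moreover have "((\<lambda>\<theta>. \<Sum>m\<le>N. c m * cos (real m * \<theta>)) has_real_derivative
        (\<Sum>m\<le>N. c m * (- sin (real m * \<theta>) * real m))) (at \<theta>)"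
      by (auto intro!: derivative_eq_intros sum.cong)
    ultimately have "poly (pderiv p) (cos \<theta>) * - sin \<theta> = (\<Sum>m\<le>N. c m * (- sin (real m * \<theta>) * real m))"
      using DERIV_unique unfolding c by blast
    then have "sin \<theta> * poly (pderiv p) (cos \<theta>) = (\<Sum>m\<le>N. (c m * real m) * sin (real m * \<theta>))"
      by (simp add: sum_negf mult_ac)
    also have "\<dots> = (\<Sum>m\<in>{1..N}. (c m * real m) * sin (real m * \<theta>))"
      by (rule sum.mono_neutral_right) auto
    finally show ?thesis .
  qed
  have I: "((\<lambda>\<theta>. (sin \<theta> * poly (pderiv p) (cos \<theta>))\<^sup>2) has_integral (\<Sum>m\<in>{1..N}. (c m * real m)\<^sup>2 * (pi/2))) {0..pi}"
    unfolding deriv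
    by (intro has_integral_square_orthogonal cos_orthogonal) auto
  have "(real M)\<^sup>2 * cheb_energy (poly (p - q)) = (\<Sum>m\<in>?S. (real M)\<^sup>2 * ((c m)\<^sup>2 * (pi/2)))"
    unfolding E1 by (simp add: sum_distrib_left)
  also have "\<dots> \<le> (\<Sum>m\<in>?S. (c m * real m)\<^sup>2 * (pi/2))"
  proof (rule sum_mono)
    fix m assume "m \<in> ?S"
    then have "(real M)\<^sup>2 \<le> (real m)\<^sup>2"
      by (intro power_mono) auto
    then show "(real M)\<^sup>2 * ((c m)\<^sup>2 * (pi/2)) \<le> (c m * real m)\<^sup>2 * (pi/2)"
      using mult_right_mono[of "(real M)\<^sup>2" "(real m)\<^sup>2" "(c m)\<^sup>2 * (pi/2)"]
      by (simp add: power_mult_distrib mult_ac)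
  qed
  also have "\<dots> \<le> (\<Sum>m\<in>{1..N}. (c m * real m)\<^sup>2 * (pi/2))"
    using assms by (intro sum_mono2) auto
  also have "\<dots> = integral {0..pi} (\<lambda>\<theta>. (sin \<theta> * poly (pderiv p) (cos \<theta>))\<^sup>2)"
    using I by (simp add: integral_unique)
  also have "\<dots> \<le> cheb_energy (poly (pderiv p))"
    unfolding cheb_energy_def
  proof (rule integral_le)
    show "(\<lambda>\<theta>. (sin \<theta> * poly (pderiv p) (cos \<theta>))\<^sup>2) integrable_on {0..pi}"
      using I by blast
    show "(\<lambda>\<theta>. (poly (pderiv p) (cos \<theta>))\<^sup>2) integrable_on {0..pi}"
      by (intro continuous_on_imp_cheb_integrable) (auto intro!: continuous_intros)
    show "(sin \<theta> * poly (pderiv p) (cos \<theta>))\<^sup>2 \<le> (poly (pderiv p) (cos \<theta>))\<^sup>2" for \<theta>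
      by (simp add: power_mult_distrib mult_left_le_one_le abs_square_le_1)
  qed
  finally have "cheb_energy (poly (p - q)) \<le> cheb_energy (poly (pderiv p)) / (real M)\<^sup>2"
    using assms by (simp add: field_simps)
  with q show ?thesis by blast
qed

lemma poly_antiderivative_exists:
  fixes q :: "real poly"
  assumes "\<And>i. i \<ge> M \<Longrightarrow> coeff q i = 0"
  shows "\<exists>Q. pderiv Q = q \<and> (\<forall>i\<ge>Suc M. coeff Q i = 0)"
proof -
  define Q where "Q = (\<Sum>i\<le>degree q. monom (coeff q i / real (Suc i)) (Suc i))"
  have "pderiv Q = (\<Sum>i\<le>degree q. monom (coeff q i) i)"
    unfolding Q_def by (simp add: higher_pderiv_sum[of 1, simplified] pderiv_monom del: of_nat_Suc)
  then have "pderiv Q = q"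
    by (simp add: poly_as_sum_of_monoms)
  moreover have "coeff Q i = 0" if "i \<ge> Suc M" for i
    unfolding Q_def coeff_sum using that assms by (intro sum.neutral) (auto simp: coeff_monom)
  ultimately show ?thesis by blast
qed

text \<open>
  Induction on \<open>n\<close>: approximate \<open>pderiv p\<close> with the induction hypothesis, take an antiderivative \<open>Q\<close>
  of the approximation, and truncate \<open>p - Q\<close>, whose derivative is the error already estimated. The
  degree drops by one at each differentiation, so the bound first involves \<open>M - 1\<close>.
\<close>
lemma poly_jackson:
  "\<exists>K>0. \<forall>(p :: real poly) M. M \<ge> n \<longrightarrow> (\<exists>q. (\<forall>i\<ge>M. coeff q i = 0) \<and>
     cheb_energy (poly (p - q)) \<le> K * cheb_energy (poly ((pderiv ^^ n) p)) / (real M ^ n)\<^sup>2)"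
proof (induction n)
  case 0
  show ?case by (intro exI[of _ 1] conjI allI impI exI[of _ 0]) auto
next
  case (Suc n)
  then obtain K where K: "K > 0" and IH: "\<And>(p :: real poly) M. M \<ge> n \<Longrightarrow> (\<exists>q. (\<forall>i\<ge>M. coeff q i = 0) \<and>
     cheb_energy (poly (p - q)) \<le> K * cheb_energy (poly ((pderiv ^^ n) p)) / (real M ^ n)\<^sup>2)"
    by blast
  show ?case
  proof (intro exI[of _ "(2 ^ n)\<^sup>2 * K"] conjI allI impI)
    show "(2 ^ n)\<^sup>2 * K > 0" using K by simp
    fix p :: "real poly" and M assume M: "M \<ge> Suc n"
    then obtain M' where M': "M = Suc M'" "M' \<ge> n" by (cases M) auto
    obtain q1 where q1: "\<And>i. i \<ge> M' \<Longrightarrow> coeff q1 i = 0"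
      "cheb_energy (poly (pderiv p - q1)) \<le> K * cheb_energy (poly ((pderiv ^^ n) (pderiv p))) / (real M' ^ n)\<^sup>2"
      using IH[OF M'(2), of "pderiv p"] by blast
    obtain Q where Q: "pderiv Q = q1" "\<And>i. i \<ge> M \<Longrightarrow> coeff Q i = 0"
      using poly_antiderivative_exists[OF q1(1)] M' by blast
    obtain q2 where q2: "\<And>i. i \<ge> M \<Longrightarrow> coeff q2 i = 0"
      "cheb_energy (poly (p - Q - q2)) \<le> cheb_energy (poly (pderiv (p - Q))) / (real M)\<^sup>2"
      using poly_truncation[of M "p - Q"] M by auto
    let ?E = "cheb_energy (poly ((pderiv ^^ Suc n) p))"
    have E: "?E \<ge> 0"
      unfolding cheb_energy_def by (rule integral_nonneg)
        (auto intro!: continuous_on_imp_cheb_integrable continuous_intros)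
    \<comment> \<open>\<open>M \<le> 2 * M'\<close> unless \<open>M' = 0\<close>, which forces \<open>n = 0\<close>\<close>
    have pow: "real M ^ n \<le> 2 ^ n * real M' ^ n"
    proof (cases "n = 0")
      case False
      then have "real M ^ n \<le> (2 * real M') ^ n"
        using M' by (intro power_mono) auto
      then show ?thesis by (simp add: power_mult_distrib)
    qed auto
    have "cheb_energy (poly (p - Q - q2)) \<le> cheb_energy (poly (pderiv p - q1)) / (real M)\<^sup>2"
      using q2(2) by (simp add: pderiv_diff Q(1))
    also have "\<dots> \<le> K * ?E / (real M' ^ n)\<^sup>2 / (real M)\<^sup>2"
      using q1(2) by (intro divide_right_mono) (auto simp: funpow_swap1)
    also have "K * ?E / (real M' ^ n)\<^sup>2 \<le> (2 ^ n)\<^sup>2 * K * ?E / (real M ^ n)\<^sup>2"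
    proof -
      have "real M' ^ n > 0"
        using M' by (cases "n = 0") auto
      moreover have "(real M ^ n)\<^sup>2 \<le> (2 ^ n)\<^sup>2 * (real M' ^ n)\<^sup>2"
        using power_mono[OF pow, of 2] by (simp add: power_mult_distrib)
      then have "K * ?E * (real M ^ n)\<^sup>2 \<le> K * ?E * ((2 ^ n)\<^sup>2 * (real M' ^ n)\<^sup>2)"
        using K E by (intro mult_left_mono) auto
      ultimately show ?thesis
        using M' by (simp add: field_simps)
    qed
    finally have "cheb_energy (poly (p - Q - q2)) \<le> (2 ^ n)\<^sup>2 * K * ?E / (real M ^ Suc n)\<^sup>2"
      by (simp add: power_mult_distrib divide_right_mono mult_ac)
    then show "\<exists>q. (\<forall>i\<ge>M. coeff q i = 0) \<and>
      cheb_energy (poly (p - q)) \<le> (2 ^ n)\<^sup>2 * K * cheb_energy (poly ((pderiv ^^ Suc n) p)) / (real M ^ Suc n)\<^sup>2"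
      using Q(2) q2(1) by (intro exI[of _ "Q + q2"]) (auto simp: diff_diff_add)
  qed
qed

text \<open>
  Weierstrass' theorem for the highest derivative, followed by \<open>n\<close> integrations; the constants of
  integration are chosen so that the values at \<open>0\<close> agree.
\<close>
lemma smooth_poly_approx:
  fixes h :: "real \<Rightarrow> real"
  assumes "smooth_fun h" "\<epsilon> > 0"
  shows "\<exists>p. \<forall>x\<in>{-1..1}. \<bar>h x - poly p x\<bar> \<le> \<epsilon> \<and> \<bar>nderiv n h x - poly ((pderiv ^^ n) p) x\<bar> \<le> \<epsilon>"
  using assms
proof (induction n arbitrary: h)
  case 0
  obtain g where "polynomial_function g" and g: "\<And>x. x \<in> {-1..1} \<Longrightarrow> norm (h x - g x) < \<epsilon>"
    using Stone_Weierstrass_polynomial_function[of "{-1..1::real}" h \<epsilon>] 0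
      smooth_fun_continuous_on_0[of h] by auto
  then have "real_polynomial_function g"
    by (simp add: real_polynomial_function_eq)
  then obtain a N where a: "g = (\<lambda>x. \<Sum>i\<le>N. a i * x ^ i)"
    by (auto simp: real_polynomial_function_iff_sum)
  have "g x = poly (\<Sum>i\<le>N. monom (a i) i) x" for x
    by (simp add: a poly_sum poly_monom)
  then show ?case
    using g by (intro exI[of _ "\<Sum>i\<le>N. monom (a i) i"]) (auto simp: less_imp_le)
next
  case (Suc n)
  obtain p1 where p1: "\<And>x. x \<in> {-1..1} \<Longrightarrow> \<bar>nderiv 1 h x - poly p1 x\<bar> \<le> \<epsilon>"
    "\<And>x. x \<in> {-1..1} \<Longrightarrow> \<bar>nderiv n (nderiv 1 h) x - poly ((pderiv ^^ n) p1) x\<bar> \<le> \<epsilon>"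
    using Suc.IH[OF smooth_fun_nderiv[OF Suc.prems(1)] Suc.prems(2)] by blast
  obtain Q where Q: "pderiv Q = p1"
    using poly_antiderivative_exists[of "Suc (degree p1)" p1] by (auto simp: coeff_eq_0)
  define p where "p = Q + [:h 0 - poly Q 0:]"
  have p: "pderiv p = p1"
    by (simp add: p_def pderiv_add pderiv_pCons Q)
  have p0: "poly p 0 = h 0"
    by (simp add: p_def)
  have der: "((\<lambda>x. h x - poly p x) has_real_derivative nderiv 1 h x - poly p1 x) (at x within S)" for x S
  proof (rule DERIV_diff)
    show "(h has_real_derivative nderiv 1 h x) (at x within S)"
      unfolding has_real_derivative_iff_has_vector_derivative
      by (rule has_vector_derivative_at_within[OF smooth_fun_has_deriv_1[OF Suc.prems(1)]])
    show "(poly p has_real_derivative poly p1 x) (at x within S)"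
      using poly_DERIV[of p x] unfolding p by (rule has_field_derivative_at_within)
  qed
  have "\<bar>h x - poly p x\<bar> \<le> \<epsilon>" if x: "x \<in> {-1..1}" for x
  proof -
    have "norm ((h x - poly p x) - (h 0 - poly p 0)) \<le> \<epsilon> * norm (x - 0)"
      by (rule field_differentiable_bound[of "{-1..1}" _ _ _ x 0])
        (use p1(1) x der in auto)
    also have "\<dots> \<le> \<epsilon> * 1"
      using x Suc.prems(2) by (intro mult_left_mono) auto
    finally show ?thesis by (simp add: p0)
  qed
  moreover have "\<bar>nderiv (Suc n) h x - poly ((pderiv ^^ Suc n) p) x\<bar> \<le> \<epsilon>" if "x \<in> {-1..1}" for x
    using p1(2)[OF that] by (simp add: nderiv_nderiv funpow_swap1[of pderiv] p)
  ultimately show ?case by blast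
qed

text \<open>
  Replace \<open>h\<close> by a polynomial so close to it, together with its \<open>n\<close>-th derivative, that the change is
  below the accuracy aimed at.
\<close>
lemma smooth_jackson:
  "\<exists>K>0. \<forall>(h :: real \<Rightarrow> real) B M. smooth_fun h \<longrightarrow> B > 0 \<longrightarrow> M \<ge> n \<longrightarrow> M \<ge> 1 \<longrightarrow>
     (\<forall>x\<in>{-1..1}. \<bar>nderiv n h x\<bar> \<le> B) \<longrightarrow>
     (\<exists>q. (\<forall>i\<ge>M. coeff q i = 0) \<and> cheb_energy (\<lambda>x. h x - poly q x) \<le> K * (B / real M ^ n)\<^sup>2)"
proof -
  obtain K where K: "K > 0" and jackson: "\<And>(p :: real poly) M. M \<ge> n \<Longrightarrow> \<exists>q. (\<forall>i\<ge>M. coeff q i = 0) \<and>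
     cheb_energy (poly (p - q)) \<le> K * cheb_energy (poly ((pderiv ^^ n) p)) / (real M ^ n)\<^sup>2"
    using poly_jackson by blast
  show ?thesis
  proof (intro exI[of _ "2 * pi + 8 * K * pi"] conjI allI impI)
    show "2 * pi + 8 * K * pi > 0" using K by (simp add: add_pos_pos)
    fix h :: "real \<Rightarrow> real" and B :: real and M :: nat
    assume h: "smooth_fun h" and B: "B > 0" and M: "M \<ge> n" "M \<ge> 1"
      and bound: "\<forall>x\<in>{-1..1}. \<bar>nderiv n h x\<bar> \<le> B"
    \<comment> \<open>the accuracy aimed at; it does not exceed \<open>B\<close>, so the \<open>n\<close>-th derivative of \<open>p\<close> is at most \<open>2 * B\<close>\<close>
    define \<epsilon> where "\<epsilon> = B / real M ^ n"
    have \<epsilon>: "\<epsilon> > 0" "\<epsilon> \<le> B"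
      using B M by (auto simp: \<epsilon>_def divide_le_eq)
    have const: "cheb_energy (\<lambda>x. c) = pi * c\<^sup>2" for c
      by (simp add: cheb_energy_def)
    obtain p where p: "\<And>x. x \<in> {-1..1} \<Longrightarrow> \<bar>h x - poly p x\<bar> \<le> \<epsilon>"
      "\<And>x. x \<in> {-1..1} \<Longrightarrow> \<bar>nderiv n h x - poly ((pderiv ^^ n) p) x\<bar> \<le> \<epsilon>"
      using smooth_poly_approx[OF h \<epsilon>(1)] by blast
    obtain q where q: "\<And>i. i \<ge> M \<Longrightarrow> coeff q i = 0"
      "cheb_energy (poly (p - q)) \<le> K * cheb_energy (poly ((pderiv ^^ n) p)) / (real M ^ n)\<^sup>2"
      using jackson[OF M(1)] by blast
    have ch: "continuous_on {-1..1} h"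
      by (rule smooth_fun_continuous_on_0[OF h])
    have int: "(\<lambda>\<theta>. (h (cos \<theta>) - poly r (cos \<theta>))\<^sup>2) integrable_on {0..pi}" for r
      by (rule continuous_on_imp_cheb_integrable[where f = "\<lambda>x. h x - poly r x"])
        (intro continuous_intros ch)
    have int_pq: "(\<lambda>\<theta>. (poly (p - q) (cos \<theta>))\<^sup>2) integrable_on {0..pi}"
      by (rule continuous_on_imp_cheb_integrable) (intro continuous_intros)
    have "cheb_energy (poly ((pderiv ^^ n) p)) \<le> cheb_energy (\<lambda>x. 2 * B)"
    proof (rule cheb_energy_mono)
      show "\<bar>poly ((pderiv ^^ n) p) x\<bar> \<le> \<bar>2 * B\<bar>" if "x \<in> {-1..1}" for x
        using p(2)[OF that] bound[rule_format, OF that] \<epsilon> by linarith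
    qed (auto intro!: continuous_intros)
    then have E1: "cheb_energy (poly ((pderiv ^^ n) p)) \<le> 4 * pi * B\<^sup>2"
      by (simp add: const power_mult_distrib)
    have "cheb_energy (poly (p - q)) \<le> K * (4 * pi * B\<^sup>2) / (real M ^ n)\<^sup>2"
      by (rule order_trans[OF q(2)]) (use K E1 in \<open>auto intro!: divide_right_mono mult_left_mono\<close>)
    then have E2: "cheb_energy (poly (p - q)) \<le> 4 * K * pi * \<epsilon>\<^sup>2"
      by (simp add: \<epsilon>_def power_divide mult_ac)
    have "cheb_energy (\<lambda>x. h x - poly p x) \<le> cheb_energy (\<lambda>x. \<epsilon>)"
    proof (rule cheb_energy_mono)
      show "\<bar>h x - poly p x\<bar> \<le> \<bar>\<epsilon>\<bar>" if "x \<in> {-1..1}" for x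
        using p(1)[OF that] by linarith
    qed (intro continuous_intros ch)+
    then have E3: "cheb_energy (\<lambda>x. h x - poly p x) \<le> pi * \<epsilon>\<^sup>2"
      by (simp add: const)
    have "cheb_energy (\<lambda>x. h x - poly q x) \<le>
        integral {0..pi} (\<lambda>\<theta>. 2 * (h (cos \<theta>) - poly p (cos \<theta>))\<^sup>2 + 2 * (poly (p - q) (cos \<theta>))\<^sup>2)"
      unfolding cheb_energy_def
    proof (rule integral_le)
      show "(\<lambda>\<theta>. (h (cos \<theta>) - poly q (cos \<theta>))\<^sup>2) integrable_on {0..pi}"
        by (rule int)
      show "(\<lambda>\<theta>. 2 * (h (cos \<theta>) - poly p (cos \<theta>))\<^sup>2 + 2 * (poly (p - q) (cos \<theta>))\<^sup>2) integrable_on {0..pi}"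
        by (rule integrable_add[OF integrable_on_mult_right[OF int] integrable_on_mult_right[OF int_pq]])
      fix \<theta> :: real
      have "(u + v)\<^sup>2 \<le> 2 * u\<^sup>2 + 2 * v\<^sup>2" for u v :: real
        using zero_le_power2[of "u - v"] by (simp add: power2_eq_square algebra_simps)
      from this[of "h (cos \<theta>) - poly p (cos \<theta>)" "poly (p - q) (cos \<theta>)"]
      show "(h (cos \<theta>) - poly q (cos \<theta>))\<^sup>2 \<le> 2 * (h (cos \<theta>) - poly p (cos \<theta>))\<^sup>2 + 2 * (poly (p - q) (cos \<theta>))\<^sup>2"
        by simp
    qed
    also have "\<dots> = 2 * cheb_energy (\<lambda>x. h x - poly p x) + 2 * cheb_energy (poly (p - q))"
      unfolding cheb_energy_def
      by (simp only: integral_add[OF integrable_on_mult_right[OF int] integrable_on_mult_right[OF int_pq]]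
          integral_mult_right)
    also have "\<dots> \<le> (2 * pi + 8 * K * pi) * \<epsilon>\<^sup>2"
      using E2 E3 by (simp add: algebra_simps)
    finally show "\<exists>q. (\<forall>i\<ge>M. coeff q i = 0) \<and>
        cheb_energy (\<lambda>x. h x - poly q x) \<le> (2 * pi + 8 * K * pi) * (B / real M ^ n)\<^sup>2"
      using q(1) unfolding \<epsilon>_def by blast
  qed
qed

lemma poly_map_of_real:
  "poly (map_poly complex_of_real p) (complex_of_real x) = complex_of_real (poly p x)"
  by (induction p) (simp_all add: map_poly_pCons)

text \<open>In the variable \<open>\<theta>\<close> the Jacobian is \<open>sin \<theta> / 2\<close>, which is at most one.\<close>
lemma integral_unit_interval_le_cheb:
  fixes F :: "real \<Rightarrow> real"
  assumes "continuous_on {0..1} F" "\<And>x. x \<in> {0..1} \<Longrightarrow> F x \<ge> 0"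
  shows "integral {0..1} F \<le> integral {0..pi} (\<lambda>\<theta>. F ((1 - cos \<theta>) / 2))"
proof -
  have ends: "(1 - cos 0) / 2 = (0 :: real)" "(1 - cos pi) / 2 = (1 :: real)"
    by auto
  have img: "(\<lambda>\<theta>. (1 - cos \<theta>) / 2) ` {0..pi} \<subseteq> {0..1::real}"
  proof clarify
    fix \<theta> :: real
    show "(1 - cos \<theta>) / 2 \<in> {0..1}"
      using cos_ge_minus_one[of \<theta>] cos_le_one[of \<theta>] by simp
  qed
  have cont: "continuous_on {0..pi} (\<lambda>\<theta>. F ((1 - cos \<theta>) / 2))"
    by (rule continuous_on_compose2[OF assms(1) _ img]) (auto intro!: continuous_intros)
  have "((\<lambda>\<theta>. (sin \<theta> / 2) *\<^sub>R F ((1 - cos \<theta>) / 2)) has_integral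
      (integral {(1 - cos 0) / 2..(1 - cos pi) / 2} F)) {0..pi}"
    by (rule has_integral_substitution[OF _ _ img assms(1)])
      (auto intro!: derivative_eq_intros)
  from integral_unique[OF this]
  have "integral {0..1} F = integral {0..pi} (\<lambda>\<theta>. (sin \<theta> / 2) *\<^sub>R F ((1 - cos \<theta>) / 2))"
    unfolding ends by (rule sym)
  also have "\<dots> \<le> integral {0..pi} (\<lambda>\<theta>. F ((1 - cos \<theta>) / 2))"
  proof (rule integral_le)
    show "(\<lambda>\<theta>. (sin \<theta> / 2) *\<^sub>R F ((1 - cos \<theta>) / 2)) integrable_on {0..pi}"
      "(\<lambda>\<theta>. F ((1 - cos \<theta>) / 2)) integrable_on {0..pi}"
      by (auto intro!: integrable_continuous_real continuous_intros cont)
    fix \<theta> assume "\<theta> \<in> {0..pi}"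
    then have "F ((1 - cos \<theta>) / 2) \<ge> 0"
      using img by (intro assms(2)) blast
    moreover have "sin \<theta> / 2 \<le> 1"
      using sin_le_one[of \<theta>] by linarith
    ultimately show "(sin \<theta> / 2) *\<^sub>R F ((1 - cos \<theta>) / 2) \<le> F ((1 - cos \<theta>) / 2)"
      using mult_right_mono[of "sin \<theta> / 2" 1] by simp
  qed
  finally show ?thesis .
qed

text \<open>
  The real bound applied to the real and the imaginary part of \<open>y \<mapsto> h ((1 - y) / 2)\<close>, whose
  derivatives are those of \<open>h\<close> up to powers of \<open>- 1 / 2\<close>. The reflection makes \<open>(1 - cos \<theta>) / 2\<close>
  increasing in \<open>\<theta>\<close>.
\<close>
lemma complex_jackson:
  "\<exists>K>0. \<forall>(h :: real \<Rightarrow> complex) B d. smooth_fun h \<longrightarrow> B > 0 \<longrightarrow> d \<ge> 1 \<longrightarrow> d + 1 \<ge> n \<longrightarrow>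
     (\<forall>x\<in>{0..1}. norm (nderiv n h x) \<le> B) \<longrightarrow>
     (\<exists>p. degree p \<le> d \<and>
        integral {0..1} (\<lambda>x. (norm (h x - poly p (complex_of_real x)))\<^sup>2) \<le> K * (B / real d ^ n)\<^sup>2)"
proof -
  obtain K where K: "K > 0" and all: "\<forall>(h :: real \<Rightarrow> real) B M. smooth_fun h \<longrightarrow> B > 0 \<longrightarrow> M \<ge> n \<longrightarrow> M \<ge> 1 \<longrightarrow>
     (\<forall>x\<in>{-1..1}. \<bar>nderiv n h x\<bar> \<le> B) \<longrightarrow>
     (\<exists>q. (\<forall>i\<ge>M. coeff q i = 0) \<and> cheb_energy (\<lambda>x. h x - poly q x) \<le> K * (B / real M ^ n)\<^sup>2)"
    using smooth_jackson[of n] by (elim exE conjE) (rule that)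
  note jackson = all[rule_format]
  show ?thesis
  proof (intro exI[of _ "2 * K"] conjI allI impI)
    show "2 * K > 0" using K by simp
    fix h :: "real \<Rightarrow> complex" and B :: real and d :: nat
    assume h: "smooth_fun h" and B: "B > 0" and d: "d \<ge> 1" "d + 1 \<ge> n"
      and bound: "\<forall>x\<in>{0..1}. norm (nderiv n h x) \<le> B"
    define D where "D = (\<lambda>i y. ((- 1 / 2) ^ i) *\<^sub>R nderiv i h ((1 - y) / 2))"
    have D: "(D i has_vector_derivative D (Suc i) y) (at y)" for i y
    proof -
      have "((\<lambda>y. (1 - y) / 2) has_vector_derivative (- 1 / 2 :: real)) (at y)"
        unfolding has_real_derivative_iff_has_vector_derivative[symmetric]
        by (auto intro!: derivative_eq_intros)
      from vector_diff_chain_at[OF this smooth_fun_has_deriv[OF h]]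
      have "((\<lambda>y. nderiv i h ((1 - y) / 2)) has_vector_derivative
          (- 1 / 2) *\<^sub>R nderiv (Suc i) h ((1 - y) / 2)) (at y)"
        by (simp add: o_def)
      from bounded_linear.has_vector_derivative[OF bounded_linear_scaleR_right this, of "(- 1 / 2) ^ i"]
      show ?thesis
        by (simp add: D_def mult.commute)
    qed
    have D0: "D 0 = (\<lambda>y. h ((1 - y) / 2))"
      by (simp add: D_def)
    have sD: "smooth_fun (D 0)" and nD: "nderiv n (D 0) = D n"
      using derivative_sequence_smooth[of D] derivative_sequence_nderiv[of D] D by auto
    have boundD: "norm (D n y) \<le> B" if "y \<in> {-1..1}" for y
    proof -
      have "norm (D n y) = (1/2) ^ n * norm (nderiv n h ((1 - y) / 2))"
        by (simp add: D_def power_abs)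
      also have "\<dots> \<le> 1 * B"
        using that bound B by (intro mult_mono power_le_one) auto
      finally show ?thesis by simp
    qed
    have "\<exists>q. (\<forall>i\<ge>Suc d. coeff q i = 0) \<and> cheb_energy (\<lambda>y. L (D 0 y) - poly q y) \<le> K * (B / real (Suc d) ^ n)\<^sup>2"
      if L: "bounded_linear L" "\<And>z. \<bar>L z\<bar> \<le> norm z" for L :: "complex \<Rightarrow> real"
    proof (rule jackson)
      show "smooth_fun (\<lambda>y. L (D 0 y))"
        by (rule smooth_fun_bounded_linear[OF L(1) sD])
      show "\<bar>nderiv n (\<lambda>y. L (D 0 y)) x\<bar> \<le> B" if "x \<in> {-1..1}" for x
        unfolding nderiv_bounded_linear[OF L(1) sD] nD
        using L(2) boundD[OF that] order_trans by blast
    qed (use B d in auto)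
    from this[OF bounded_linear_Re abs_Re_le_cmod] this[OF bounded_linear_Im abs_Im_le_cmod]
    obtain q1 q2 where q: "\<And>i. i \<ge> Suc d \<Longrightarrow> coeff q1 i = 0" "\<And>i. i \<ge> Suc d \<Longrightarrow> coeff q2 i = 0"
      and E: "cheb_energy (\<lambda>y. Re (D 0 y) - poly q1 y) \<le> K * (B / real (Suc d) ^ n)\<^sup>2"
        "cheb_energy (\<lambda>y. Im (D 0 y) - poly q2 y) \<le> K * (B / real (Suc d) ^ n)\<^sup>2"
      by blast
    define Q where "Q = map_poly complex_of_real q1 + smult \<i> (map_poly complex_of_real q2)"
    define p where "p = pcompose Q [:1, - 2:]"
    have "degree Q \<le> d"
      by (rule degree_le) (use q in \<open>auto simp: Q_def coeff_map_poly\<close>)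
    then have p: "degree p \<le> d"
      unfolding p_def by (simp add: degree_pcompose)
    have cont: "continuous_on S (\<lambda>x. (norm (h x - poly p (complex_of_real x)))\<^sup>2)" for S
      by (intro continuous_intros smooth_fun_continuous_on_0[OF h])
    have cD: "continuous_on S (D 0)" for S
      by (rule smooth_fun_continuous_on_0[OF sD])
    have "integral {0..1} (\<lambda>x. (norm (h x - poly p (complex_of_real x)))\<^sup>2) \<le>
      integral {0..pi} (\<lambda>\<theta>. (norm (h ((1 - cos \<theta>) / 2) - poly p (complex_of_real ((1 - cos \<theta>) / 2))))\<^sup>2)"
      by (rule integral_unit_interval_le_cheb[OF cont]) auto
    also have "(\<lambda>\<theta>. (norm (h ((1 - cos \<theta>) / 2) - poly p (complex_of_real ((1 - cos \<theta>) / 2))))\<^sup>2) =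
      (\<lambda>\<theta>. (Re (D 0 (cos \<theta>)) - poly q1 (cos \<theta>))\<^sup>2 + (Im (D 0 (cos \<theta>)) - poly q2 (cos \<theta>))\<^sup>2)"
    proof
      fix \<theta> :: real
      have "poly p (complex_of_real ((1 - cos \<theta>) / 2)) = poly Q (complex_of_real (cos \<theta>))"
      proof -
        have "poly [:1, - 2:] (complex_of_real ((1 - cos \<theta>) / 2)) = complex_of_real (cos \<theta>)"
          by (simp add: complex_eq_iff field_simps)
        then show ?thesis
          by (simp only: p_def poly_pcompose)
      qed
      also have "\<dots> = complex_of_real (poly q1 (cos \<theta>)) + \<i> * complex_of_real (poly q2 (cos \<theta>))"
        by (simp add: Q_def poly_map_of_real)
      finally show "(norm (h ((1 - cos \<theta>) / 2) - poly p (complex_of_real ((1 - cos \<theta>) / 2))))\<^sup>2 =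
        (Re (D 0 (cos \<theta>)) - poly q1 (cos \<theta>))\<^sup>2 + (Im (D 0 (cos \<theta>)) - poly q2 (cos \<theta>))\<^sup>2"
        by (simp add: D0 cmod_power2)
    qed
    also have "integral {0..pi} \<dots> = cheb_energy (\<lambda>y. Re (D 0 y) - poly q1 y) + cheb_energy (\<lambda>y. Im (D 0 y) - poly q2 y)"
      unfolding cheb_energy_def
      by (rule integral_add; rule continuous_on_imp_cheb_integrable[where f = "\<lambda>y. Re (D 0 y) - poly q1 y"]
          continuous_on_imp_cheb_integrable[where f = "\<lambda>y. Im (D 0 y) - poly q2 y"]; intro continuous_intros cD)
    also have "\<dots> \<le> 2 * K * (B / real (Suc d) ^ n)\<^sup>2"
      using E by simp
    also have "\<dots> \<le> 2 * K * (B / real d ^ n)\<^sup>2"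
      using K B d by (intro mult_left_mono power_mono divide_left_mono) auto
    finally show "\<exists>p. degree p \<le> d \<and>
        integral {0..1} (\<lambda>x. (norm (h x - poly p (complex_of_real x)))\<^sup>2) \<le> 2 * K * (B / real d ^ n)\<^sup>2"
      using p by blast
  qed
qed


section \<open>Derivatives of the remainder of the asymptotic expansion\<close>

text \<open>
  At \<open>+\<infinity>\<close> the zeroth remainder of the expansion is \<open>\<Psi>\<close> itself; its order \<open>e 0\<close> is not positive and
  each derivative lowers it by one. At \<open>-\<infinity>\<close> the decay is faster than any power, and in between
  compactness suffices.
\<close>
lemma decaying_symbol_bound:
  fixes \<Psi> :: "real \<Rightarrow> complex"
  assumes smooth: "smooth_fun \<Psi>"
    and top: "symbol_expansion_at_top \<Psi> c e" and e: "e 0 \<le> 0"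
    and bot: "rapidly_decreasing_at_bot \<Psi>"
  shows "\<exists>C>0. \<forall>\<tau>. norm (nderiv n \<Psi> \<tau>) * (1 + \<bar>\<tau>\<bar>) ^ n \<le> C"
proof -
  let ?f = "\<lambda>\<tau>. norm (nderiv n \<Psi> \<tau>)"
  have *: "?f \<tau> * (1 + \<bar>\<tau>\<bar>) ^ n \<le> c * 2 ^ n"
    if "\<bar>\<tau>\<bar> \<ge> 1" "c > 0" "?f \<tau> \<le> c * \<bar>\<tau>\<bar> powi (- int n)" for \<tau> c
  proof -
    have "?f \<tau> * (1 + \<bar>\<tau>\<bar>) ^ n \<le> (c * \<bar>\<tau>\<bar> powi (- int n)) * (2 * \<bar>\<tau>\<bar>) ^ n"
      using that by (intro mult_mono power_mono) auto
    also have "\<dots> = c * 2 ^ n"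
      using that by (simp add: power_int_minus power_mult_distrib)
    finally show ?thesis .
  qed
  have "?f \<in> O[at_top](\<lambda>\<tau>. \<tau> powi (e 0 - int n))"
    using top[unfolded symbol_expansion_at_top_def, rule_format, of n 0] by simp
  then obtain c1 where c1: "c1 > 0" "eventually (\<lambda>\<tau>. norm (?f \<tau>) \<le> c1 * norm (\<tau> powi (e 0 - int n))) at_top"
    by (rule landau_o.bigE)
  then obtain T1 where T1: "\<And>\<tau>. \<tau> \<ge> T1 \<Longrightarrow> ?f \<tau> \<le> c1 * norm (\<tau> powi (e 0 - int n))"
    unfolding eventually_at_top_linorder by auto
  have "?f \<in> O[at_bot](\<lambda>\<tau>. \<bar>\<tau>\<bar> powi (- int n))"
    using bot by (simp add: rapidly_decreasing_at_bot_def)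
  then obtain c2 where c2: "c2 > 0" "eventually (\<lambda>\<tau>. norm (?f \<tau>) \<le> c2 * norm (\<bar>\<tau>\<bar> powi (- int n))) at_bot"
    by (rule landau_o.bigE)
  then obtain T2 where T2: "\<And>\<tau>. \<tau> \<le> T2 \<Longrightarrow> ?f \<tau> \<le> c2 * norm (\<bar>\<tau>\<bar> powi (- int n))"
    unfolding eventually_at_bot_linorder by auto
  define T where "T = Max {1, T1, - T2}"
  have "continuous_on {-T..T} (\<lambda>\<tau>. ?f \<tau> * (1 + \<bar>\<tau>\<bar>) ^ n)"
    by (intro continuous_intros smooth_fun_continuous_on smooth)
  then have "compact ((\<lambda>\<tau>. ?f \<tau> * (1 + \<bar>\<tau>\<bar>) ^ n) ` {-T..T})"
    by (intro compact_continuous_image) auto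
  from compact_imp_bounded[OF this] obtain c3
    where "\<forall>x\<in>(\<lambda>\<tau>. ?f \<tau> * (1 + \<bar>\<tau>\<bar>) ^ n) ` {-T..T}. norm x \<le> c3"
    unfolding bounded_iff ..
  note c3 = this[rule_format, OF imageI]
  have "?f \<tau> * (1 + \<bar>\<tau>\<bar>) ^ n \<le> c1 * 2 ^ n + c2 * 2 ^ n + \<bar>c3\<bar>" for \<tau>
  proof -
    consider "\<tau> \<in> {-T..T}" | "\<tau> \<ge> 1" "\<tau> \<ge> T1" | "\<tau> \<le> -1" "\<tau> \<le> T2"
      unfolding T_def by fastforce
    then show ?thesis
    proof cases
      case 1
      then have "?f \<tau> * (1 + \<bar>\<tau>\<bar>) ^ n \<le> \<bar>c3\<bar>"
        using c3[OF 1] unfolding real_norm_def by linarith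
      moreover have "c1 * 2 ^ n \<ge> 0" "c2 * 2 ^ n \<ge> 0" using c1 c2 by auto
      ultimately show ?thesis by linarith
    next
      case 2
      have "\<tau> powi (e 0 - int n) \<le> \<tau> powi (- int n)"
        using 2 e by (intro power_int_increasing) auto
      then have h: "c1 * norm (\<tau> powi (e 0 - int n)) \<le> c1 * \<bar>\<tau>\<bar> powi (- int n)"
        using c1 2 by (intro mult_left_mono) auto
      then have "?f \<tau> * (1 + \<bar>\<tau>\<bar>) ^ n \<le> c1 * 2 ^ n"
        using 2 c1 order_trans[OF T1[OF 2(2)] h] by (intro *) auto
      moreover have "c2 * 2 ^ n \<ge> 0" using c2 by auto
      ultimately show ?thesis by linarith
    next
      case 3
      have eq: "norm (\<bar>\<tau>\<bar> powi (- int n)) = \<bar>\<tau>\<bar> powi (- int n)"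
        unfolding real_norm_def by (rule abs_of_nonneg) (simp add: zero_le_power_int)
      have "?f \<tau> * (1 + \<bar>\<tau>\<bar>) ^ n \<le> c2 * 2 ^ n"
        using 3 by (intro *[OF _ c2(1) T2[OF 3(2), unfolded eq]]) auto
      moreover have "c1 * 2 ^ n \<ge> 0" using c1 by auto
      ultimately show ?thesis by linarith
    qed
  qed
  moreover have "c1 * 2 ^ n + c2 * 2 ^ n + \<bar>c3\<bar> > 0"
    using c1 c2 by (simp add: add_pos_nonneg add_pos_pos)
  ultimately show ?thesis by blast
qed

lemma smooth_fun_bounded_on_interval:
  assumes "smooth_fun f"
  shows "\<exists>C\<ge>1. \<forall>m\<le>N. \<forall>s\<in>{a..b::real}. norm (nderiv m f s) \<le> C"
proof -
  have "\<exists>C. \<forall>s\<in>{a..b}. norm (nderiv m f s) \<le> C" for m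
  proof -
    have "compact (nderiv m f ` {a..b})"
      by (intro compact_continuous_image smooth_fun_continuous_on assms) auto
    then show ?thesis
      by (auto dest!: compact_imp_bounded simp: bounded_iff)
  qed
  then have "\<forall>m. \<exists>C. \<forall>s\<in>{a..b}. norm (nderiv m f s) \<le> C" ..
  from choice[OF this] obtain C where "\<forall>m. \<forall>s\<in>{a..b}. norm (nderiv m f s) \<le> C m" ..
  note C = this[rule_format]
  have "norm (nderiv m f s) \<le> 1 + (\<Sum>m\<le>N. \<bar>C m\<bar>)" if "m \<le> N" "s \<in> {a..b}" for m s
  proof -
    have "norm (nderiv m f s) \<le> \<bar>C m\<bar>"
      using C[OF that(2), of m] by linarith
    also have "\<dots> \<le> (\<Sum>m\<le>N. \<bar>C m\<bar>)"
      using that(1) by (intro member_le_sum) auto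
    finally show ?thesis by simp
  qed
  then show ?thesis
    by (intro exI[of _ "1 + (\<Sum>m\<le>N. \<bar>C m\<bar>)"]) (auto intro: sum_nonneg)
qed

lemma periodic_fun_int:
  assumes "periodic_fun T f"
  shows "f (s + of_int z * T) = f s"
proof -
  have step: "f (s + T) = f s" for s
    using assms by (simp add: periodic_fun_def)
  have nat: "f (s + of_nat m * T) = f s" for m s
  proof (induction m)
    case (Suc m)
    then show ?case
      using step[of "s + of_nat m * T"] by (simp add: algebra_simps)
  qed simp
  show ?thesis
  proof (cases "z \<ge> 0")
    case True
    then show ?thesis using nat[of s "nat z"] by simp
  next
    case False
    then show ?thesis using nat[of "s + of_int z * T" "nat (- z)"] by (simp add: algebra_simps)
  qed
qed

lemma periodic_fun_nderiv:
  assumes "smooth_fun f" "periodic_fun T f"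
  shows "periodic_fun T (nderiv n f)"
proof -
  define D where "D = (\<lambda>n s. nderiv n f (s + T))"
  have D: "(D n has_vector_derivative D (Suc n) s) (at s)" for n s
  proof -
    have "((\<lambda>s. s + T) has_vector_derivative 1) (at s)"
      unfolding has_real_derivative_iff_has_vector_derivative[symmetric]
      by (auto intro!: derivative_eq_intros)
    from vector_diff_chain_at[OF this smooth_fun_has_deriv[OF assms(1)]]
    show ?thesis by (simp add: D_def o_def)
  qed
  have "D 0 = f"
    using assms(2) by (simp add: D_def periodic_fun_def)
  then have "nderiv n f = D n"
    using derivative_sequence_nderiv[of D, OF D] by simp
  then show ?thesis
    by (auto simp: periodic_fun_def D_def fun_eq_iff)
qed

lemma shift_into_period:
  fixes s L T :: real
  assumes "T > 0"
  shows "\<exists>z. s + of_int z * T \<in> {L..<L + T}"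
proof (intro exI[of _ "- \<lfloor>(s - L) / T\<rfloor>"])
  have "of_int \<lfloor>(s - L) / T\<rfloor> \<le> (s - L) / T" "(s - L) / T < of_int \<lfloor>(s - L) / T\<rfloor> + 1"
    by linarith+
  from mult_right_mono[OF this(1), of T] mult_strict_right_mono[OF this(2), of T]
  show "s + of_int (- \<lfloor>(s - L) / T\<rfloor>) * T \<in> {L..<L + T}"
    using assms by (simp add: distrib_right)
qed

lemma smooth_cis_linear: "smooth_fun (\<lambda>x. exp (\<i> * complex_of_real x))"
proof -
  have "((\<lambda>x. \<i> ^ n * exp (\<i> * complex_of_real x)) has_vector_derivative
      \<i> ^ Suc n * exp (\<i> * complex_of_real x)) (at x)" for n x
  proof -
    have "((\<lambda>z. \<i> ^ n * exp (\<i> * z)) has_field_derivative \<i> ^ Suc n * exp (\<i> * complex_of_real x))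
        (at (complex_of_real x))"
      by (auto intro!: derivative_eq_intros)
    from has_vector_derivative_real_field[OF this] show ?thesis by simp
  qed
  from derivative_sequence_smooth[of "\<lambda>n x. \<i> ^ n * exp (\<i> * complex_of_real x)", OF this]
  show ?thesis by simp
qed

text \<open>
  The symbol class speaks of derivatives relative to \<open>[0, 2P]\<close>, the bounds used below of derivatives
  on the whole line. They agree, also at the end points, because derivatives within a nondegenerate
  interval are unique.
\<close>
lemma mixed_derivs_nderiv:
  assumes D: "mixed_derivs P a D" and "P > 0" and smooth: "smooth_fun (\<lambda>s. a s k)" and "k > 0"
    and s: "s \<in> {0..2 * P}"
  shows "nderiv m (\<lambda>s. a s k) s = D m 0 s k"
  using s
proof (induction m arbitrary: s)
  case 0
  then show ?case using D \<open>k > 0\<close> by (simp add: mixed_derivs_def)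
next
  case (Suc m)
  have "((\<lambda>s. D m 0 s k) has_vector_derivative D (Suc m) 0 s k) (at s within {0..2 * P})"
    using D \<open>k > 0\<close> Suc.prems by (simp add: mixed_derivs_def)
  moreover have "(nderiv m (\<lambda>s. a s k) has_vector_derivative nderiv (Suc m) (\<lambda>s. a s k) s) (at s within {0..2 * P})"
    by (rule has_vector_derivative_at_within[OF smooth_fun_has_deriv[OF smooth]])
  then have "((\<lambda>s. D m 0 s k) has_vector_derivative nderiv (Suc m) (\<lambda>s. a s k) s) (at s within {0..2 * P})"
    by (rule has_vector_derivative_transform[OF Suc.prems, rotated]) (simp add: Suc.IH)
  ultimately show ?case
    using vector_derivative_unique_within_closed_interval[of 0 "2 * P" s "\<lambda>s. D m 0 s k"] Suc.prems \<open>P > 0\<close>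
    by simp
qed

text \<open>
  The cost of one derivative: since \<open>Z\<close> vanishes to first order at the shadow boundary points, this is
  comparable to the reciprocal of the distance from \<open>s\<close> to the nearest of these points, with \<open>k powr (1/3)\<close> as an
  upper limit. A factor \<open>\<Lambda> \<ge> \<bar>Z s\<bar> + 1\<close> makes the rate at least one, so that lower
  derivatives can be estimated by higher powers of it.
\<close>
definition layer_rate :: "(real \<Rightarrow> real) \<Rightarrow> real \<Rightarrow> real \<Rightarrow> real \<Rightarrow> real" where
  "layer_rate Z \<Lambda> k s = \<Lambda> / (k powr (- 1/3) + \<bar>Z s\<bar>)"

lemma layer_rate_ge_1:
  assumes "k \<ge> 1" "\<bar>Z s\<bar> + 1 \<le> \<Lambda>"
  shows "layer_rate Z \<Lambda> k s \<ge> 1"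
proof -
  have "k powr (- 1/3) \<le> 1"
    using powr_mono[of "- 1/3" 0 k] assms by simp
  moreover have "k powr (- 1/3) + \<bar>Z s\<bar> > 0"
    using assms by (intro add_pos_nonneg) auto
  ultimately show ?thesis
    unfolding layer_rate_def using assms by (subst le_divide_eq_1_pos) linarith+
qed

lemma smooth_expansion_term:
  assumes "expansion_data P t b Z \<Psi>" "i \<in> indices"
  shows "smooth_fun (\<lambda>s. expansion_term b Z \<Psi> i s k)"
proof -
  obtain p q r l where i: "i = (p, q, r, l)" by (cases i)
  then have "l < 0" using assms(2) by (simp add: indices_def)
  then have *: "smooth_fun (b i)" "smooth_fun Z" "smooth_fun (\<Psi> r l)"
    using assms by (simp_all add: expansion_data_def)
  show ?thesis
    unfolding i expansion_term_def prod.case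
    by (rule smooth_fun_mult[OF smooth_fun_mult[OF smooth_fun_const *(1)[unfolded i]]
        smooth_fun_compose[OF smooth_fun_nderiv[OF *(3)] smooth_fun_bounded_linear[OF bounded_linear_mult_right *(2)]]])
qed

lemma periodic_expansion_term:
  assumes "expansion_data P t b Z \<Psi>" "i \<in> indices"
  shows "periodic_fun (2 * P) (\<lambda>s. expansion_term b Z \<Psi> i s k)"
  using assms by (cases i) (simp add: expansion_data_def periodic_fun_def expansion_term_def)

text \<open>
  With \<open>A = k powr (1/3) * Z\<close>, the \<open>m\<close>-th derivative of the profile at \<open>A s\<close> is of size
  \<open>(1 + \<bar>A s\<bar>) powr (- m)\<close>, while all derivatives of \<open>A\<close> are of size \<open>k powr (1/3)\<close>. The quotient
  \<open>k powr (1/3) / (1 + \<bar>A s\<bar>)\<close> is the rate up to the factor \<open>\<Lambda>\<close>; as the rate is at least one, it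
  may be replaced by its \<open>i\<close>-th power where the composition bound asks for that.
\<close>
lemma expansion_term_bound:
  assumes data: "expansion_data P t b Z \<Psi>" and i: "i \<in> indices"
    and \<Lambda>: "\<And>s. s \<in> {0..2 * P} \<Longrightarrow> \<bar>Z s\<bar> + 1 \<le> \<Lambda>"
  shows "\<exists>C>0. \<forall>k\<ge>1. \<forall>m\<le>N. \<forall>s\<in>{0..2 * P}.
    norm (nderiv m (\<lambda>s. expansion_term b Z \<Psi> i s k) s)
      \<le> C * k powr term_order i * layer_rate Z \<Lambda> k s ^ m"
proof -
  obtain p q r l where i_eq: "i = (p, q, r, l)" by (cases i)
  have l: "l < 0" using i by (simp add: i_eq indices_def)
  have sb: "smooth_fun (b i)" and sZ: "smooth_fun Z" and s\<Psi>: "smooth_fun (\<Psi> r l)"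
    using data i l by (simp_all add: expansion_data_def)
  have bot: "rapidly_decreasing_at_bot (\<Psi> r l)"
    using data l by (simp add: expansion_data_def)
  have "\<exists>c. symbol_expansion_at_top (\<Psi> r l) c (\<lambda>j. 1 + l - 2 * int r - 3 * int j)"
    using data l by (simp add: expansion_data_def)
  then obtain c where c: "symbol_expansion_at_top (\<Psi> r l) c (\<lambda>j. 1 + l - 2 * int r - 3 * int j)" ..
  let ?G = "nderiv p (\<Psi> r l)"
  have sG: "smooth_fun ?G" by (rule smooth_fun_nderiv[OF s\<Psi>])
  have "\<forall>n. \<exists>C. C > 0 \<and> (\<forall>\<tau>. norm (nderiv n (\<Psi> r l) \<tau>) * (1 + \<bar>\<tau>\<bar>) ^ n \<le> C)"
    using l by (intro allI decaying_symbol_bound[OF s\<Psi> c _ bot]) auto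
  from choice[OF this] obtain C where
    "\<forall>n. C n > 0 \<and> (\<forall>\<tau>. norm (nderiv n (\<Psi> r l) \<tau>) * (1 + \<bar>\<tau>\<bar>) ^ n \<le> C n)" ..
  then have C: "\<And>n. C n > 0" "\<And>n \<tau>. norm (nderiv n (\<Psi> r l) \<tau>) * (1 + \<bar>\<tau>\<bar>) ^ n \<le> C n"
    by simp_all
  define CG where "CG = (\<Sum>m\<le>N. C (m + p))"
  have CG: "CG > 0" unfolding CG_def by (rule sum_pos) (auto simp: C(1))
  have boundG: "norm (nderiv m ?G \<tau>) \<le> CG * (1 / (1 + \<bar>\<tau>\<bar>)) ^ m" if "m \<le> N" for m \<tau>
  proof -
    have "norm (nderiv m ?G \<tau>) * (1 + \<bar>\<tau>\<bar>) ^ m * 1 \<le> norm (nderiv m ?G \<tau>) * (1 + \<bar>\<tau>\<bar>) ^ m * (1 + \<bar>\<tau>\<bar>) ^ p"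
      by (intro mult_left_mono one_le_power) auto
    also have "\<dots> \<le> C (m + p)"
      using C(2)[of "m + p" \<tau>] by (simp add: nderiv_nderiv power_add mult_ac)
    also have "\<dots> \<le> CG"
      unfolding CG_def using that C(1) by (intro member_le_sum) (auto simp: less_imp_le)
    finally show ?thesis
      by (simp add: power_divide field_simps)
  qed
  from smooth_fun_bounded_on_interval[OF sb, of N 0 "2 * P"]
  obtain Cb where Cb: "Cb \<ge> 1" "\<And>m s. m \<le> N \<Longrightarrow> s \<in> {0..2 * P} \<Longrightarrow> norm (nderiv m (b i) s) \<le> Cb"
    by blast
  from smooth_fun_bounded_on_interval[OF sZ, of N 0 "2 * P"]
  obtain CZ where CZ: "CZ \<ge> 1" "\<And>m s. m \<le> N \<Longrightarrow> s \<in> {0..2 * P} \<Longrightarrow> norm (nderiv m Z s) \<le> CZ"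
    by blast
  then have CZ0: "CZ > 0" by simp
  define K where "K = compose_const CZ N"
  have K1: "K \<ge> 1" using CZ0 compose_const_ge_1 by (simp add: K_def)
  show ?thesis
  proof (intro exI[of _ "2 ^ N * (Cb * (K * CG))"] conjI allI impI ballI)
    show "2 ^ N * (Cb * (K * CG)) > 0" using Cb K1 CG by simp
    fix k :: real and m :: nat and s :: real
    assume k: "k \<ge> 1" and m: "m \<le> N" and s: "s \<in> {0..2 * P}"
    let ?\<mu> = "layer_rate Z \<Lambda> k s"
    define \<kappa> where "\<kappa> = k powr (1/3)"
    have \<kappa>: "\<kappa> \<ge> 1" using ge_one_powr_ge_zero[of k "1/3"] k by (simp add: \<kappa>_def)
    let ?A = "\<lambda>s. \<kappa> * Z s"
    have sA: "smooth_fun ?A" by (rule smooth_fun_bounded_linear[OF bounded_linear_mult_right sZ])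
    have \<mu>1: "?\<mu> \<ge> 1" using layer_rate_ge_1[OF k, of Z s \<Lambda>] \<Lambda>[OF s] by simp
    have \<Lambda>1: "\<Lambda> \<ge> 1" using \<Lambda>[OF s] by linarith
    have \<mu>_eq: "?\<mu> = \<Lambda> * \<kappa> / (1 + \<bar>?A s\<bar>)"
    proof -
      have "k powr (- 1/3) = 1 / \<kappa>"
        using powr_minus_divide[of k "1/3"] by (simp add: \<kappa>_def)
      moreover have "1 / \<kappa> + \<bar>Z s\<bar> = (1 + \<bar>?A s\<bar>) / \<kappa>"
        using \<kappa> by (simp add: abs_mult field_simps)
      ultimately show ?thesis
        by (simp only: layer_rate_def) simp
    qed
    have comp: "norm (nderiv j (\<lambda>s. ?G (?A s)) s) \<le> K * CG * ?\<mu> ^ j" if j: "j \<le> N" for j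
    unfolding K_def
    proof (rule nderiv_compose_bound[OF CZ0 sA _ _ sG _ j, where \<nu> = "1 / (1 + \<bar>?A s\<bar>)"])
      show "norm (nderiv i ?G (?A s)) \<le> CG * (1 / (1 + \<bar>?A s\<bar>)) ^ i" if "i \<le> j" for i
        using that j by (intro boundG) auto
      fix i assume i: "1 \<le> i" "i \<le> j"
      have "\<bar>nderiv i ?A s\<bar> * (1 / (1 + \<bar>?A s\<bar>)) = \<bar>nderiv i Z s\<bar> * (\<kappa> / (1 + \<bar>?A s\<bar>))"
        using \<kappa> by (simp add: nderiv_bounded_linear[OF bounded_linear_mult_right sZ] abs_mult)
      also have "\<dots> \<le> CZ * ?\<mu>"
      proof (rule mult_mono)
        show "\<bar>nderiv i Z s\<bar> \<le> CZ" using CZ(2)[of i s] i j s by simp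
        show "\<kappa> / (1 + \<bar>?A s\<bar>) \<le> ?\<mu>"
          unfolding \<mu>_eq using \<Lambda>1 \<kappa> by (intro divide_right_mono) auto
      qed (use CZ \<kappa> in auto)
      also have "\<dots> \<le> CZ * ?\<mu> ^ i"
        using CZ(1) \<mu>1 i self_le_power[of ?\<mu> i] by (intro mult_left_mono) auto
      finally show "\<bar>nderiv i ?A s\<bar> * (1 / (1 + \<bar>?A s\<bar>)) \<le> CZ * ?\<mu> ^ i" .
    qed (use CG \<mu>1 in \<open>auto intro: add_pos_nonneg\<close>)
    have "norm (nderiv m (\<lambda>s. b i s * ?G (?A s)) s) \<le> 2 ^ m * (Cb * (K * CG)) * ?\<mu> ^ m"
    proof (rule nderiv_mult_bound[OF sb smooth_fun_compose[OF sG sA]])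
      fix j assume j: "j \<le> m"
      have "norm (nderiv j (b i) s) * 1 \<le> Cb * ?\<mu> ^ j"
        using Cb j m s \<mu>1 by (intro mult_mono one_le_power) auto
      then show "norm (nderiv j (b i) s) \<le> Cb * ?\<mu> ^ j" by simp
      show "norm (nderiv j (\<lambda>s. ?G (?A s)) s) \<le> K * CG * ?\<mu> ^ j"
        using comp j m by simp
    qed (use Cb K1 CG \<mu>1 in auto)
    also have "\<dots> \<le> 2 ^ N * (Cb * (K * CG)) * ?\<mu> ^ m"
      using m Cb K1 CG \<mu>1 by (intro mult_right_mono power_increasing) auto
    finally have bound: "norm (nderiv m (\<lambda>s. b i s * ?G (?A s)) s) \<le> 2 ^ N * (Cb * (K * CG)) * ?\<mu> ^ m" .
    have "(\<lambda>s. expansion_term b Z \<Psi> i s k) = (\<lambda>s. complex_of_real (k powr term_order i) * (b i s * ?G (?A s)))"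
      by (simp add: i_eq expansion_term_def \<kappa>_def mult.assoc)
    then have "norm (nderiv m (\<lambda>s. expansion_term b Z \<Psi> i s k) s) =
        k powr term_order i * norm (nderiv m (\<lambda>s. b i s * ?G (?A s)) s)"
      by (simp add: nderiv_bounded_linear[OF bounded_linear_mult_right smooth_fun_mult[OF sb smooth_fun_compose[OF sG sA]]]
          norm_mult)
    also have "\<dots> \<le> k powr term_order i * (2 ^ N * (Cb * (K * CG)) * ?\<mu> ^ m)"
      by (intro mult_left_mono bound) auto
    finally show "norm (nderiv m (\<lambda>s. expansion_term b Z \<Psi> i s k) s)
      \<le> 2 ^ N * (Cb * (K * CG)) * k powr term_order i * ?\<mu> ^ m"
      by (simp add: mult_ac)
  qed
qed

text \<open>As \<open>l < 0\<close>, the summand that distinguishes \<open>vartheta\<close> from \<open>term_order\<close> is always zero.\<close>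
lemma term_order_not_leading:
  assumes "i \<in> indices" "i \<notin> leading_indices \<beta>"
  shows "term_order i \<le> - real \<beta> / 3"
proof -
  obtain p q r l where i: "i = (p, q, r, l)" by (cases i)
  have "l < 0" "vartheta i \<le> - real \<beta> / 3"
    using assms by (auto simp: i indices_def leading_indices_def)
  moreover have "(if 1 + l - 2 * int r - int p < 0 then 0
      else real_of_int (1 + l - 2 * int r - int p) / 3) = (0 :: real)"
    using \<open>l < 0\<close> by auto
  ultimately show ?thesis
    by (simp only: i vartheta_def prod.case)
qed

lemma smooth_slow_field:
  assumes \<gamma>: "smooth_fun \<gamma>" and u: "smooth_fun (\<lambda>s. u k (\<gamma> s))"
  shows "smooth_fun (\<lambda>s. slow_field \<gamma> \<alpha> u s k)"
proof -
  have 1: "smooth_fun (\<lambda>s. c * (\<alpha> \<bullet> \<gamma> s))" for c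
    using \<gamma> by (rule smooth_fun_bounded_linear[rotated])
      (intro bounded_linear_const_mult bounded_linear_inner_right)
  have 2: "smooth_fun (\<lambda>s. exp (\<i> * complex_of_real (c * (\<alpha> \<bullet> \<gamma> s))))" for c
    by (rule smooth_fun_compose[OF smooth_cis_linear 1])
  have "(\<lambda>s. slow_field \<gamma> \<alpha> u s k) = (\<lambda>s. exp (\<i> * complex_of_real ((- k) * (\<alpha> \<bullet> \<gamma> s))) *
      (u k (\<gamma> s) + exp (\<i> * complex_of_real (k * (\<alpha> \<bullet> \<gamma> s)))))"
    by (simp add: slow_field_def total_field_def incident_field_def)
  then show ?thesis
    by (simp only:) (rule smooth_fun_mult[OF 2 smooth_fun_add[OF u 2]])
qed

text \<open>
  Split the remainder into the symbol left over by a long partial sum of the expansion and the finitely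
  many terms of that sum which are not in \<open>leading_indices \<beta>\<close>.
\<close>
lemma slow_remainder_bound_on_period:
  assumes data: "expansion_data P t b Z \<Psi>" and P: "P > 0"
    and expansion: "asymptotic_expansion P g (expansion_term b Z \<Psi>)"
    and smooth: "\<And>k. k > 0 \<Longrightarrow> smooth_fun (\<lambda>s. g s k)"
    and \<Lambda>: "\<And>s. s \<in> {0..2 * P} \<Longrightarrow> \<bar>Z s\<bar> + 1 \<le> \<Lambda>"
  shows "\<exists>C>0. \<forall>k\<ge>1. \<forall>m\<le>N. \<forall>s\<in>{0..2 * P}.
    norm (nderiv m (\<lambda>s. g s k - (\<Sum>i\<in>leading_indices \<beta>. expansion_term b Z \<Psi> i s k)) s)
      \<le> C * k powr (- real \<beta> / 3) * layer_rate Z \<Lambda> k s ^ m"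
proof -
  let ?E = "expansion_term b Z \<Psi>"
  \<comment> \<open>each derivative in \<open>s\<close> costs a factor \<open>k powr (1/3)\<close> in the symbol class, and \<open>N\<close> of them are needed\<close>
  define M where "M = real \<beta> / 3 + real N / 3 + 1"
  have "M > 0" by (simp add: M_def add_nonneg_pos)
  from expansion[unfolded asymptotic_expansion_def, rule_format, OF this] obtain F0 where
    F0_all: "finite F0 \<and> F0 \<subseteq> indices \<and> (\<forall>F. finite F \<and> F0 \<subseteq> F \<and> F \<subseteq> indices \<longrightarrow>
      (\<lambda>s k. g s k - (\<Sum>i\<in>F. ?E i s k)) \<in> symbol_class P (- M) (2/3) (1/3))" ..
  then have F0: "finite F0" "F0 \<subseteq> indices" by simp_all
  define F where "F = F0 \<union> leading_indices \<beta>"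
  have lead: "leading_indices \<beta> \<subseteq> indices" by (auto simp: leading_indices_def)
  have F: "finite F" "F \<subseteq> indices" "leading_indices \<beta> \<subseteq> F"
    using F0 lead finite_leading_indices by (auto simp: F_def)
  define r where "r = (\<lambda>s k. g s k - (\<Sum>i\<in>F. ?E i s k))"
  define T where "T = F - leading_indices \<beta>"
  have T: "finite T" "\<And>i. i \<in> T \<Longrightarrow> i \<in> indices" "\<And>i. i \<in> T \<Longrightarrow> term_order i \<le> - real \<beta> / 3"
    using F term_order_not_leading by (auto simp: T_def)
  have "r \<in> symbol_class P (- M) (2/3) (1/3)"
    unfolding r_def using F F0_all by (simp add: F_def)
  then obtain D where D: "mixed_derivs P r D"
    and D_bound: "\<forall>n m. \<forall>\<kappa>>0. \<exists>C. \<forall>s\<in>{0..2 * P}. \<forall>k\<ge>\<kappa>.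
              norm (D n m s k) \<le> C * k powr (- M + 1/3 * real n - 2/3 * real m)"
    unfolding symbol_class_def mem_Collect_eq by (elim exE conjE) (rule that)
  have "\<forall>n. \<exists>C. \<forall>s\<in>{0..2 * P}. \<forall>k\<ge>1. norm (D n 0 s k) \<le> C * k powr (- M + 1/3 * real n)"
  proof
    fix n
    show "\<exists>C. \<forall>s\<in>{0..2 * P}. \<forall>k\<ge>1. norm (D n 0 s k) \<le> C * k powr (- M + 1/3 * real n)"
      using D_bound[rule_format, of 1 n 0] by simp
  qed
  from choice[OF this] obtain C1 where C1: "\<forall>n. \<forall>s\<in>{0..2 * P}. \<forall>k\<ge>1. norm (D n 0 s k) \<le> C1 n * k powr (- M + 1/3 * real n)" ..
  define CR where "CR = 1 + (\<Sum>n\<le>N. \<bar>C1 n\<bar>)"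
  have CR: "CR > 0" unfolding CR_def by (intro add_pos_nonneg sum_nonneg) auto
  have "\<exists>C>0. \<forall>k\<ge>1. \<forall>m\<le>N. \<forall>s\<in>{0..2 * P}.
    norm (nderiv m (\<lambda>s. ?E i s k) s) \<le> C * k powr term_order i * layer_rate Z \<Lambda> k s ^ m" if "i \<in> T" for i
    by (rule expansion_term_bound[OF data T(2)[OF that] \<Lambda>])
  then have "\<forall>i. \<exists>C. i \<in> T \<longrightarrow> C > 0 \<and> (\<forall>k\<ge>1. \<forall>m\<le>N. \<forall>s\<in>{0..2 * P}.
    norm (nderiv m (\<lambda>s. ?E i s k) s) \<le> C * k powr term_order i * layer_rate Z \<Lambda> k s ^ m)"
    by blast
  from choice[OF this] obtain CT where CT: "\<forall>i. i \<in> T \<longrightarrow> CT i > 0 \<and> (\<forall>k\<ge>1. \<forall>m\<le>N. \<forall>s\<in>{0..2 * P}.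
    norm (nderiv m (\<lambda>s. ?E i s k) s) \<le> CT i * k powr term_order i * layer_rate Z \<Lambda> k s ^ m)" ..
  show ?thesis
  proof (intro exI[of _ "CR + (\<Sum>i\<in>T. CT i)"] conjI allI impI ballI)
    show "CR + (\<Sum>i\<in>T. CT i) > 0"
      using CR CT by (intro add_pos_nonneg sum_nonneg) (auto simp: less_imp_le)
    fix k :: real and m :: nat and s :: real
    assume k: "k \<ge> 1" and m: "m \<le> N" and s: "s \<in> {0..2 * P}"
    let ?\<mu> = "layer_rate Z \<Lambda> k s" and ?kb = "k powr (- real \<beta> / 3)"
    have \<mu>1: "?\<mu> \<ge> 1" using layer_rate_ge_1[OF k, of Z s \<Lambda>] \<Lambda>[OF s] by simp
    have sE: "smooth_fun (\<lambda>s. ?E i s k)" if "i \<in> F" for i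
      using smooth_expansion_term[OF data] that F by blast
    have sr: "smooth_fun (\<lambda>s. r s k)"
      unfolding r_def using k by (intro smooth_fun_diff smooth smooth_fun_sum F sE) auto
    have sT: "smooth_fun (\<lambda>s. \<Sum>i\<in>T. ?E i s k)"
      using T(1) by (intro smooth_fun_sum sE) (auto simp: T_def)
    have split: "(\<lambda>s. g s k - (\<Sum>i\<in>leading_indices \<beta>. ?E i s k)) = (\<lambda>s. r s k + (\<Sum>i\<in>T. ?E i s k))"
    proof
      fix s
      have "(\<Sum>i\<in>F. ?E i s k) = (\<Sum>i\<in>T. ?E i s k) + (\<Sum>i\<in>leading_indices \<beta>. ?E i s k)"
        unfolding T_def by (rule sum.subset_diff[OF F(3,1)])
      then show "g s k - (\<Sum>i\<in>leading_indices \<beta>. ?E i s k) = r s k + (\<Sum>i\<in>T. ?E i s k)"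
        by (simp add: r_def)
    qed
    have "norm (nderiv m (\<lambda>s. r s k) s) = norm (D m 0 s k)"
      using mixed_derivs_nderiv[OF D P sr _ s] k by simp
    also have "\<dots> \<le> C1 m * k powr (- M + 1/3 * real m)"
      using C1 s k by blast
    also have "\<dots> \<le> CR * ?kb"
    proof (rule mult_mono)
      have "C1 m \<le> \<bar>C1 m\<bar>" by simp
      also have "\<dots> \<le> (\<Sum>n\<le>N. \<bar>C1 n\<bar>)" using m by (intro member_le_sum) auto
      finally show "C1 m \<le> CR" by (simp add: CR_def)
      show "k powr (- M + 1/3 * real m) \<le> ?kb"
        using k m by (intro powr_mono) (auto simp: M_def)
    qed (use CR in auto)
    also have "\<dots> \<le> CR * ?kb * ?\<mu> ^ m"
      using mult_left_mono[OF one_le_power[OF \<mu>1, of m], of "CR * ?kb"] CR by simp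
    finally have 1: "norm (nderiv m (\<lambda>s. r s k) s) \<le> CR * ?kb * ?\<mu> ^ m" .
    have "norm (nderiv m (\<lambda>s. \<Sum>i\<in>T. ?E i s k) s) = norm (\<Sum>i\<in>T. nderiv m (\<lambda>s. ?E i s k) s)"
      using nderiv_sum[of T "\<lambda>i s. ?E i s k" m] T(1) sE by (simp add: T_def)
    also have "\<dots> \<le> (\<Sum>i\<in>T. CT i * ?kb * ?\<mu> ^ m)"
    proof (rule sum_norm_le)
      fix i assume i: "i \<in> T"
      have CTi: "CT i > 0" using CT i by blast
      have "norm (nderiv m (\<lambda>s. ?E i s k) s) \<le> CT i * k powr term_order i * ?\<mu> ^ m"
        using CT i k m s by blast
      also have "\<dots> \<le> CT i * ?kb * ?\<mu> ^ m"
        using CTi k T(3)[OF i] \<mu>1 by (intro mult_right_mono mult_left_mono powr_mono) auto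
      finally show "norm (nderiv m (\<lambda>s. ?E i s k) s) \<le> CT i * ?kb * ?\<mu> ^ m" .
    qed
    finally have 2: "norm (nderiv m (\<lambda>s. \<Sum>i\<in>T. ?E i s k) s) \<le> (\<Sum>i\<in>T. CT i) * ?kb * ?\<mu> ^ m"
      by (simp add: sum_distrib_right)
    show "norm (nderiv m (\<lambda>s. g s k - (\<Sum>i\<in>leading_indices \<beta>. ?E i s k)) s)
      \<le> (CR + (\<Sum>i\<in>T. CT i)) * ?kb * ?\<mu> ^ m"
      unfolding split nderiv_add[OF sr sT]
      using norm_triangle_ineq[of "nderiv m (\<lambda>s. r s k) s" "nderiv m (\<lambda>s. \<Sum>i\<in>T. ?E i s k) s"] 1 2
      by (simp add: algebra_simps)
  qed
qed

text \<open>
  Close to \<open>t0\<close> the difference quotient of \<open>Z\<close> stays near its nonzero limit; away from \<open>t0\<close> the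
  function is bounded below by compactness.
\<close>
lemma simple_zero_lower_bound:
  fixes Z :: "real \<Rightarrow> real"
  assumes Z: "smooth_fun Z" and zero: "Z t0 = 0" "vector_derivative Z (at t0) \<noteq> 0"
    and nz: "\<And>s. s \<in> {a..b} \<Longrightarrow> s \<noteq> t0 \<Longrightarrow> Z s \<noteq> 0"
  shows "\<exists>c>0. \<forall>s\<in>{a..b}. c * \<bar>s - t0\<bar> \<le> \<bar>Z s\<bar>"
proof -
  define D where "D = nderiv 1 Z t0"
  have D: "D \<noteq> 0" using zero by (simp add: D_def nderiv_Suc)
  have "(Z has_real_derivative D) (at t0)"
    using smooth_fun_has_deriv_1[OF Z, of t0] by (simp add: D_def has_real_derivative_iff_has_vector_derivative)
  then have "(\<lambda>h. Z (t0 + h) / h) \<midarrow>0\<rightarrow> D"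
    using zero by (simp add: DERIV_def)
  from LIM_D[OF this, of "\<bar>D\<bar> / 2"] D obtain \<delta> where
    \<delta>: "\<delta> > 0" "\<And>h. h \<noteq> 0 \<Longrightarrow> \<bar>h\<bar> < \<delta> \<Longrightarrow> \<bar>Z (t0 + h) / h - D\<bar> < \<bar>D\<bar> / 2"
    by auto
  have near: "\<bar>D\<bar> / 2 * \<bar>s - t0\<bar> \<le> \<bar>Z s\<bar>" if "\<bar>s - t0\<bar> < \<delta>" for s
  proof (cases "s = t0")
    case False
    then have "\<bar>Z s / (s - t0) - D\<bar> < \<bar>D\<bar> / 2"
      using \<delta>(2)[of "s - t0"] that by simp
    then have "\<bar>D\<bar> / 2 \<le> \<bar>Z s / (s - t0)\<bar>"
      by linarith
    then show ?thesis
      using False by (simp add: abs_divide le_divide_eq)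
  qed (simp add: zero)
  let ?S = "{a..b} - ball t0 \<delta>"
  have "\<exists>m>0. \<forall>s\<in>?S. m \<le> \<bar>Z s\<bar>"
  proof (cases "?S = {}")
    case False
    have "compact ?S" by (intro compact_diff) auto
    moreover have "continuous_on ?S (\<lambda>s. \<bar>Z s\<bar>)"
      by (intro continuous_intros smooth_fun_continuous_on_0[OF Z])
    ultimately obtain s0 where s0: "s0 \<in> ?S" "\<And>s. s \<in> ?S \<Longrightarrow> \<bar>Z s0\<bar> \<le> \<bar>Z s\<bar>"
      using continuous_attains_inf[of ?S "\<lambda>s. \<bar>Z s\<bar>"] False by blast
    then have "s0 \<noteq> t0" using \<delta>(1) by auto
    then have "\<bar>Z s0\<bar> > 0" using nz s0(1) by auto
    then show ?thesis using s0(2) by blast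
  qed (auto intro: exI[of _ 1])
  then obtain m where m: "m > 0" "\<And>s. s \<in> ?S \<Longrightarrow> m \<le> \<bar>Z s\<bar>" by blast
  define L where "L = 1 + \<bar>a - t0\<bar> + \<bar>b - t0\<bar>"
  have L: "L > 0" by (simp add: L_def)
  show ?thesis
  proof (intro exI[of _ "min (\<bar>D\<bar> / 2) (m / L)"] conjI ballI)
    show "min (\<bar>D\<bar> / 2) (m / L) > 0" using D m L by simp
    fix s assume s: "s \<in> {a..b}"
    show "min (\<bar>D\<bar> / 2) (m / L) * \<bar>s - t0\<bar> \<le> \<bar>Z s\<bar>"
    proof (cases "\<bar>s - t0\<bar> < \<delta>")
      case True
      have "min (\<bar>D\<bar> / 2) (m / L) * \<bar>s - t0\<bar> \<le> \<bar>D\<bar> / 2 * \<bar>s - t0\<bar>"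
        by (intro mult_right_mono min.cobounded1) auto
      then show ?thesis using near[OF True] by linarith
    next
      case False
      have "min (\<bar>D\<bar> / 2) (m / L) * \<bar>s - t0\<bar> \<le> m / L * L"
        using s m L by (intro mult_mono min.cobounded2) (auto simp: L_def)
      also have "\<dots> = m" using L by simp
      also have "\<dots> \<le> \<bar>Z s\<bar>"
        using s False by (intro m(2)) (auto simp: dist_real_def abs_minus_commute)
      finally show ?thesis .
    qed
  qed
qed


section \<open>Approximation on one interval after a change of variables\<close>

lemma strictly_increasing_unit:
  assumes \<Phi>: "smooth_fun \<Phi>" and pos: "\<And>x. x \<in> {0..1} \<Longrightarrow> nderiv 1 \<Phi> x > (0::real)"
    and "x \<in> {0..1}" "y \<in> {0..1}" "x < y"
  shows "\<Phi> x < \<Phi> y"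
proof (rule DERIV_pos_imp_increasing[OF \<open>x < y\<close>])
  fix z assume "x \<le> z" "z \<le> y"
  then show "\<exists>d. (\<Phi> has_real_derivative d) (at z) \<and> 0 < d"
    using assms smooth_fun_has_deriv_1[OF \<Phi>, of z]
    by (intro exI[of _ "nderiv 1 \<Phi> z"]) (auto simp: has_real_derivative_iff_has_vector_derivative)
qed

text \<open>
  On the unit interval the inverse of the change of variables, evaluated along \<open>\<Phi>\<close>, is an affine
  function; therefore polynomials in this inverse correspond to polynomials on \<open>[0, 1]\<close>.
\<close>
lemma change_of_var_inverse:
  fixes \<Phi> :: "real \<Rightarrow> real"
  assumes \<Phi>: "smooth_fun \<Phi>" and ab: "a < b" and ends: "\<Phi> 0 = a" "\<Phi> 1 = b"
    and pos: "\<And>x. x \<in> {0..1} \<Longrightarrow> nderiv 1 \<Phi> x > 0"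
  defines "\<psi> \<equiv> \<lambda>s. \<Phi> ((s - a) / (b - a))"
  shows "x \<in> {0..1} \<Longrightarrow> the_inv_into {a..b} \<psi> (\<Phi> x) = a + (b - a) * x"
    and "continuous_on {a..b} (the_inv_into {a..b} \<psi>)"
    and "x \<in> {0..1} \<Longrightarrow> \<Phi> x \<in> {a..b}"
proof -
  have unit: "(s - a) / (b - a) \<in> {0..1}" if "s \<in> {a..b}" for s
    using that ab by (auto simp: field_simps)
  have mono: "\<psi> s < \<psi> s'" if "s \<in> {a..b}" "s' \<in> {a..b}" "s < s'" for s s'
    unfolding \<psi>_def using that ab
    by (intro strictly_increasing_unit[OF \<Phi> pos] unit) (auto simp: divide_strict_right_mono)
  then have inj: "inj_on \<psi> {a..b}"
    by (intro linorder_inj_onI) (auto simp: less_imp_neq)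
  have psi_ends: "\<psi> a = a" "\<psi> b = b"
    using ab ends by (auto simp: \<psi>_def)
  have maps: "\<psi> s \<in> {a..b}" if "s \<in> {a..b}" for s
    using mono[of a s] mono[of s b] psi_ends that ab by (cases "s = a"; cases "s = b") (auto simp: less_imp_le)
  have cont: "continuous_on {a..b} \<psi>"
    unfolding \<psi>_def
    by (rule continuous_on_compose2[OF smooth_fun_continuous_on_0[OF \<Phi>, of UNIV]])
      (use ab in \<open>auto intro!: continuous_intros\<close>)
  have img: "\<psi> ` {a..b} = {a..b}"
  proof (intro equalityI subsetI)
    fix y assume "y \<in> {a..b}"
    then have "\<exists>s\<ge>a. s \<le> b \<and> \<psi> s = y"
      using IVT'[of \<psi> a y b] cont psi_ends ab by auto
    then show "y \<in> \<psi> ` {a..b}" by auto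
  qed (use maps in auto)
  have psi: "\<psi> (a + (b - a) * x) = \<Phi> x" "a + (b - a) * x \<in> {a..b}" if "x \<in> {0..1}" for x
  proof -
    show "\<psi> (a + (b - a) * x) = \<Phi> x" using ab by (simp add: \<psi>_def)
    have "(b - a) * x \<le> b - a" "0 \<le> (b - a) * x"
      using that ab by (auto intro: mult_left_le)
    then show "a + (b - a) * x \<in> {a..b}" unfolding atLeastAtMost_iff by linarith
  qed
  show "the_inv_into {a..b} \<psi> (\<Phi> x) = a + (b - a) * x" if "x \<in> {0..1}"
    using the_inv_into_f_f[OF inj psi(2)[OF that]] psi(1)[OF that] by simp
  show "\<Phi> x \<in> {a..b}" if "x \<in> {0..1}"
    using maps[OF psi(2)[OF that]] psi(1)[OF that] by simp
  have "continuous_on (\<psi> ` {a..b}) (the_inv_into {a..b} \<psi>)"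
    by (rule continuous_on_inv[OF cont]) (auto simp: the_inv_into_f_f[OF inj])
  then show "continuous_on {a..b} (the_inv_into {a..b} \<psi>)" by (simp add: img)
qed

text \<open>
  Mean square approximation on \<open>I\<close> by the functions \<open>p \<circ> \<phi>\<^sup>-\<^sup>1\<close>; the error \<open>\<epsilon>\<close> is squared.
  Continuity of the inverse makes these functions measurable and bounded.
\<close>
definition poly_approximable ::
    "real set \<Rightarrow> (real \<Rightarrow> real) \<Rightarrow> nat \<Rightarrow> (real \<Rightarrow> complex) \<Rightarrow> real \<Rightarrow> bool" where
  "poly_approximable I \<phi> d g \<epsilon> \<longleftrightarrow>
     (\<exists>p. degree p \<le> d \<and> continuous_on I (the_inv_into I \<phi>) \<and>
        integral I (\<lambda>s. (norm (g s - poly p (complex_of_real (the_inv_into I \<phi> s))))\<^sup>2) \<le> \<epsilon>)"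

lemma poly_approximable_mono:
  "poly_approximable I \<phi> d g \<epsilon> \<Longrightarrow> \<epsilon> \<le> \<epsilon>' \<Longrightarrow> poly_approximable I \<phi> d g \<epsilon>'"
  unfolding poly_approximable_def by (meson order_trans)

text \<open>
  Pull everything back to the unit interval by \<open>s = \<Phi> x\<close>: the trial functions become polynomials in
  \<open>x\<close>, to which Jackson's bound for \<open>g \<circ> \<Phi>\<close> applies, and \<open>J\<close> bounds the Jacobian.
\<close>
lemma region_approximation:
  "\<exists>K>0. \<forall>(g :: real \<Rightarrow> complex) \<Phi> a b J B d. smooth_fun g \<longrightarrow> smooth_fun \<Phi> \<longrightarrow> a < b \<longrightarrow>
     \<Phi> 0 = a \<longrightarrow> \<Phi> 1 = b \<longrightarrow> (\<forall>x\<in>{0..1}. 0 < nderiv 1 \<Phi> x \<and> nderiv 1 \<Phi> x \<le> J) \<longrightarrow>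
     B > 0 \<longrightarrow> d \<ge> 1 \<longrightarrow> d + 1 \<ge> n \<longrightarrow>
     (\<forall>x\<in>{0..1}. norm (nderiv n (\<lambda>x. g (\<Phi> x)) x) \<le> B) \<longrightarrow>
     poly_approximable {a..b} (\<lambda>s. \<Phi> ((s - a) / (b - a))) d g (K * J * (B / real d ^ n)\<^sup>2)"
proof -
  obtain K where K: "K > 0" and all: "\<forall>(h :: real \<Rightarrow> complex) B d. smooth_fun h \<longrightarrow> B > 0 \<longrightarrow> d \<ge> 1 \<longrightarrow> d + 1 \<ge> n \<longrightarrow>
     (\<forall>x\<in>{0..1}. norm (nderiv n h x) \<le> B) \<longrightarrow>
     (\<exists>p. degree p \<le> d \<and>
        integral {0..1} (\<lambda>x. (norm (h x - poly p (complex_of_real x)))\<^sup>2) \<le> K * (B / real d ^ n)\<^sup>2)"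
    using complex_jackson[of n] by (elim exE conjE) (rule that)
  show ?thesis
  proof (intro exI[of _ K] conjI allI impI)
    show "K > 0" by (rule K)
    fix g :: "real \<Rightarrow> complex" and \<Phi> :: "real \<Rightarrow> real" and a b J B :: real and d :: nat
    assume g: "smooth_fun g" and \<Phi>: "smooth_fun \<Phi>" and ab: "a < b" and ends: "\<Phi> 0 = a" "\<Phi> 1 = b"
      and der: "\<forall>x\<in>{0..1}. 0 < nderiv 1 \<Phi> x \<and> nderiv 1 \<Phi> x \<le> J"
      and B: "B > 0" and d: "d \<ge> 1" "d + 1 \<ge> n"
      and bound: "\<forall>x\<in>{0..1}. norm (nderiv n (\<lambda>x. g (\<Phi> x)) x) \<le> B"
    let ?inv = "the_inv_into {a..b} (\<lambda>s. \<Phi> ((s - a) / (b - a)))"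
    note inv = change_of_var_inverse[OF \<Phi> ab ends]
    have inv_eq: "?inv (\<Phi> x) = a + (b - a) * x" and in_ab: "\<Phi> x \<in> {a..b}" if "x \<in> {0..1}" for x
      using inv(1,3) der that by auto
    have cont_inv: "continuous_on {a..b} ?inv"
      using inv(2) der by auto
    obtain p0 where p0: "degree p0 \<le> d"
      "integral {0..1} (\<lambda>x. (norm (g (\<Phi> x) - poly p0 (complex_of_real x)))\<^sup>2) \<le> K * (B / real d ^ n)\<^sup>2"
      using all[rule_format, OF smooth_fun_compose[OF g \<Phi>] B d] bound by blast
    define p where "p = pcompose p0 [:complex_of_real (- a / (b - a)), complex_of_real (1 / (b - a)):]"
    have deg: "degree p \<le> d"
      unfolding p_def using p0(1) ab by (simp add: degree_pcompose)
    have p_eq: "poly p (complex_of_real (?inv (\<Phi> x))) = poly p0 (complex_of_real x)" if "x \<in> {0..1}" for x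
    proof -
      have "- a / (b - a) + (a + (b - a) * x) * (1 / (b - a)) = x"
        using ab by (simp add: add_divide_distrib)
      then have "complex_of_real (- a / (b - a)) + complex_of_real (a + (b - a) * x) * complex_of_real (1 / (b - a))
          = complex_of_real x"
        by (simp only: of_real_add[symmetric] of_real_mult[symmetric])
      then show ?thesis
        by (simp only: p_def poly_pcompose inv_eq[OF that] poly_pCons poly_0 mult_zero_right add_0_right)
    qed
    let ?F = "\<lambda>s. (norm (g s - poly p (complex_of_real (?inv s))))\<^sup>2"
    have cont_F: "continuous_on {a..b} ?F"
      by (intro continuous_intros smooth_fun_continuous_on_0[OF g] cont_inv)
    have sub: "((\<lambda>x. nderiv 1 \<Phi> x *\<^sub>R ?F (\<Phi> x)) has_integral (integral {\<Phi> 0..\<Phi> 1} ?F)) {0..1}"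
    proof (rule has_integral_substitution[where c = a and d = b])
      show "(\<Phi> has_real_derivative nderiv 1 \<Phi> x) (at x within {0..1})" for x
        unfolding has_real_derivative_iff_has_vector_derivative
        by (rule has_vector_derivative_at_within[OF smooth_fun_has_deriv_1[OF \<Phi>]])
    qed (use ab ends in_ab cont_F in auto)
    have int_h: "(\<lambda>x. (norm (g (\<Phi> x) - poly p0 (complex_of_real x)))\<^sup>2) integrable_on {0..1}"
      by (intro integrable_continuous_real continuous_intros smooth_fun_continuous_on_0[OF smooth_fun_compose[OF g \<Phi>]])
    have J: "J \<ge> 0" using der[rule_format, of 0] by simp
    have "integral {a..b} ?F = integral {0..1} (\<lambda>x. nderiv 1 \<Phi> x *\<^sub>R ?F (\<Phi> x))"
      using integral_unique[OF sub] ends by simp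
    also have "\<dots> \<le> integral {0..1} (\<lambda>x. J * (norm (g (\<Phi> x) - poly p0 (complex_of_real x)))\<^sup>2)"
    proof (rule integral_le)
      show "(\<lambda>x. nderiv 1 \<Phi> x *\<^sub>R ?F (\<Phi> x)) integrable_on {0..1}" using sub by blast
      show "(\<lambda>x. J * (norm (g (\<Phi> x) - poly p0 (complex_of_real x)))\<^sup>2) integrable_on {0..1}"
        by (rule integrable_on_mult_right[OF int_h])
      fix x :: real assume x: "x \<in> {0..1}"
      then show "nderiv 1 \<Phi> x *\<^sub>R ?F (\<Phi> x) \<le> J * (norm (g (\<Phi> x) - poly p0 (complex_of_real x)))\<^sup>2"
        unfolding p_eq[OF x] real_scaleR_def using der by (intro mult_right_mono) auto
    qed
    also have "\<dots> = J * integral {0..1} (\<lambda>x. (norm (g (\<Phi> x) - poly p0 (complex_of_real x)))\<^sup>2)"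
      by (rule integral_mult_right)
    also have "\<dots> \<le> J * (K * (B / real d ^ n)\<^sup>2)"
      by (rule mult_left_mono[OF p0(2) J])
    finally have "integral {a..b} ?F \<le> K * J * (B / real d ^ n)\<^sup>2"
      by (simp add: mult_ac)
    with deg cont_inv show "poly_approximable {a..b} (\<lambda>s. \<Phi> ((s - a) / (b - a))) d g (K * J * (B / real d ^ n)\<^sup>2)"
      unfolding poly_approximable_def by blast
  qed
qed

text \<open>
  The changes of variables to the right (\<open>e = 1\<close>) and to the left (\<open>e = - 1\<close>) of a shadow boundary
  point \<open>t\<close>, pulled back to the unit interval. In both cases the distance from \<open>t\<close> is the linear
  factor, with values between the two constants of the region, times an exponential with rate
  \<open>\<omega> = ln k / 3\<close> that runs between \<open>k powr (- 1/3)\<close> and \<open>1\<close>.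
\<close>
definition layer_map :: "real \<Rightarrow> real \<Rightarrow> real \<Rightarrow> real \<Rightarrow> real \<Rightarrow> real \<Rightarrow> real \<Rightarrow> real" where
  "layer_map t p q e f \<omega> x = t + e * ((p + q * x) * exp (\<omega> * (e * x + f)))"

lemma
  assumes e: "e\<^sup>2 = (1::real)"
  shows smooth_layer_map: "smooth_fun (layer_map t p q e f \<omega>)"
    and nderiv_layer_map: "i \<ge> 1 \<Longrightarrow> nderiv i (layer_map t p q e f \<omega>) x =
      e * ((p + q * x) * (\<omega> * e) ^ i + real i * q * (\<omega> * e) ^ (i - 1)) * exp (\<omega> * (e * x + f))"
proof -
  define D where "D = (\<lambda>i x. (if i = 0 then t else 0) +
    e * ((p + q * x) * (\<omega> * e) ^ i + real i * q * (\<omega> * e) ^ (i - 1)) * exp (\<omega> * (e * x + f)))"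
  have D: "(D i has_vector_derivative D (Suc i) x) (at x)" for i x
  proof -
    have "(D i has_real_derivative
       e * (q * (\<omega> * e) ^ i) * exp (\<omega> * (e * x + f)) +
       e * ((p + q * x) * (\<omega> * e) ^ i + real i * q * (\<omega> * e) ^ (i - 1)) * (exp (\<omega> * (e * x + f)) * (\<omega> * e))) (at x)"
      unfolding D_def by (auto intro!: derivative_eq_intros)
    also have "e * (q * (\<omega> * e) ^ i) * exp (\<omega> * (e * x + f)) +
       e * ((p + q * x) * (\<omega> * e) ^ i + real i * q * (\<omega> * e) ^ (i - 1)) * (exp (\<omega> * (e * x + f)) * (\<omega> * e))
       = D (Suc i) x"
      by (cases i) (simp_all add: D_def algebra_simps)
    finally show ?thesis by (simp add: has_real_derivative_iff_has_vector_derivative)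
  qed
  have "D 0 = layer_map t p q e f \<omega>"
    by (auto simp: D_def layer_map_def)
  then show "smooth_fun (layer_map t p q e f \<omega>)"
    and "i \<ge> 1 \<Longrightarrow> nderiv i (layer_map t p q e f \<omega>) x =
      e * ((p + q * x) * (\<omega> * e) ^ i + real i * q * (\<omega> * e) ^ (i - 1)) * exp (\<omega> * (e * x + f))"
    using derivative_sequence_smooth[of D, OF D] derivative_sequence_nderiv[of D i, OF D]
    by (auto simp: D_def)
qed

text \<open>
  Let \<open>w\<close> be the distance of \<open>\<Phi> x\<close> from \<open>t\<close>. Every derivative of \<open>\<Phi>\<close> of order \<open>i \<ge> 1\<close> is at most a
  constant times \<open>w * \<omega> ^ i\<close>, because the linear factor of \<open>w\<close> is bounded below and \<open>\<omega>\<close> is bounded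
  away from zero for \<open>k \<ge> k\<^sub>0 > 1\<close>; a derivative of \<open>g\<close> costs at most a constant times \<open>1 / w\<close>. So the
  composition bound applies with \<open>\<mu> = \<omega>\<close>. The Jacobian is at most a constant times \<open>ln k\<close>.
\<close>
lemma layer_approximation:
  fixes t \<xi> \<xi>' k\<^sub>0 :: real
  assumes \<xi>: "0 < \<xi>" "\<xi> \<le> \<xi>'" and k0: "k\<^sub>0 > 1" and cZ: "cZ > 0" and \<Lambda>: "\<Lambda> > 0"
    and e: "e = 1 \<and> p = \<xi> \<and> q = \<xi>' - \<xi> \<and> f = - 1 \<or> e = - 1 \<and> p = \<xi>' \<and> q = \<xi> - \<xi>' \<and> f = 0"
  shows "\<exists>K>0. \<forall>k\<ge>k\<^sub>0. \<forall>(g :: real \<Rightarrow> complex) B d. smooth_fun g \<longrightarrow> B > 0 \<longrightarrow> d \<ge> 1 \<longrightarrow> d + 1 \<ge> n \<longrightarrow>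
     (let \<Phi> = layer_map t p q e f (ln k / 3); a = \<Phi> 0; b = \<Phi> 1 in
      (\<forall>s\<in>{a..b}. cZ * \<bar>s - t\<bar> \<le> \<bar>Z s\<bar>) \<longrightarrow>
      (\<forall>m\<le>n. \<forall>s\<in>{a..b}. norm (nderiv m g s) \<le> B * layer_rate Z \<Lambda> k s ^ m) \<longrightarrow>
      poly_approximable {a..b} (\<lambda>s. \<Phi> ((s - a) / (b - a))) d g ((K * B * sqrt (ln k) * (ln k ^ n / real d ^ n))\<^sup>2))"
proof -
  define \<omega>0 where "\<omega>0 = ln k\<^sub>0 / 3"
  have \<omega>0: "\<omega>0 > 0" using k0 by (simp add: \<omega>0_def)
  define c where "c = (1 + real n * (\<xi>' - \<xi>) / (\<xi> * \<omega>0)) * \<Lambda> / cZ"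
  have c: "c > 0"
    using \<xi> \<omega>0 \<Lambda> cZ unfolding c_def by (intro divide_pos_pos mult_pos_pos add_pos_nonneg) auto
  obtain K1 where K1: "K1 > 0" and region: "\<forall>(g :: real \<Rightarrow> complex) \<Phi> a b J B d. smooth_fun g \<longrightarrow> smooth_fun \<Phi> \<longrightarrow> a < b \<longrightarrow>
     \<Phi> 0 = a \<longrightarrow> \<Phi> 1 = b \<longrightarrow> (\<forall>x\<in>{0..1}. 0 < nderiv 1 \<Phi> x \<and> nderiv 1 \<Phi> x \<le> J) \<longrightarrow>
     B > 0 \<longrightarrow> d \<ge> 1 \<longrightarrow> d + 1 \<ge> n \<longrightarrow>
     (\<forall>x\<in>{0..1}. norm (nderiv n (\<lambda>x. g (\<Phi> x)) x) \<le> B) \<longrightarrow>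
     poly_approximable {a..b} (\<lambda>s. \<Phi> ((s - a) / (b - a))) d g (K1 * J * (B / real d ^ n)\<^sup>2)"
    using region_approximation[of n] by (elim exE conjE) (rule that)
  define K2 where "K2 = compose_const c n"
  have K2: "K2 \<ge> 1" using c compose_const_ge_1 by (simp add: K2_def)
  define J0 where "J0 = (\<xi>' - \<xi>) / \<omega>0 + \<xi>'"
  have J0: "J0 > 0" using \<xi> \<omega>0 unfolding J0_def by (intro add_nonneg_pos) auto
  define K where "K = sqrt (K1 * J0) * K2"
  show ?thesis
  proof (intro exI[of _ K] conjI allI impI)
    show "K > 0" using K1 K2 J0 by (simp add: K_def)
    fix k :: real and g :: "real \<Rightarrow> complex" and B :: real and d :: nat
    assume k: "k \<ge> k\<^sub>0" and g: "smooth_fun g" and B: "B > 0" and d: "d \<ge> 1" "d + 1 \<ge> n"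
    define \<omega> where "\<omega> = ln k / 3"
    have \<omega>: "\<omega> \<ge> \<omega>0" "\<omega> > 0" using k k0 \<omega>0 by (auto simp: \<omega>_def \<omega>0_def)
    have lnk: "ln k > 0" using k k0 by simp
    define \<Phi> where "\<Phi> = layer_map t p q e f \<omega>"
    define a where "a = \<Phi> 0"
    define b where "b = \<Phi> 1"
    have e2: "e\<^sup>2 = 1" and ee: "e * e = 1" and eq: "e * q = \<xi>' - \<xi>" and absq: "\<bar>q\<bar> = \<xi>' - \<xi>" and abse: "\<bar>e\<bar> = 1"
      using e \<xi> by auto
    have pq: "\<xi> \<le> p + q * x" "p + q * x \<le> \<xi>'" "e * x + f \<le> 0" if "x \<in> {0..1}" for x
    proof -
      have "(\<xi>' - \<xi>) * x \<le> \<xi>' - \<xi>" "0 \<le> (\<xi>' - \<xi>) * x"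
        using that \<xi> by (auto intro: mult_left_le)
      then show "\<xi> \<le> p + q * x" "p + q * x \<le> \<xi>'" "e * x + f \<le> 0"
        using e that by (auto simp: algebra_simps)
    qed
    have s\<Phi>: "smooth_fun \<Phi>" unfolding \<Phi>_def by (rule smooth_layer_map[OF e2])
    have der: "nderiv 1 \<Phi> x = (\<omega> * (p + q * x) + (\<xi>' - \<xi>)) * exp (\<omega> * (e * x + f))" for x
    proof -
      have "nderiv 1 \<Phi> x = ((e * e) * \<omega> * (p + q * x) + e * q) * exp (\<omega> * (e * x + f))"
        unfolding \<Phi>_def by (subst nderiv_layer_map[OF e2]) (simp_all add: algebra_simps)
      then show ?thesis by (simp add: ee eq)
    qed
    have der_bound: "0 < nderiv 1 \<Phi> x \<and> nderiv 1 \<Phi> x \<le> J0 * \<omega>" if x: "x \<in> {0..1}" for x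
    proof
      have pos: "\<omega> * (p + q * x) + (\<xi>' - \<xi>) > 0"
        using mult_pos_pos[of \<omega> "p + q * x"] pq[OF x] \<omega> \<xi> by linarith
      then show "0 < nderiv 1 \<Phi> x" unfolding der by simp
      have "nderiv 1 \<Phi> x \<le> (\<omega> * (p + q * x) + (\<xi>' - \<xi>)) * 1"
        unfolding der using pos pq[OF x] \<omega> by (intro mult_left_mono) (auto simp: mult_nonneg_nonpos)
      also have "\<dots> \<le> \<omega> * \<xi>' + (\<xi>' - \<xi>) / \<omega>0 * \<omega>"
      proof -
        have "(\<xi>' - \<xi>) / \<omega>0 * \<omega>0 \<le> (\<xi>' - \<xi>) / \<omega>0 * \<omega>"
          using \<omega> \<omega>0 \<xi> by (intro mult_left_mono) auto
        moreover have "\<omega> * (p + q * x) \<le> \<omega> * \<xi>'"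
          using pq[OF x] \<omega> by (intro mult_left_mono) auto
        ultimately show ?thesis using \<omega>0 by simp
      qed
      also have "\<dots> = J0 * \<omega>" by (simp add: J0_def algebra_simps)
      finally show "nderiv 1 \<Phi> x \<le> J0 * \<omega>" .
    qed
    have ab: "a < b"
      unfolding a_def b_def using strictly_increasing_unit[OF s\<Phi>, of 0 1] der_bound by auto
    have "poly_approximable {a..b} (\<lambda>s. \<Phi> ((s - a) / (b - a))) d g ((K * B * sqrt (ln k) * (ln k ^ n / real d ^ n))\<^sup>2)"
      if Z: "\<forall>s\<in>{a..b}. cZ * \<bar>s - t\<bar> \<le> \<bar>Z s\<bar>"
        and bound: "\<forall>m\<le>n. \<forall>s\<in>{a..b}. norm (nderiv m g s) \<le> B * layer_rate Z \<Lambda> k s ^ m"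
    proof -
      have hbound: "norm (nderiv n (\<lambda>x. g (\<Phi> x)) x) \<le> K2 * B * \<omega> ^ n" if x: "x \<in> {0..1}" for x
      proof -
        have \<Phi>x: "\<Phi> x \<in> {a..b}"
          using change_of_var_inverse(3)[OF s\<Phi> ab] der_bound x by (auto simp: a_def b_def)
        define w where "w = (p + q * x) * exp (\<omega> * (e * x + f))"
        have w: "w > 0" using pq[OF x] \<xi> by (simp add: w_def)
        have "\<bar>\<Phi> x - t\<bar> = w"
          using w abse by (simp add: \<Phi>_def layer_map_def w_def[symmetric] abs_mult)
        then have Zw: "cZ * w \<le> \<bar>Z (\<Phi> x)\<bar>" using Z \<Phi>x by auto
        let ?\<nu> = "layer_rate Z \<Lambda> k (\<Phi> x)"
        have kp: "k powr (- 1/3) > 0" using k k0 by simp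
        have \<nu>: "?\<nu> > 0" unfolding layer_rate_def using kp \<Lambda> by (intro divide_pos_pos add_pos_nonneg) auto
        have "cZ * w \<le> k powr (- 1/3) + \<bar>Z (\<Phi> x)\<bar>" "0 < k powr (- 1/3) + \<bar>Z (\<Phi> x)\<bar>"
          using Zw kp by linarith+
        then have \<nu>w: "?\<nu> \<le> \<Lambda> / (cZ * w)"
          unfolding layer_rate_def using \<Lambda> cZ w by (intro divide_left_mono mult_pos_pos) auto
        show ?thesis
          unfolding K2_def
        proof (rule nderiv_compose_bound[OF c s\<Phi> \<nu> _ g _ order_refl])
          fix i assume i: "1 \<le> i" "i \<le> n"
          have "\<bar>nderiv i \<Phi> x\<bar> = \<bar>(p + q * x) * (\<omega> * e) ^ i + real i * q * (\<omega> * e) ^ (i - 1)\<bar> * exp (\<omega> * (e * x + f))"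
            unfolding \<Phi>_def using nderiv_layer_map[OF e2, of i] i abse by (simp add: abs_mult)
          also have "\<dots> \<le> ((p + q * x) * \<omega> ^ i + real n * (\<xi>' - \<xi>) * \<omega> ^ (i - 1)) * exp (\<omega> * (e * x + f))"
          proof (intro mult_right_mono order_trans[OF abs_triangle_ineq] add_mono)
            show "\<bar>(p + q * x) * (\<omega> * e) ^ i\<bar> \<le> (p + q * x) * \<omega> ^ i"
              using pq[OF x] \<xi> \<omega> abse by (simp add: abs_mult power_abs power_mult_distrib)
            show "\<bar>real i * q * (\<omega> * e) ^ (i - 1)\<bar> \<le> real n * (\<xi>' - \<xi>) * \<omega> ^ (i - 1)"
              using i \<xi> \<omega> abse absq
              by (simp add: abs_mult power_abs power_mult_distrib mult_right_mono)
          qed auto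
          also have "\<dots> \<le> ((p + q * x) * \<omega> ^ i + real n * (\<xi>' - \<xi>) / (\<xi> * \<omega>0) * ((p + q * x) * \<omega> ^ i)) * exp (\<omega> * (e * x + f))"
          proof (intro mult_right_mono add_left_mono)
            have "\<xi> * \<omega>0 * \<omega> ^ (i - 1) \<le> (p + q * x) * \<omega> * \<omega> ^ (i - 1)"
              using pq[OF x] \<xi> \<omega> \<omega>0 by (intro mult_right_mono mult_mono) auto
            also have "\<dots> = (p + q * x) * \<omega> ^ i" using i by (cases i) auto
            finally have "real n * (\<xi>' - \<xi>) / (\<xi> * \<omega>0) * (\<xi> * \<omega>0 * \<omega> ^ (i - 1)) \<le>
                real n * (\<xi>' - \<xi>) / (\<xi> * \<omega>0) * ((p + q * x) * \<omega> ^ i)"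
              using \<xi> \<omega>0 by (intro mult_left_mono) auto
            then show "real n * (\<xi>' - \<xi>) * \<omega> ^ (i - 1) \<le> real n * (\<xi>' - \<xi>) / (\<xi> * \<omega>0) * ((p + q * x) * \<omega> ^ i)"
              using \<xi> \<omega>0 by simp
          qed auto
          also have "\<dots> = (1 + real n * (\<xi>' - \<xi>) / (\<xi> * \<omega>0)) * w * \<omega> ^ i"
          proof -
            have "(u * v + c0 * (u * v)) * z = (1 + c0) * (u * z) * v" for u v z c0 :: real
              by (simp add: algebra_simps)
            then show ?thesis by (simp only: w_def)
          qed
          finally have "\<bar>nderiv i \<Phi> x\<bar> \<le> (1 + real n * (\<xi>' - \<xi>) / (\<xi> * \<omega>0)) * w * \<omega> ^ i" .
          then have "\<bar>nderiv i \<Phi> x\<bar> * ?\<nu> \<le> ((1 + real n * (\<xi>' - \<xi>) / (\<xi> * \<omega>0)) * w * \<omega> ^ i) * (\<Lambda> / (cZ * w))"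
            using \<nu> \<nu>w by (intro mult_mono) auto
          also have "\<dots> = c * \<omega> ^ i"
            using w by (simp add: c_def)
          finally show "\<bar>nderiv i \<Phi> x\<bar> * ?\<nu> \<le> c * \<omega> ^ i" .
        qed (use B \<omega> bound \<Phi>x in auto)
      qed
      have "poly_approximable {a..b} (\<lambda>s. \<Phi> ((s - a) / (b - a))) d g (K1 * (J0 * \<omega>) * (K2 * B * \<omega> ^ n / real d ^ n)\<^sup>2)"
      proof (rule region[rule_format, OF g s\<Phi> ab])
        show "0 < K2 * B * \<omega> ^ n" using K2 B \<omega> by simp
      qed (use der_bound hbound d a_def b_def in auto)
      moreover have "K1 * (J0 * \<omega>) * (K2 * B * \<omega> ^ n / real d ^ n)\<^sup>2 \<le> (K * B * sqrt (ln k) * (ln k ^ n / real d ^ n))\<^sup>2"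
      proof -
        have "\<omega> ^ n \<le> ln k ^ n" using lnk by (intro power_mono) (auto simp: \<omega>_def)
        then have "K2 * B * \<omega> ^ n / real d ^ n \<le> K2 * B * ln k ^ n / real d ^ n"
          using K2 B by (intro divide_right_mono mult_left_mono) auto
        then have "(K2 * B * \<omega> ^ n / real d ^ n)\<^sup>2 \<le> (K2 * B * ln k ^ n / real d ^ n)\<^sup>2"
          using K2 B \<omega> by (intro power_mono) auto
        then have "K1 * (J0 * \<omega>) * (K2 * B * \<omega> ^ n / real d ^ n)\<^sup>2 \<le>
            K1 * (J0 * ln k) * (K2 * B * ln k ^ n / real d ^ n)\<^sup>2"
          using K1 J0 \<omega> lnk by (intro mult_mono) (auto simp: \<omega>_def)
        also have "\<dots> = (K * B * sqrt (ln k) * (ln k ^ n / real d ^ n))\<^sup>2"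
          using K1 J0 lnk by (simp add: K_def power_mult_distrib power_divide)
        finally show ?thesis .
      qed
      ultimately show ?thesis
        by (rule poly_approximable_mono)
    qed
    then show "let \<Phi> = layer_map t p q e f (ln k / 3); a = \<Phi> 0; b = \<Phi> 1 in
      (\<forall>s\<in>{a..b}. cZ * \<bar>s - t\<bar> \<le> \<bar>Z s\<bar>) \<longrightarrow>
      (\<forall>m\<le>n. \<forall>s\<in>{a..b}. norm (nderiv m g s) \<le> B * layer_rate Z \<Lambda> k s ^ m) \<longrightarrow>
      poly_approximable {a..b} (\<lambda>s. \<Phi> ((s - a) / (b - a))) d g ((K * B * sqrt (ln k) * (ln k ^ n / real d ^ n))\<^sup>2)"
      unfolding Let_def a_def b_def \<Phi>_def \<omega>_def by blast
  qed
qed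

text \<open>
  The variable is not changed here, so on the unit interval \<open>\<Phi>\<close> is affine with slope \<open>L * k powr (- 1/3)\<close>, which compensates the upper limit
  \<open>\<Lambda> * k powr (1/3)\<close> of the rate. The factor \<open>sqrt (ln k)\<close>, bounded below by \<open>sqrt (ln k\<^sub>0)\<close>, gives
  the estimate the same form as in the layers.
\<close>
lemma transition_approximation:
  fixes L k\<^sub>0 :: real
  assumes L: "L > 0" and k0: "k\<^sub>0 > 1" and \<Lambda>: "\<Lambda> > 0"
  shows "\<exists>K>0. \<forall>k\<ge>k\<^sub>0. \<forall>(g :: real \<Rightarrow> complex) B d a b. smooth_fun g \<longrightarrow> B > 0 \<longrightarrow> d \<ge> 1 \<longrightarrow> d + 1 \<ge> n \<longrightarrow>
     b = a + L * k powr (- 1/3) \<longrightarrow>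
      (\<forall>m\<le>n. \<forall>s\<in>{a..b}. norm (nderiv m g s) \<le> B * layer_rate Z \<Lambda> k s ^ m) \<longrightarrow>
      poly_approximable {a..b} (\<lambda>s. s) d g ((K * B * sqrt (ln k) * (1 / real d ^ n))\<^sup>2)"
proof -
  define c where "c = L * \<Lambda>"
  have c: "c > 0" using L \<Lambda> by (simp add: c_def)
  obtain K1 where K1: "K1 > 0" and region: "\<forall>(g :: real \<Rightarrow> complex) \<Phi> a b J B d. smooth_fun g \<longrightarrow> smooth_fun \<Phi> \<longrightarrow> a < b \<longrightarrow>
     \<Phi> 0 = a \<longrightarrow> \<Phi> 1 = b \<longrightarrow> (\<forall>x\<in>{0..1}. 0 < nderiv 1 \<Phi> x \<and> nderiv 1 \<Phi> x \<le> J) \<longrightarrow>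
     B > 0 \<longrightarrow> d \<ge> 1 \<longrightarrow> d + 1 \<ge> n \<longrightarrow>
     (\<forall>x\<in>{0..1}. norm (nderiv n (\<lambda>x. g (\<Phi> x)) x) \<le> B) \<longrightarrow>
     poly_approximable {a..b} (\<lambda>s. \<Phi> ((s - a) / (b - a))) d g (K1 * J * (B / real d ^ n)\<^sup>2)"
    using region_approximation[of n] by (elim exE conjE) (rule that)
  define K2 where "K2 = compose_const c n"
  have K2: "K2 \<ge> 1" using c compose_const_ge_1 by (simp add: K2_def)
  define K where "K = sqrt (K1 * L / ln k\<^sub>0) * K2"
  have lnk0: "ln k\<^sub>0 > 0" using k0 by simp
  show ?thesis
  proof (intro exI[of _ K] conjI allI impI)
    show "K > 0" using K1 K2 L lnk0 by (simp add: K_def)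
    fix k :: real and g :: "real \<Rightarrow> complex" and B :: real and d :: nat and a b :: real
    assume k: "k \<ge> k\<^sub>0" and g: "smooth_fun g" and B: "B > 0" and d: "d \<ge> 1" "d + 1 \<ge> n"
      and b: "b = a + L * k powr (- 1/3)"
      and bound: "\<forall>m\<le>n. \<forall>s\<in>{a..b}. norm (nderiv m g s) \<le> B * layer_rate Z \<Lambda> k s ^ m"
    have lnk: "ln k \<ge> ln k\<^sub>0" "ln k > 0" using k k0 by auto
    define \<kappa> where "\<kappa> = k powr (- 1/3)"
    have \<kappa>: "\<kappa> > 0" "\<kappa> \<le> 1"
      using k k0 powr_mono[of "- 1/3" 0 k] by (auto simp: \<kappa>_def)
    have ab: "a < b" "b - a = L * \<kappa>" using L \<kappa> by (auto simp: b \<kappa>_def)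
    define \<Phi> where "\<Phi> = (\<lambda>x. a + (b - a) * x)"
    define D where "D = (\<lambda>i x. if i = 0 then \<Phi> x else if i = Suc 0 then b - a else 0)"
    have D: "(D i has_vector_derivative D (Suc i) x) (at x)" for i x
    proof -
      have "(\<Phi> has_real_derivative (b - a)) (at x)"
        unfolding \<Phi>_def by (auto intro!: derivative_eq_intros)
      then have "(\<Phi> has_vector_derivative (b - a)) (at x)"
        by (simp add: has_real_derivative_iff_has_vector_derivative)
      moreover have "D 0 = \<Phi>" by (simp add: D_def)
      ultimately show ?thesis by (cases i) (simp_all add: D_def)
    qed
    have s\<Phi>: "smooth_fun \<Phi>" and n\<Phi>: "nderiv i \<Phi> = D i" for i
      using derivative_sequence_smooth[of D, OF D] derivative_sequence_nderiv[of D i, OF D]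
      by (auto simp: D_def)
    have hbound: "norm (nderiv n (\<lambda>x. g (\<Phi> x)) x) \<le> K2 * B * 1 ^ n" if x: "x \<in> {0..1}" for x
    proof -
      have "(b - a) * x \<le> b - a" "0 \<le> (b - a) * x"
        using x ab(1) by (auto intro: mult_left_le)
      then have \<Phi>x: "\<Phi> x \<in> {a..b}" unfolding \<Phi>_def atLeastAtMost_iff by linarith
      let ?\<nu> = "layer_rate Z \<Lambda> k (\<Phi> x)"
      have \<nu>: "?\<nu> > 0" unfolding layer_rate_def using \<kappa> \<Lambda>
        by (intro divide_pos_pos add_pos_nonneg) (auto simp: \<kappa>_def)
      have \<nu>\<kappa>: "?\<nu> \<le> \<Lambda> / \<kappa>"
        unfolding layer_rate_def \<kappa>_def[symmetric] using \<kappa> \<Lambda>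
        by (intro divide_left_mono mult_pos_pos add_pos_nonneg) auto
      show ?thesis
        unfolding K2_def
      proof (rule nderiv_compose_bound[OF c s\<Phi> \<nu> _ g _ order_refl])
        fix i assume i: "1 \<le> i" "i \<le> n"
        have "\<bar>nderiv i \<Phi> x\<bar> * ?\<nu> \<le> (L * \<kappa>) * (\<Lambda> / \<kappa>)"
          using i L \<kappa> \<nu> \<nu>\<kappa> ab unfolding n\<Phi> by (intro mult_mono) (auto simp: D_def)
        also have "\<dots> = c * 1 ^ i" using \<kappa> by (simp add: c_def)
        finally show "\<bar>nderiv i \<Phi> x\<bar> * ?\<nu> \<le> c * 1 ^ i" .
      qed (use B bound \<Phi>x in auto)
    qed
    have "poly_approximable {a..b} (\<lambda>s. \<Phi> ((s - a) / (b - a))) d g (K1 * L * (K2 * B / real d ^ n)\<^sup>2)"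
    proof (rule region[rule_format, OF g s\<Phi> ab(1)])
      show "0 < K2 * B" using K2 B by simp
      have "L * \<kappa> \<le> L * 1" using L \<kappa> by (intro mult_left_mono) auto
      then show "0 < nderiv 1 \<Phi> x \<and> nderiv 1 \<Phi> x \<le> L" for x
        using L \<kappa> ab by (simp add: n\<Phi> D_def)
    qed (use hbound d in \<open>auto simp: \<Phi>_def\<close>)
    moreover have "(\<lambda>s. \<Phi> ((s - a) / (b - a))) = (\<lambda>s. s)"
      using ab(1) by (auto simp: \<Phi>_def)
    moreover have "K1 * L * (K2 * B / real d ^ n)\<^sup>2 \<le> (K * B * sqrt (ln k) * (1 / real d ^ n))\<^sup>2"
    proof -
      have "K1 * L * (K2 * B / real d ^ n)\<^sup>2 * 1 \<le> K1 * L * (K2 * B / real d ^ n)\<^sup>2 * (ln k / ln k\<^sub>0)"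
        using K1 L lnk lnk0 by (intro mult_left_mono) auto
      also have "\<dots> = (K * B * sqrt (ln k) * (1 / real d ^ n))\<^sup>2"
        using K1 L lnk lnk0 by (simp add: K_def power_mult_distrib power_divide mult_ac)
      finally show ?thesis by simp
    qed
    ultimately show "poly_approximable {a..b} (\<lambda>s. s) d g ((K * B * sqrt (ln k) * (1 / real d ^ n))\<^sup>2)"
      by (simp add: poly_approximable_mono)
  qed
qed


section \<open>Quasi-optimality of the Galerkin method\<close>

lemma norm_square_lincomb_le:
  "(norm (a + z * b))\<^sup>2 \<le> 2 * (norm a)\<^sup>2 + 2 * (norm z)\<^sup>2 * (norm b)\<^sup>2" for a b z :: complex
proof -
  have "(norm (a + z * b))\<^sup>2 \<le> (norm a + norm z * norm b)\<^sup>2"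
    using norm_triangle_ineq[of a "z * b"] by (intro power_mono) (auto simp: norm_mult)
  also have "\<dots> \<le> 2 * (norm a)\<^sup>2 + 2 * (norm z * norm b)\<^sup>2"
    using zero_le_power2[of "norm a - norm z * norm b"] by (simp add: power2_sum power2_diff)
  finally show ?thesis by (simp add: power_mult_distrib)
qed

lemma L2_lincomb:
  assumes f: "f \<in> L2 P" and g: "g \<in> L2 P"
  shows "(\<lambda>x. f x + z * g x) \<in> L2 P"
proof -
  have [measurable]: "f \<in> borel_measurable borel" "g \<in> borel_measurable borel"
    using f g by (auto simp: L2_def)
  have "set_integrable lborel {0..2 * P} (\<lambda>s. 2 * (norm (f s))\<^sup>2 + 2 * (norm z)\<^sup>2 * (norm (g s))\<^sup>2)"
    using f g by (intro set_integral_add set_integrable_mult_right) (auto simp: L2_def)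
  then have "set_integrable lborel {0..2 * P} (\<lambda>s. (norm (f s + z * g s))\<^sup>2)"
  proof (rule set_integrable_bound)
    show "set_borel_measurable lborel {0..2 * P} (\<lambda>s. (norm (f s + z * g s))\<^sup>2)"
      unfolding set_borel_measurable_def by measurable
    show "AE s in lborel. s \<in> {0..2 * P} \<longrightarrow>
      norm ((norm (f s + z * g s))\<^sup>2) \<le> norm (2 * (norm (f s))\<^sup>2 + 2 * (norm z)\<^sup>2 * (norm (g s))\<^sup>2)"
      using norm_square_lincomb_le by (intro AE_I2) (smt (verit) real_norm_def zero_le_power2)
  qed
  then show ?thesis
    using f g by (auto simp: L2_def periodic_fun_def)
qed

lemma L2_diff:
  assumes "f \<in> L2 P" "g \<in> L2 P"
  shows "(\<lambda>x. f x - g x) \<in> L2 P"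
  using L2_lincomb[OF assms, of "- 1"] by simp

lemma L2_inner_measurable:
  assumes f: "f \<in> L2 P" and g: "g \<in> L2 P"
  shows "(\<lambda>s. cnj (f s) * g s) \<in> borel_measurable borel"
proof -
  have "f \<in> borel_measurable borel" "g \<in> borel_measurable borel"
    using f g by (auto simp: L2_def)
  moreover from this have "(\<lambda>s. cnj (f s)) \<in> borel_measurable borel"
    by (intro measurable_compose[OF _ borel_measurable_continuous_onI[of cnj]] continuous_intros)
  ultimately show ?thesis by (intro borel_measurable_times)
qed

lemma L2_inner_integrable:
  assumes f: "f \<in> L2 P" and g: "g \<in> L2 P"
  shows "set_integrable lborel {0..2 * P} (\<lambda>s. cnj (f s) * g s)"
proof -
  note [measurable] = L2_inner_measurable[OF assms]
  have "set_integrable lborel {0..2 * P} (\<lambda>s. (norm (f s))\<^sup>2 + (norm (g s))\<^sup>2)"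
    using f g by (intro set_integral_add) (auto simp: L2_def)
  then show ?thesis
  proof (rule set_integrable_bound)
    show "set_borel_measurable lborel {0..2 * P} (\<lambda>s. cnj (f s) * g s)"
      unfolding set_borel_measurable_def by measurable
    have "norm (cnj a * b) \<le> norm ((norm a)\<^sup>2 + (norm b)\<^sup>2)" for a b :: complex
    proof -
      have "norm a * norm b \<le> (norm a)\<^sup>2 + (norm b)\<^sup>2"
        using zero_le_power2[of "norm a - norm b"] mult_nonneg_nonneg[OF norm_ge_zero[of a] norm_ge_zero[of b]]
        unfolding power2_diff by linarith
      then show ?thesis by (simp add: norm_mult)
    qed
    then show "AE s in lborel. s \<in> {0..2 * P} \<longrightarrow>
        norm (cnj (f s) * g s) \<le> norm ((norm (f s))\<^sup>2 + (norm (g s))\<^sup>2)"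
      by (intro AE_I2) simp
  qed
qed

lemma L2_inner_diff_left:
  assumes "f \<in> L2 P" "g \<in> L2 P" "h \<in> L2 P"
  shows "L2_inner P (\<lambda>x. f x - g x) h = L2_inner P f h - L2_inner P g h"
  unfolding L2_inner_def
  using set_integral_diff(2)[OF L2_inner_integrable[OF assms(1,3)] L2_inner_integrable[OF assms(2,3)]]
  by (simp add: algebra_simps)

lemma L2_inner_diff_right:
  assumes "f \<in> L2 P" "g \<in> L2 P" "h \<in> L2 P"
  shows "L2_inner P h (\<lambda>x. f x - g x) = L2_inner P h f - L2_inner P h g"
  unfolding L2_inner_def
  using set_integral_diff(2)[OF L2_inner_integrable[OF assms(3,1)] L2_inner_integrable[OF assms(3,2)]]
  by (simp add: algebra_simps)

lemma L2_inner_cong_AE: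
  assumes "f \<in> L2 P" "g \<in> L2 P" "h \<in> L2 P" and "AE s in lborel. f s = g s"
  shows "L2_inner P h f = L2_inner P h g"
proof -
  note [measurable] = L2_inner_measurable[OF assms(3,1)] L2_inner_measurable[OF assms(3,2)]
  show ?thesis
    unfolding L2_inner_def set_lebesgue_integral_def
  proof (rule integral_cong_AE)
    show "AE s in lborel. indicator {0..2 * P} s *\<^sub>R (cnj (h s) * f s) =
        indicator {0..2 * P} s *\<^sub>R (cnj (h s) * g s)"
      using assms(4) by eventually_elim simp
  qed measurable
qed

lemma L2_norm_nonneg: "L2_norm P f \<ge> 0"
  unfolding L2_norm_def set_lebesgue_integral_def by (intro real_sqrt_ge_zero integral_nonneg_AE) auto

text \<open>
  Cea's lemma. The residual \<open>R e\<close> of the error \<open>e\<close> is orthogonal to the trial space \<open>V\<close>, so the first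
  argument of \<open>\<langle>e, R e\<rangle>\<close> may be changed by an element of \<open>V\<close> without changing the value; then
  coercivity bounds this value from below and continuity bounds it from above.
\<close>
lemma galerkin_quasi_optimal:
  assumes R: "continuous_coercive P R C c"
    and L2: "\<eta> \<in> L2 P" "\<sigma> \<in> L2 P" "f \<in> L2 P"
    and eq: "AE s in lborel. R \<eta> s = f s"
    and V: "V \<subseteq> L2 P" "\<And>v w. v \<in> V \<Longrightarrow> w \<in> V \<Longrightarrow> (\<lambda>x. v x - w x) \<in> V"
    and sol: "galerkin_solution P V R (\<lambda>s. f s - R \<sigma> s) \<rho>"
    and v: "v \<in> V"
  shows "L2_norm P (\<lambda>s. \<eta> s - (\<sigma> s + \<rho> s)) \<le> C / c * L2_norm P (\<lambda>s. (\<eta> s - \<sigma> s) - v s)"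
proof -
  have Cc: "C > 0" "c > 0" and R_L2: "\<And>\<phi>. \<phi> \<in> L2 P \<Longrightarrow> R \<phi> \<in> L2 P"
    and R_lin: "\<And>\<phi> \<psi> z. \<phi> \<in> L2 P \<Longrightarrow> \<psi> \<in> L2 P \<Longrightarrow> AE s in lborel. R (\<lambda>x. \<phi> x + z * \<psi> x) s = R \<phi> s + z * R \<psi> s"
    and R_cont: "\<And>\<mu> \<phi>. \<mu> \<in> L2 P \<Longrightarrow> \<phi> \<in> L2 P \<Longrightarrow> norm (L2_inner P \<mu> (R \<phi>)) \<le> C * L2_norm P \<mu> * L2_norm P \<phi>"
    and R_coer: "\<And>\<mu>. \<mu> \<in> L2 P \<Longrightarrow> norm (L2_inner P \<mu> (R \<mu>)) \<ge> c * (L2_norm P \<mu>)\<^sup>2"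
    using R unfolding continuous_coercive_def by blast+
  have \<rho>V: "\<rho> \<in> V" and ortho: "\<And>\<mu>. \<mu> \<in> V \<Longrightarrow> L2_inner P \<mu> (R \<rho>) = L2_inner P \<mu> (\<lambda>s. f s - R \<sigma> s)"
    using sol by (auto simp: galerkin_solution_def)
  have \<rho>: "\<rho> \<in> L2 P" and vL: "v \<in> L2 P" using V(1) \<rho>V v by auto
  define d where "d = (\<lambda>s. \<eta> s - \<sigma> s)"
  define e where "e = (\<lambda>s. d s - \<rho> s)"
  have d: "d \<in> L2 P" unfolding d_def by (rule L2_diff[OF L2(1,2)])
  have e: "e \<in> L2 P" unfolding e_def by (rule L2_diff[OF d \<rho>])
  have "AE s in lborel. R (\<lambda>x. \<eta> x + (- 1) * \<sigma> x) s = R \<eta> s + (- 1) * R \<sigma> s"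
    by (rule R_lin[OF L2(1,2)])
  moreover have "AE s in lborel. R (\<lambda>x. d x + (- 1) * \<rho> x) s = R d s + (- 1) * R \<rho> s"
    by (rule R_lin[OF d \<rho>])
  ultimately have Re: "AE s in lborel. R e s = (f s - R \<sigma> s) - R \<rho> s"
    using eq by eventually_elim (simp add: d_def e_def)
  have r: "(\<lambda>s. f s - R \<sigma> s) \<in> L2 P"
    by (rule L2_diff[OF L2(3) R_L2[OF L2(2)]])
  define \<mu> where "\<mu> = (\<lambda>s. v s - \<rho> s)"
  have \<mu>V: "\<mu> \<in> V" unfolding \<mu>_def by (rule V(2)[OF v \<rho>V])
  then have \<mu>: "\<mu> \<in> L2 P" using V(1) by auto
  \<comment> \<open>orthogonality of the residual to \<open>\<mu>\<close>\<close>
  have "L2_inner P \<mu> (R e) = L2_inner P \<mu> (\<lambda>s. (f s - R \<sigma> s) - R \<rho> s)"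
    by (rule L2_inner_cong_AE[OF R_L2[OF e] L2_diff[OF r R_L2[OF \<rho>]] \<mu> Re])
  also have "\<dots> = 0"
    using ortho[OF \<mu>V] L2_inner_diff_right[OF r R_L2[OF \<rho>] \<mu>] by simp
  finally have zero: "L2_inner P \<mu> (R e) = 0" .
  define w where "w = (\<lambda>s. d s - v s)"
  have w: "w \<in> L2 P" unfolding w_def by (rule L2_diff[OF d vL])
  have "w = (\<lambda>s. e s - \<mu> s)" by (simp add: w_def e_def \<mu>_def)
  then have "L2_inner P w (R e) = L2_inner P e (R e)"
    using L2_inner_diff_left[OF e \<mu> R_L2[OF e]] zero by simp
  then have main: "c * (L2_norm P e)\<^sup>2 \<le> C * L2_norm P w * L2_norm P e"
    using R_coer[OF e] R_cont[OF w e] by simp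
  have "L2_norm P e \<le> C / c * L2_norm P w"
  proof (cases "L2_norm P e = 0")
    case True
    then show ?thesis using Cc L2_norm_nonneg by simp
  next
    case False
    then have "L2_norm P e > 0" using L2_norm_nonneg[of P e] by simp
    moreover have "(c * L2_norm P e) * L2_norm P e \<le> (C * L2_norm P w) * L2_norm P e"
      using main by (simp add: power2_eq_square mult_ac)
    ultimately have "c * L2_norm P e \<le> C * L2_norm P w" by simp
    then show ?thesis using Cc by (simp add: field_simps)
  qed
  then show ?thesis by (simp add: e_def d_def w_def diff_diff_eq)
qed


section \<open>Periodic functions assembled from six pieces\<close>

text \<open>
  The regions cover one period \<open>[L, L + T]\<close>, whereas norms are taken over \<open>[0, T]\<close>. Three neighbouring
  translates of the former cover the latter.
\<close>
lemma nn_integral_period_le: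
  fixes F :: "real \<Rightarrow> ennreal"
  assumes [measurable]: "F \<in> borel_measurable borel" and per: "\<And>s. F (s + T) = F s"
    and L: "- T \<le> L" "L \<le> T" and T: "T > 0"
  shows "(\<integral>\<^sup>+s. indicator {0..T} s * F s \<partial>lborel) \<le> 3 * (\<integral>\<^sup>+s. indicator {L..L + T} s * F s \<partial>lborel)"
proof -
  let ?G = "\<lambda>s. indicator {L..L + T} s * F s"
  have per': "F (s - T) = F s" for s
    using per[of "s - T"] by simp
  have shift: "(\<integral>\<^sup>+s. ?G (c + s) \<partial>lborel) = (\<integral>\<^sup>+s. ?G s \<partial>lborel)" for c
    using nn_integral_real_affine[of ?G 1 c] by simp
  have "(\<integral>\<^sup>+s. indicator {0..T} s * F s \<partial>lborel) \<le> (\<integral>\<^sup>+s. (?G (- T + s) + ?G (0 + s)) + ?G (T + s) \<partial>lborel)"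
  proof (rule nn_integral_mono)
    fix s
    have eqs: "F (- T + s) = F s" "F (T + s) = F s"
      using per'[of s] per[of s] by (simp_all add: add.commute)
    show "indicator {0..T} s * F s \<le> (?G (- T + s) + ?G (0 + s)) + ?G (T + s)"
    proof (cases "s \<in> {0..T}")
      case True
      then have "- T + s \<in> {L..L + T} \<or> s \<in> {L..L + T} \<or> T + s \<in> {L..L + T}"
        using L T by auto
      then show ?thesis
        unfolding eqs by (auto simp: indicator_def add_increasing add_increasing2)
    qed simp
  qed
  also have "\<dots> = ((\<integral>\<^sup>+s. ?G (- T + s) \<partial>lborel) + (\<integral>\<^sup>+s. ?G (0 + s) \<partial>lborel)) + (\<integral>\<^sup>+s. ?G (T + s) \<partial>lborel)"
    by (simp add: nn_integral_add)
  also have "\<dots> = 3 * (\<integral>\<^sup>+s. ?G s \<partial>lborel)"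
  proof -
    have "(3 :: ennreal) = 1 + 1 + 1" by simp
    then show ?thesis unfolding shift by (simp only: distrib_right mult_1_left)
  qed
  finally show ?thesis .
qed

lemma nn_integral_interval:
  fixes F :: "real \<Rightarrow> real"
  assumes "continuous_on {a..b} F" "\<And>x. F x \<ge> 0"
  shows "(\<integral>\<^sup>+s. indicator {a..b} s * ennreal (F s) \<partial>lborel) = ennreal (integral {a..b} F)"
proof -
  have int: "set_integrable lborel {a..b} F"
    unfolding set_integrable_def
    by (rule borel_integrable_compact) (use assms(1) in auto)
  have "(\<integral>\<^sup>+s. indicator {a..b} s * ennreal (F s) \<partial>lborel) = (\<integral>\<^sup>+s. ennreal (indicator {a..b} s *\<^sub>R F s) \<partial>lborel)"
    by (intro nn_integral_cong) (simp add: indicator_def)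
  also have "\<dots> = ennreal (LINT s|lborel. indicator {a..b} s *\<^sub>R F s)"
    using int assms(2) unfolding set_integrable_def by (intro nn_integral_eq_integral) auto
  also have "(LINT s|lborel. indicator {a..b} s *\<^sub>R F s) = integral {a..b} F"
    using set_borel_integral_eq_integral(2)[OF int] by (simp add: set_lebesgue_integral_def)
  finally show ?thesis .
qed

lemma continuous_periodic_L2:
  assumes "continuous_on UNIV f" "periodic_fun (2 * P) f"
  shows "f \<in> L2 P"
proof -
  have "set_integrable lborel {0..2 * P} (\<lambda>s. (norm (f s))\<^sup>2)"
    unfolding set_integrable_def
    by (rule borel_integrable_compact) (auto intro!: continuous_intros continuous_on_subset[OF assms(1)])
  moreover have "f \<in> borel_measurable borel"
    by (rule borel_measurable_continuous_onI[OF assms(1)])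
  ultimately show ?thesis
    using assms(2) by (simp add: L2_def)
qed

lemma six_regions_partition:
  fixes l r :: "nat \<Rightarrow> real"
  assumes chain: "r 3 = l 5" "r 5 = l 1" "r 1 = l 2" "r 2 = l 6" "r 6 = l 4"
    and less: "\<And>j. j \<in> {1..6} \<Longrightarrow> l j < r j"
    and s: "s \<in> {l 3..r 4}" "\<And>j. j \<in> {1..6} \<Longrightarrow> s \<noteq> l j \<and> s \<noteq> r j"
  shows "\<exists>j\<in>{1..6}. s \<in> {l j..r j} \<and> (\<forall>i\<in>{1..6}. i \<noteq> j \<longrightarrow> s \<notin> {l i..r i})"
proof -
  have six: "{1..6} = {1, 2, 3, 4, 5, 6 :: nat}" by auto
  have l: "l 1 < r 1" "l 2 < r 2" "l 3 < r 3" "l 4 < r 4" "l 5 < r 5" "l 6 < r 6"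
    using less by auto
  have ne: "s \<noteq> l 3" "s \<noteq> l 5" "s \<noteq> l 1" "s \<noteq> l 2" "s \<noteq> l 6" "s \<noteq> l 4" "s \<noteq> r 4"
    using s(2) by auto
  consider "s < l 5" | "l 5 < s" "s < l 1" | "l 1 < s" "s < l 2" | "l 2 < s" "s < l 6"
    | "l 6 < s" "s < l 4" | "l 4 < s"
    using ne by argo
  then show ?thesis
  proof cases
    case 1
    then show ?thesis using l s(1) ne chain unfolding six by (intro bexI[of _ 3]) auto
  next
    case 2
    then show ?thesis using l s(1) ne chain unfolding six by (intro bexI[of _ 5]) auto
  next
    case 3
    then show ?thesis using l s(1) ne chain unfolding six by (intro bexI[of _ 1]) auto
  next
    case 4
    then show ?thesis using l s(1) ne chain unfolding six by (intro bexI[of _ 2]) auto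
  next
    case 5
    then show ?thesis using l s(1) ne chain unfolding six by (intro bexI[of _ 6]) auto
  next
    case 6
    then show ?thesis using l s(1) ne chain unfolding six by (intro bexI[of _ 4]) auto
  qed
qed

text \<open>
  The trial function is the periodic extension of the piecewise function from \<open>[L, L + 2P)\<close>. Off the
  end points exactly one indicator is one, so the squared error there is that of a single region. The
  modulus of the oscillating factor is one, so it drops out. Square integrability of \<open>v\<close> follows from
  that of the target and of the difference.
\<close>
lemma piecewise_approximation:
  fixes L P :: real and l r :: "nat \<Rightarrow> real" and q :: "nat \<Rightarrow> real \<Rightarrow> complex"
    and \<theta> :: "real \<Rightarrow> real" and g :: "real \<Rightarrow> complex"
  assumes P: "P > 0" and L: "- (2 * P) \<le> L" "L \<le> 2 * P" and ends: "l 3 = L" "r 4 = L + 2 * P"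
    and chain: "r 3 = l 5" "r 5 = l 1" "r 1 = l 2" "r 2 = l 6" "r 6 = l 4"
    and less: "\<And>j. j \<in> {1..6} \<Longrightarrow> l j < r j"
    and g: "continuous_on UNIV g" "periodic_fun (2 * P) g"
    and \<theta>: "continuous_on UNIV \<theta>" "periodic_fun (2 * P) \<theta>"
    and q: "\<And>j. j \<in> {1..6} \<Longrightarrow> continuous_on {l j..r j} (q j)"
    and X: "\<And>j. j \<in> {1..6} \<Longrightarrow> integral {l j..r j} (\<lambda>s. (norm (g s - q j s))\<^sup>2) \<le> (X j)\<^sup>2"
      "\<And>j. j \<in> {1..6} \<Longrightarrow> X j \<ge> 0"
  shows "\<exists>v\<in>L2 P. (AE s in lborel. s \<in> {L..L + 2 * P} \<longrightarrow>
        v s = exp (\<i> * complex_of_real (\<theta> s)) * (\<Sum>j\<in>{1..6}. indicator {l j..r j} s * q j s)) \<and>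
      L2_norm P (\<lambda>s. exp (\<i> * complex_of_real (\<theta> s)) * g s - v s) \<le> 2 * (\<Sum>j\<in>{1..6}. X j)"
proof -
  let ?I = "{1..6} :: nat set" and ?T = "2 * P"
  let ?e = "\<lambda>s. exp (\<i> * complex_of_real (\<theta> s))"
  have T: "?T > 0" using P by simp
  define w where "w = (\<lambda>s. ?e s * (\<Sum>j\<in>?I. indicator {l j..r j} s * q j s))"
  \<comment> \<open>reduction modulo the period to \<open>[L, L + 2P)\<close>\<close>
  define red where "red = (\<lambda>s. s - ?T * of_int \<lfloor>(s - L) / ?T\<rfloor>)"
  define v where "v = (\<lambda>s. w (red s))"
  have red_per: "red (s + ?T) = red s" for s
  proof -
    have "(s + ?T - L) / ?T = (s - L) / ?T + 1" using T by (simp add: field_simps)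
    then show ?thesis by (simp add: red_def algebra_simps)
  qed
  have red_id: "red s = s" if "s \<in> {L..<L + ?T}" for s
  proof -
    have "\<lfloor>(s - L) / ?T\<rfloor> = 0" using that T by (intro floor_unique) (auto simp: field_simps)
    then show ?thesis by (simp add: red_def)
  qed
  have [measurable]: "(\<lambda>s. indicator {l j..r j} s * q j s) \<in> borel_measurable borel" if "j \<in> ?I" for j
  proof -
    have "(\<lambda>s. indicator {l j..r j} s *\<^sub>R q j s) \<in> borel_measurable borel"
      by (rule borel_measurable_continuous_on_indicator[OF _ q[OF that]]) auto
    also have "(\<lambda>s. indicator {l j..r j} s *\<^sub>R q j s) = (\<lambda>s. indicator {l j..r j} s * q j s)"
      by (auto simp: indicator_def)
    finally show ?thesis .
  qed
  have cont_e: "continuous_on UNIV ?e" by (intro continuous_intros \<theta>)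
  have [measurable]: "?e \<in> borel_measurable borel"
    by (rule borel_measurable_continuous_onI[OF cont_e])
  have [measurable]: "w \<in> borel_measurable borel"
    unfolding w_def by measurable
  have [measurable]: "red \<in> borel_measurable borel"
    unfolding red_def by measurable
  have v_meas[measurable]: "v \<in> borel_measurable borel"
    unfolding v_def by measurable
  have v_per: "periodic_fun ?T v"
    by (simp add: periodic_fun_def v_def red_per)
  define f where "f = (\<lambda>s. ?e s * g s)"
  have f: "f \<in> L2 P"
    unfolding f_def
  proof (rule continuous_periodic_L2)
    show "continuous_on UNIV (\<lambda>s. ?e s * g s)" by (intro continuous_intros cont_e g)
    show "periodic_fun ?T (\<lambda>s. ?e s * g s)" using \<theta>(2) g(2) by (simp add: periodic_fun_def)
  qed
  have [measurable]: "f \<in> borel_measurable borel" using f by (simp add: L2_def)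
  define D where "D = (\<lambda>s. (norm (f s - v s))\<^sup>2)"
  have [measurable]: "D \<in> borel_measurable borel" unfolding D_def by measurable
  have D_per: "D (s + ?T) = D s" for s
    using v_per f by (simp add: D_def periodic_fun_def L2_def)
  let ?F = "\<lambda>j s. (norm (g s - q j s))\<^sup>2"
  let ?N = "insert (L + ?T) (l ` ?I \<union> r ` ?I)"
  have null: "AE s in lborel. s \<notin> ?N"
    by (rule AE_not_in) (auto intro!: finite_imp_null_set_lborel)
  have v_eq: "AE s in lborel. s \<in> {L..L + ?T} \<longrightarrow> v s = w s"
    using null by eventually_elim (auto simp: v_def red_id)
  have "(\<integral>\<^sup>+s. indicator {L..L + ?T} s * ennreal (D s) \<partial>lborel) \<le>
      (\<integral>\<^sup>+s. (\<Sum>j\<in>?I. indicator {l j..r j} s * ennreal (?F j s)) \<partial>lborel)"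
  proof (rule nn_integral_mono_AE, use null v_eq in eventually_elim)
    fix s assume s: "s \<notin> ?N" and vw: "s \<in> {L..L + ?T} \<longrightarrow> v s = w s"
    show "indicator {L..L + ?T} s * ennreal (D s) \<le> (\<Sum>j\<in>?I. indicator {l j..r j} s * ennreal (?F j s))"
    proof (cases "s \<in> {L..L + ?T}")
      case True
      have "s \<in> {l 3..r 4}" "\<And>j. j \<in> ?I \<Longrightarrow> s \<noteq> l j \<and> s \<noteq> r j"
        using True ends s by auto
      from six_regions_partition[OF chain less this]
      obtain j where j: "j \<in> ?I" "s \<in> {l j..r j}" "\<And>i. i \<in> ?I \<Longrightarrow> i \<noteq> j \<Longrightarrow> s \<notin> {l i..r i}"
        by blast
      have "(\<Sum>i\<in>?I. indicator {l i..r i} s * q i s) = (\<Sum>i\<in>?I. if i = j then q j s else 0)"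
        by (rule sum.cong) (use j in auto)
      then have "v s = ?e s * q j s"
        using vw True j(1) by (simp add: w_def)
      then have "f s - v s = ?e s * (g s - q j s)"
        by (simp add: f_def algebra_simps)
      then have "indicator {L..L + ?T} s * ennreal (D s) = ennreal (?F j s)"
        using True by (simp add: D_def norm_mult)
      also have "\<dots> = indicator {l j..r j} s * ennreal (?F j s)" using j(2) by simp
      also have "\<dots> \<le> (\<Sum>j\<in>?I. indicator {l j..r j} s * ennreal (?F j s))"
        by (rule member_le_sum[OF j(1)]) auto
      finally show ?thesis .
    qed simp
  qed
  also have "\<dots> = (\<Sum>j\<in>?I. \<integral>\<^sup>+s. indicator {l j..r j} s * ennreal (?F j s) \<partial>lborel)"
  proof (rule nn_integral_sum)
    fix j assume j: "j \<in> ?I"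
    have "continuous_on {l j..r j} (?F j)"
      by (intro continuous_intros continuous_on_subset[OF g(1)] q[OF j]) auto
    then have "(\<lambda>s. indicator {l j..r j} s *\<^sub>R ?F j s) \<in> borel_measurable borel"
      by (rule borel_measurable_continuous_on_indicator[rotated]) auto
    then have "(\<lambda>s. ennreal (indicator {l j..r j} s *\<^sub>R ?F j s)) \<in> borel_measurable borel"
      by measurable
    also have "(\<lambda>s. ennreal (indicator {l j..r j} s *\<^sub>R ?F j s)) = (\<lambda>s. indicator {l j..r j} s * ennreal (?F j s))"
      by (auto simp: indicator_def)
    finally show "(\<lambda>s. indicator {l j..r j} s * ennreal (?F j s)) \<in> borel_measurable lborel" by simp
  qed
  also have "\<dots> \<le> (\<Sum>j\<in>?I. ennreal ((X j)\<^sup>2))"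
  proof (rule sum_mono)
    fix j assume j: "j \<in> ?I"
    have "continuous_on {l j..r j} (?F j)"
      by (intro continuous_intros continuous_on_subset[OF g(1)] q[OF j]) auto
    from nn_integral_interval[OF this]
    show "(\<integral>\<^sup>+s. indicator {l j..r j} s * ennreal (?F j s) \<partial>lborel) \<le> ennreal ((X j)\<^sup>2)"
      using X(1)[OF j] by (simp add: ennreal_leI)
  qed
  also have "\<dots> = ennreal (\<Sum>j\<in>?I. (X j)\<^sup>2)"
    by (rule sum_ennreal) simp
  also have "\<dots> \<le> ennreal ((\<Sum>j\<in>?I. X j)\<^sup>2)"
  proof (rule ennreal_leI)
    have "(\<Sum>j\<in>?I. (X j)\<^sup>2) = (\<Sum>j\<in>?I. X j * X j)" by (simp add: power2_eq_square)
    also have "\<dots> \<le> (\<Sum>j\<in>?I. X j * (\<Sum>j\<in>?I. X j))"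
      using X(2) by (intro sum_mono mult_left_mono member_le_sum) auto
    also have "\<dots> = (\<Sum>j\<in>?I. X j)\<^sup>2"
      by (simp only: sum_distrib_right power2_eq_square)
    finally show "(\<Sum>j\<in>?I. (X j)\<^sup>2) \<le> (\<Sum>j\<in>?I. X j)\<^sup>2" .
  qed
  finally have one: "(\<integral>\<^sup>+s. indicator {L..L + ?T} s * ennreal (D s) \<partial>lborel) \<le> ennreal ((\<Sum>j\<in>?I. X j)\<^sup>2)" .
  have "(\<integral>\<^sup>+s. indicator {0..?T} s * ennreal (D s) \<partial>lborel) \<le> 3 * (\<integral>\<^sup>+s. indicator {L..L + ?T} s * ennreal (D s) \<partial>lborel)"
    by (rule nn_integral_period_le) (use D_per L T in auto)
  also have "\<dots> \<le> 3 * ennreal ((\<Sum>j\<in>?I. X j)\<^sup>2)"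
    by (intro mult_left_mono one) simp
  also have "\<dots> = ennreal (3 * (\<Sum>j\<in>?I. X j)\<^sup>2)"
    by (simp add: ennreal_mult')
  also have "(\<lambda>s. indicator {0..?T} s * ennreal (D s)) = (\<lambda>s. ennreal (indicator {0..?T} s *\<^sub>R D s))"
    by (auto simp: indicator_def)
  finally have bound: "(\<integral>\<^sup>+s. ennreal (indicator {0..?T} s *\<^sub>R D s) \<partial>lborel) \<le> ennreal (3 * (\<Sum>j\<in>?I. X j)\<^sup>2)" .
  have D_nonneg: "D s \<ge> 0" for s by (simp add: D_def)
  have "set_integrable lborel {0..?T} D"
    unfolding set_integrable_def
  proof (rule integrableI_nonneg)
    show "(\<integral>\<^sup>+s. ennreal (indicator {0..?T} s *\<^sub>R D s) \<partial>lborel) < \<infinity>"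
      using bound by (rule order_le_less_trans) simp
  qed (use D_nonneg in auto)
  then have "(\<lambda>s. f s - v s) \<in> L2 P"
    using v_per f by (simp add: L2_def D_def periodic_fun_def)
  from L2_diff[OF f this] have v: "v \<in> L2 P" by simp
  have "(LINT s|lborel. indicator {0..?T} s *\<^sub>R D s) \<le> 3 * (\<Sum>j\<in>?I. X j)\<^sup>2"
    by (rule integral_real_bounded[OF _ bound]) simp
  then have "L2_norm P (\<lambda>s. f s - v s) \<le> sqrt (3 * (\<Sum>j\<in>?I. X j)\<^sup>2)"
    by (simp add: L2_norm_def set_lebesgue_integral_def D_def)
  also have "\<dots> \<le> sqrt ((2 * (\<Sum>j\<in>?I. X j))\<^sup>2)"
    by (intro real_sqrt_le_mono) (simp add: power_mult_distrib)
  also have "\<dots> = 2 * (\<Sum>j\<in>?I. X j)"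
    unfolding real_sqrt_abs using sum_nonneg[of ?I X] X(2) by simp
  finally have "L2_norm P (\<lambda>s. f s - v s) \<le> 2 * (\<Sum>j\<in>?I. X j)" .
  then show ?thesis
    using v v_eq unfolding f_def w_def by (intro bexI[of _ v]) auto
qed


section \<open>The six regions of the boundary\<close>

lemma layer_map_right:
  assumes "k > 0"
  shows "layer_map t \<xi> (\<xi>' - \<xi>) 1 (- 1) (ln k / 3) x = t + (\<xi> + (\<xi>' - \<xi>) * x) * k powr (- (1/3) * (1 - x))"
proof -
  have "ln k / 3 * (1 * x + - 1) = - (1/3) * (1 - x) * ln k" by (simp add: field_simps)
  then show ?thesis using assms unfolding layer_map_def powr_def by simp
qed

lemma layer_map_left:
  assumes "k > 0"
  shows "layer_map t \<xi>' (\<xi> - \<xi>') (- 1) 0 (ln k / 3) x = t - (\<xi>' + (\<xi> - \<xi>') * x) * k powr (- (1/3) * x)"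
proof -
  have "ln k / 3 * (- 1 * x + 0) = - (1/3) * x * ln k" by (simp add: field_simps)
  then show ?thesis using assms unfolding layer_map_def powr_def by simp
qed

text \<open>Along the boundary the regions follow each other in the order 3, 5, 1, 2, 6, 4.\<close>
lemma region_chain:
  assumes "region_parameters P t \<xi> \<xi>' \<zeta> \<zeta>'" "k > 1"
  defines "l \<equiv> left_end t \<xi> \<xi>' \<zeta> \<zeta>' k" and "r \<equiv> right_end t \<xi> \<xi>' \<zeta> \<zeta>' k"
  shows "r 3 = l 5" "r 5 = l 1" "r 1 = l 2" "r 2 = l 6" "r 6 = l 4"
    and "l 3 = t 1 - \<zeta>' 1" "r 4 = t 2 + \<zeta>' 2"
    and "j \<in> {1..6} \<Longrightarrow> l j < r j"
proof -
  have pos: "\<xi> 1 > 0" "\<xi> 2 > 0" "\<zeta> 1 > 0" "\<zeta> 2 > 0"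
    "\<xi> 1 \<le> \<xi>' 1" "\<xi> 2 \<le> \<xi>' 2" "\<zeta> 1 \<le> \<zeta>' 1" "\<zeta> 2 \<le> \<zeta>' 2" "t 1 + \<xi>' 1 = t 2 - \<xi>' 2"
    using assms(1) by (auto simp: region_parameters_def)
  have \<kappa>: "0 < k powr (- 1/3)" "k powr (- 1/3) < 1"
    using assms(2) powr_less_mono[of "- 1/3" 0 k] by auto
  show "r 3 = l 5" "r 5 = l 1" "r 1 = l 2" "r 2 = l 6" "r 6 = l 4"
    "l 3 = t 1 - \<zeta>' 1" "r 4 = t 2 + \<zeta>' 2"
    using pos by (simp_all add: l_def r_def left_end_def right_end_def)
  have less: "x * k powr (- 1/3) < x'" if "0 < x" "x \<le> x'" for x x'
    using mult_strict_left_mono[OF \<kappa>(2) that(1)] that(2) by simp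
  have gt: "- (x * k powr (- 1/3)) < x' * k powr (- 1/3)" if "0 < x" "0 < x'" for x x'
    using mult_pos_pos[OF that(1) \<kappa>(1)] mult_pos_pos[OF that(2) \<kappa>(1)] by linarith
  assume "j \<in> {1..6}"
  then have "j = 1 \<or> j = 2 \<or> j = 3 \<or> j = 4 \<or> j = 5 \<or> j = 6" by auto
  then show "l j < r j"
    using less[of "\<xi> 1" "\<xi>' 1"] less[of "\<xi> 2" "\<xi>' 2"] less[of "\<zeta> 1" "\<zeta>' 1"] less[of "\<zeta> 2" "\<zeta>' 2"]
      gt[of "\<zeta> 1" "\<xi> 1"] gt[of "\<xi> 2" "\<zeta> 2"] pos
    by (elim disjE) (simp_all add: l_def r_def left_end_def right_end_def)
qed

text \<open>
  Regions 1 and 4 lie to the right, regions 2 and 3 to the left of a shadow boundary point; their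
  changes of variables are instances of \<open>layer_map\<close>. Regions 5 and 6 are the transition intervals.
\<close>
lemma galerkin_region_approximation:
  fixes n :: nat
  assumes regions: "region_parameters P t \<xi> \<xi>' \<zeta> \<zeta>'" and k0: "k\<^sub>0 > 1" and \<Lambda>: "\<Lambda> > 0" and c: "c > 0"
    and Z1: "\<And>s. s \<in> {t 1 - \<zeta>' 1..t 1 + \<xi>' 1} \<Longrightarrow> c * \<bar>s - t 1\<bar> \<le> \<bar>Z s\<bar>"
    and Z2: "\<And>s. s \<in> {t 2 - \<xi>' 2..t 2 + \<zeta>' 2} \<Longrightarrow> c * \<bar>s - t 2\<bar> \<le> \<bar>Z s\<bar>"
    and j: "j \<in> {1..6}"
  shows "\<exists>K>0. \<forall>k\<ge>k\<^sub>0. \<forall>(g :: real \<Rightarrow> complex) B d. smooth_fun g \<longrightarrow> B > 0 \<longrightarrow> d \<ge> 1 \<longrightarrow> d + 1 \<ge> n \<longrightarrow>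
     (\<forall>m\<le>n. \<forall>s\<in>region t \<xi> \<xi>' \<zeta> \<zeta>' k j. norm (nderiv m g s) \<le> B * layer_rate Z \<Lambda> k s ^ m) \<longrightarrow>
     poly_approximable (region t \<xi> \<xi>' \<zeta> \<zeta>' k j) (change_of_var t \<xi> \<xi>' \<zeta> \<zeta>' k j) d g
       ((K * B * sqrt (ln k) * ((if j \<le> 4 then ln k ^ n else 1) / real d ^ n))\<^sup>2)"
proof -
  have pos: "\<xi> 1 > 0" "\<xi> 2 > 0" "\<zeta> 1 > 0" "\<zeta> 2 > 0"
    "\<xi> 1 \<le> \<xi>' 1" "\<xi> 2 \<le> \<xi>' 2" "\<zeta> 1 \<le> \<zeta>' 1" "\<zeta> 2 \<le> \<zeta>' 2" "t 1 + \<xi>' 1 = t 2 - \<xi>' 2"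
    using regions by (auto simp: region_parameters_def)
  let ?l = "\<lambda>k. left_end t \<xi> \<xi>' \<zeta> \<zeta>' k j" and ?r = "\<lambda>k. right_end t \<xi> \<xi>' \<zeta> \<zeta>' k j"
  have reg: "region t \<xi> \<xi>' \<zeta> \<zeta>' k j = {?l k..?r k}" for k
    by (simp add: region_def)
  have k1: "k > 1" if "k \<ge> k\<^sub>0" for k using that k0 by simp
  have lr: "?l k < ?r k" if "k \<ge> k\<^sub>0" for k
    using region_chain(8)[OF regions k1[OF that] j] .
  have flip: "(b - s) / (b - a) = 1 - (s - a) / (b - a)" if "a < b" for a b s :: real
    using that by (simp add: field_simps)
  have layer: ?thesis
    if j4: "j \<le> 4" and x: "0 < x" "x \<le> x'"
      and e: "e = 1 \<and> p = x \<and> q = x' - x \<and> f = - 1 \<or> e = - 1 \<and> p = x' \<and> q = x - x' \<and> f = 0"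
      and ends: "\<And>k. k \<ge> k\<^sub>0 \<Longrightarrow> layer_map T p q e f (ln k / 3) 0 = ?l k \<and> layer_map T p q e f (ln k / 3) 1 = ?r k"
      and cov: "\<And>k s. k \<ge> k\<^sub>0 \<Longrightarrow> change_of_var t \<xi> \<xi>' \<zeta> \<zeta>' k j s =
        layer_map T p q e f (ln k / 3) ((s - ?l k) / (?r k - ?l k))"
      and Z: "\<And>k s. k \<ge> k\<^sub>0 \<Longrightarrow> s \<in> {?l k..?r k} \<Longrightarrow> c * \<bar>s - T\<bar> \<le> \<bar>Z s\<bar>"
    for x x' e p q f T
  proof -
    obtain K where K: "K > 0" and approx: "\<forall>k\<ge>k\<^sub>0. \<forall>(g :: real \<Rightarrow> complex) B d. smooth_fun g \<longrightarrow> B > 0 \<longrightarrow> d \<ge> 1 \<longrightarrow> d + 1 \<ge> n \<longrightarrow>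
     (let \<Phi> = layer_map T p q e f (ln k / 3); a = \<Phi> 0; b = \<Phi> 1 in
      (\<forall>s\<in>{a..b}. c * \<bar>s - T\<bar> \<le> \<bar>Z s\<bar>) \<longrightarrow>
      (\<forall>m\<le>n. \<forall>s\<in>{a..b}. norm (nderiv m g s) \<le> B * layer_rate Z \<Lambda> k s ^ m) \<longrightarrow>
      poly_approximable {a..b} (\<lambda>s. \<Phi> ((s - a) / (b - a))) d g ((K * B * sqrt (ln k) * (ln k ^ n / real d ^ n))\<^sup>2))"
      using layer_approximation[OF x k0 c \<Lambda> e, of n T Z] by (elim exE conjE) (rule that)
    show ?thesis
    proof (intro exI[of _ K] conjI allI impI)
      show "K > 0" by (rule K)
      fix k :: real and g :: "real \<Rightarrow> complex" and B :: real and d :: nat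
      assume k: "k \<ge> k\<^sub>0" and hyp: "smooth_fun g" "B > 0" "d \<ge> 1" "d + 1 \<ge> n"
        and bound: "\<forall>m\<le>n. \<forall>s\<in>region t \<xi> \<xi>' \<zeta> \<zeta>' k j. norm (nderiv m g s) \<le> B * layer_rate Z \<Lambda> k s ^ m"
      have cov': "change_of_var t \<xi> \<xi>' \<zeta> \<zeta>' k j = (\<lambda>s. layer_map T p q e f (ln k / 3) ((s - ?l k) / (?r k - ?l k)))"
        using cov[OF k] by auto
      show "poly_approximable (region t \<xi> \<xi>' \<zeta> \<zeta>' k j) (change_of_var t \<xi> \<xi>' \<zeta> \<zeta>' k j) d g
          ((K * B * sqrt (ln k) * ((if j \<le> 4 then ln k ^ n else 1) / real d ^ n))\<^sup>2)"
        using approx[rule_format, OF k hyp] bound Z[OF k] j4 ends[OF k]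
        unfolding Let_def reg cov' by simp
    qed
  qed
  have transition: ?thesis
    if j5: "j > 4" and L: "L > 0" and ends: "\<And>k. k \<ge> k\<^sub>0 \<Longrightarrow> ?r k = ?l k + L * k powr (- 1/3)" for L
  proof -
    obtain K where K: "K > 0" and approx: "\<forall>k\<ge>k\<^sub>0. \<forall>(g :: real \<Rightarrow> complex) B d a b. smooth_fun g \<longrightarrow> B > 0 \<longrightarrow> d \<ge> 1 \<longrightarrow> d + 1 \<ge> n \<longrightarrow>
     b = a + L * k powr (- 1/3) \<longrightarrow>
      (\<forall>m\<le>n. \<forall>s\<in>{a..b}. norm (nderiv m g s) \<le> B * layer_rate Z \<Lambda> k s ^ m) \<longrightarrow>
      poly_approximable {a..b} (\<lambda>s. s) d g ((K * B * sqrt (ln k) * (1 / real d ^ n))\<^sup>2)"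
      using transition_approximation[OF L k0 \<Lambda>, of n Z] by (elim exE conjE) (rule that)
    show ?thesis
    proof (intro exI[of _ K] conjI allI impI)
      show "K > 0" by (rule K)
      fix k :: real and g :: "real \<Rightarrow> complex" and B :: real and d :: nat
      assume k: "k \<ge> k\<^sub>0" and hyp: "smooth_fun g" "B > 0" "d \<ge> 1" "d + 1 \<ge> n"
        and bound: "\<forall>m\<le>n. \<forall>s\<in>region t \<xi> \<xi>' \<zeta> \<zeta>' k j. norm (nderiv m g s) \<le> B * layer_rate Z \<Lambda> k s ^ m"
      have cov: "change_of_var t \<xi> \<xi>' \<zeta> \<zeta>' k j = (\<lambda>s. s)"
        using j5 by (auto simp: change_of_var_def Let_def)
      show "poly_approximable (region t \<xi> \<xi>' \<zeta> \<zeta>' k j) (change_of_var t \<xi> \<xi>' \<zeta> \<zeta>' k j) d g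
          ((K * B * sqrt (ln k) * ((if j \<le> 4 then ln k ^ n else 1) / real d ^ n))\<^sup>2)"
        using approx[rule_format, OF k hyp ends[OF k]] bound j5
        unfolding reg cov by simp
    qed
  qed
  have half: "t 1 - \<zeta>' 1 \<le> t 1" "t 1 \<le> t 1 + \<xi>' 1" "t 2 - \<xi>' 2 \<le> t 2" "t 2 \<le> t 2 + \<zeta>' 2"
    using pos by auto
  have \<kappa>: "0 < k powr (- 1/3)" if "k \<ge> k\<^sub>0" for k using k1[OF that] by simp
  have off: "0 \<le> y * k powr (- 1/3)" if "0 < y" "k \<ge> k\<^sub>0" for y k
    using that \<kappa>[OF that(2)] by simp
  have "j = 1 \<or> j = 2 \<or> j = 3 \<or> j = 4 \<or> j = 5 \<or> j = 6" using j by auto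
  then show ?thesis
  proof (elim disjE)
    assume j: "j = 1"
    show ?thesis
    proof (rule layer[where e = 1 and p = "\<xi> 1" and q = "\<xi>' 1 - \<xi> 1" and f = "- 1" and T = "t 1", OF _ pos(1,5)])
      fix k assume k: "k \<ge> k\<^sub>0"
      then have k': "k > 0" using k1 by force
      show "layer_map (t 1) (\<xi> 1) (\<xi>' 1 - \<xi> 1) 1 (- 1) (ln k / 3) 0 = ?l k \<and>
          layer_map (t 1) (\<xi> 1) (\<xi>' 1 - \<xi> 1) 1 (- 1) (ln k / 3) 1 = ?r k"
        using k' by (simp add: layer_map_right[OF k'] j left_end_def right_end_def)
      fix s
      show "change_of_var t \<xi> \<xi>' \<zeta> \<zeta>' k j s =
        layer_map (t 1) (\<xi> 1) (\<xi>' 1 - \<xi> 1) 1 (- 1) (ln k / 3) ((s - ?l k) / (?r k - ?l k))"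
        using flip[OF lr[OF k]] unfolding layer_map_right[OF k'] change_of_var_def Let_def j by simp
      show "c * \<bar>s - t 1\<bar> \<le> \<bar>Z s\<bar>" if "s \<in> {?l k..?r k}"
        using that half off[OF pos(1) k] unfolding j by (intro Z1) (simp add: left_end_def right_end_def)
    qed (auto simp: j)
  next
    assume j: "j = 2"
    show ?thesis
    proof (rule layer[where e = "- 1" and p = "\<xi>' 2" and q = "\<xi> 2 - \<xi>' 2" and f = 0 and T = "t 2", OF _ pos(2,6)])
      fix k assume k: "k \<ge> k\<^sub>0"
      then have k': "k > 0" using k1 by force
      show "layer_map (t 2) (\<xi>' 2) (\<xi> 2 - \<xi>' 2) (- 1) 0 (ln k / 3) 0 = ?l k \<and>
          layer_map (t 2) (\<xi>' 2) (\<xi> 2 - \<xi>' 2) (- 1) 0 (ln k / 3) 1 = ?r k"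
        using k' by (simp add: layer_map_left[OF k'] j left_end_def right_end_def)
      fix s
      show "change_of_var t \<xi> \<xi>' \<zeta> \<zeta>' k j s =
        layer_map (t 2) (\<xi>' 2) (\<xi> 2 - \<xi>' 2) (- 1) 0 (ln k / 3) ((s - ?l k) / (?r k - ?l k))"
        unfolding layer_map_left[OF k'] change_of_var_def Let_def j by simp
      show "c * \<bar>s - t 2\<bar> \<le> \<bar>Z s\<bar>" if "s \<in> {?l k..?r k}"
        using that half off[OF pos(2) k] unfolding j by (intro Z2) (simp add: left_end_def right_end_def)
    qed (auto simp: j)
  next
    assume j: "j = 3"
    show ?thesis
    proof (rule layer[where e = "- 1" and p = "\<zeta>' 1" and q = "\<zeta> 1 - \<zeta>' 1" and f = 0 and T = "t 1", OF _ pos(3,7)])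
      fix k assume k: "k \<ge> k\<^sub>0"
      then have k': "k > 0" using k1 by force
      show "layer_map (t 1) (\<zeta>' 1) (\<zeta> 1 - \<zeta>' 1) (- 1) 0 (ln k / 3) 0 = ?l k \<and>
          layer_map (t 1) (\<zeta>' 1) (\<zeta> 1 - \<zeta>' 1) (- 1) 0 (ln k / 3) 1 = ?r k"
        using k' by (simp add: layer_map_left[OF k'] j left_end_def right_end_def)
      fix s
      show "change_of_var t \<xi> \<xi>' \<zeta> \<zeta>' k j s =
        layer_map (t 1) (\<zeta>' 1) (\<zeta> 1 - \<zeta>' 1) (- 1) 0 (ln k / 3) ((s - ?l k) / (?r k - ?l k))"
        unfolding layer_map_left[OF k'] change_of_var_def Let_def j by simp
      show "c * \<bar>s - t 1\<bar> \<le> \<bar>Z s\<bar>" if "s \<in> {?l k..?r k}"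
        using that half off[OF pos(3) k] unfolding j by (intro Z1) (simp add: left_end_def right_end_def)
    qed (auto simp: j)
  next
    assume j: "j = 4"
    show ?thesis
    proof (rule layer[where e = 1 and p = "\<zeta> 2" and q = "\<zeta>' 2 - \<zeta> 2" and f = "- 1" and T = "t 2", OF _ pos(4,8)])
      fix k assume k: "k \<ge> k\<^sub>0"
      then have k': "k > 0" using k1 by force
      show "layer_map (t 2) (\<zeta> 2) (\<zeta>' 2 - \<zeta> 2) 1 (- 1) (ln k / 3) 0 = ?l k \<and>
          layer_map (t 2) (\<zeta> 2) (\<zeta>' 2 - \<zeta> 2) 1 (- 1) (ln k / 3) 1 = ?r k"
        using k' by (simp add: layer_map_right[OF k'] j left_end_def right_end_def)
      fix s
      show "change_of_var t \<xi> \<xi>' \<zeta> \<zeta>' k j s =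
        layer_map (t 2) (\<zeta> 2) (\<zeta>' 2 - \<zeta> 2) 1 (- 1) (ln k / 3) ((s - ?l k) / (?r k - ?l k))"
        using flip[OF lr[OF k]] unfolding layer_map_right[OF k'] change_of_var_def Let_def j by simp
      show "c * \<bar>s - t 2\<bar> \<le> \<bar>Z s\<bar>" if "s \<in> {?l k..?r k}"
        using that half off[OF pos(4) k] unfolding j by (intro Z2) (simp add: left_end_def right_end_def)
    qed (auto simp: j)
  next
    assume j: "j = 5"
    show ?thesis
      by (rule transition[of "\<zeta> 1 + \<xi> 1"]) (use pos in \<open>auto simp: j left_end_def right_end_def algebra_simps\<close>)
  next
    assume j: "j = 6"
    show ?thesis
      by (rule transition[of "\<xi> 2 + \<zeta> 2"]) (use pos in \<open>auto simp: j left_end_def right_end_def algebra_simps\<close>)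
  qed
qed

lemma galerkin_space_diff:
  assumes v: "v \<in> galerkin_space P \<gamma> \<alpha> t \<xi> \<xi>' \<zeta> \<zeta>' k d" and w: "w \<in> galerkin_space P \<gamma> \<alpha> t \<xi> \<xi>' \<zeta> \<zeta>' k d"
  shows "(\<lambda>s. v s - w s) \<in> galerkin_space P \<gamma> \<alpha> t \<xi> \<xi>' \<zeta> \<zeta>' k d"
proof -
  let ?f = "\<lambda>p s. exp (\<i> * complex_of_real (k * (\<alpha> \<bullet> \<gamma> s))) *
             (\<Sum>j\<in>{1..6}. indicator (region t \<xi> \<xi>' \<zeta> \<zeta>' k j) s *
                poly (p j) (complex_of_real
                  (the_inv_into (region t \<xi> \<xi>' \<zeta> \<zeta>' k j) (change_of_var t \<xi> \<xi>' \<zeta> \<zeta>' k j) s)))"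
  obtain p where p: "\<forall>j\<in>{1..6}. degree (p j) \<le> d j"
    "AE s in lborel. s \<in> {t 1 - \<zeta>' 1 .. t 2 + \<zeta>' 2} \<longrightarrow> v s = ?f p s"
    using v unfolding galerkin_space_def mem_Collect_eq by (elim exE conjE) (rule that)
  obtain q where q: "\<forall>j\<in>{1..6}. degree (q j) \<le> d j"
    "AE s in lborel. s \<in> {t 1 - \<zeta>' 1 .. t 2 + \<zeta>' 2} \<longrightarrow> w s = ?f q s"
    using w unfolding galerkin_space_def mem_Collect_eq by (elim exE conjE) (rule that)
  have "(\<lambda>s. v s - w s) \<in> L2 P"
    using v w by (intro L2_diff) (auto simp: galerkin_space_def)
  moreover have "\<forall>j\<in>{1..6}. degree (p j - q j) \<le> d j"
    using p(1) q(1) by (auto intro: degree_diff_le)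
  moreover have "AE s in lborel. s \<in> {t 1 - \<zeta>' 1 .. t 2 + \<zeta>' 2} \<longrightarrow> v s - w s = ?f (\<lambda>j. p j - q j) s"
    using p(2) q(2)
  proof eventually_elim
    case (elim s)
    have "?f (\<lambda>j. p j - q j) s = ?f p s - ?f q s"
      by (simp only: poly_diff right_diff_distrib sum_subtractf)
    with elim show ?case by simp
  qed
  ultimately show ?thesis
    unfolding galerkin_space_def mem_Collect_eq by (intro conjI exI[of _ "\<lambda>j. p j - q j"])
qed


section \<open>The error estimate\<close>

theorem theorem16:
  fixes K :: "(real^2) set" and P :: real and \<gamma> :: "real \<Rightarrow> real^2" and \<alpha> :: "real^2"
    and t \<xi> \<xi>' \<zeta> \<zeta>' :: "nat \<Rightarrow> real"
    and u :: "real \<Rightarrow> real^2 \<Rightarrow> complex" and \<eta> \<sigma> :: "real \<Rightarrow> real \<Rightarrow> complex"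
    and b :: "index \<Rightarrow> real \<Rightarrow> complex" and Z :: "real \<Rightarrow> real"
    and \<Psi> :: "nat \<Rightarrow> int \<Rightarrow> real \<Rightarrow> complex"
    and k\<^sub>0 :: real and R :: "real \<Rightarrow> (real \<Rightarrow> complex) \<Rightarrow> real \<Rightarrow> complex"
    and f :: "real \<Rightarrow> real \<Rightarrow> complex" and C\<^sub>R c\<^sub>R :: "real \<Rightarrow> real"
    and \<beta> :: nat and n :: "nat \<Rightarrow> nat"
  assumes obstacle: "obstacle K P \<gamma>"
    and direction: "norm \<alpha> = 1"
    and shadow: "shadow_boundaries P \<gamma> \<alpha> t"
    and solution: "\<And>k. k > 0 \<Longrightarrow> scattering_solution K \<gamma> \<alpha> k (u k)"
    and eta: "\<eta> = total_field \<gamma> \<alpha> u"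
    and expansion_data: "expansion_data P t b Z \<Psi>"
    and slow_symbol: "slow_field \<gamma> \<alpha> u \<in> symbol_class P 0 (2/3) (1/3)"
    and expansion: "asymptotic_expansion P (slow_field \<gamma> \<alpha> u) (expansion_term b Z \<Psi>)"
    and sigma: "\<sigma> = sigma \<gamma> \<alpha> (expansion_term b Z \<Psi>) \<beta>"
    and k0: "k\<^sub>0 > 1"
    and operator: "\<And>k. k \<ge> k\<^sub>0 \<Longrightarrow> continuous_coercive P (R k) (C\<^sub>R k) (c\<^sub>R k)"
    and rhs: "\<And>k. k \<ge> k\<^sub>0 \<Longrightarrow> f k \<in> L2 P"
    and equation: "\<And>k. k \<ge> k\<^sub>0 \<Longrightarrow> AE s in lborel. R k (\<lambda>s. \<eta> s k) s = f k s"
    and regions: "region_parameters P t \<xi> \<xi>' \<zeta> \<zeta>'"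
  shows "\<exists>C>0. \<forall>k\<ge>k\<^sub>0. \<forall>d :: nat \<Rightarrow> nat.
    (\<forall>j\<in>{1..6}. d j \<ge> 1 \<and> int (d j) \<ge> int (n j) - 1) \<longrightarrow>
    (\<forall>\<rho>. galerkin_solution P (galerkin_space P \<gamma> \<alpha> t \<xi> \<xi>' \<zeta> \<zeta>' k d) (R k)
            (\<lambda>s. f k s - R k (\<lambda>s. \<sigma> s k) s) \<rho> \<longrightarrow>
       L2_norm P (\<lambda>s. \<eta> s k - (\<sigma> s k + \<rho> s))
         \<le> C * (C\<^sub>R k / c\<^sub>R k) * k powr (- real \<beta> / 3) * sqrt (ln k) *
            ((\<Sum>j=1..4. ln k ^ n j * real (d j) powi (- int (n j)))
             + (\<Sum>j=5..6. real (d j) powi (- int (n j)))))"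
proof -
  have P: "P > 0" and \<gamma>: "smooth_fun \<gamma>" "periodic_fun (2 * P) \<gamma>"
    using obstacle by (simp_all add: obstacle_def)
  have t: "0 < t 1" "t 1 < t 2" "t 2 < 2 * P" "t 1 + t 2 = 2 * P"
    using shadow by (simp_all add: shadow_boundaries_def)
  have Z: "smooth_fun Z" "periodic_fun (2 * P) Z"
    and Zpos: "\<And>s. s \<in> {t 1<..<t 2} \<Longrightarrow> Z s > 0"
    and Zneg: "\<And>s. s \<in> {0..<t 1} \<union> {t 2<..2 * P} \<Longrightarrow> Z s < 0"
    and Zzero: "Z (t 1) = 0" "vector_derivative Z (at (t 1)) \<noteq> 0"
      "Z (t 2) = 0" "vector_derivative Z (at (t 2)) \<noteq> 0"
    using expansion_data unfolding expansion_data_def by (blast, blast, blast, blast, blast, blast, blast, blast)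
  have reg: "\<xi> 1 > 0" "\<xi> 2 > 0" "\<zeta> 1 > 0" "\<zeta> 2 > 0" "\<xi> 1 \<le> \<xi>' 1" "\<xi> 2 \<le> \<xi>' 2" "\<zeta> 1 \<le> \<zeta>' 1" "\<zeta> 2 \<le> \<zeta>' 2"
    "t 1 + \<xi>' 1 = t 2 - \<xi>' 2" "t 2 + \<zeta>' 2 = 2 * P + t 1 - \<zeta>' 1"
    using regions by (auto simp: region_parameters_def)
  let ?E = "expansion_term b Z \<Psi>"
  \<comment> \<open>an upper bound for the number of derivatives used on any region\<close>
  define N where "N = (\<Sum>j\<in>{1..6}. n j)"
  have N: "n j \<le> N" if "j \<in> {1..6}" for j
    unfolding N_def using that by (intro member_le_sum) auto
  obtain CZ where CZ: "CZ \<ge> 1" "\<And>s. s \<in> {0..2 * P} \<Longrightarrow> \<bar>Z s\<bar> \<le> CZ"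
    using smooth_fun_bounded_on_interval[OF Z(1), of 0 0 "2 * P"] by auto
  define \<Lambda> where "\<Lambda> = CZ + 1"
  have \<Lambda>: "\<Lambda> > 0" "\<And>s. s \<in> {0..2 * P} \<Longrightarrow> \<bar>Z s\<bar> + 1 \<le> \<Lambda>"
    using CZ by (auto simp: \<Lambda>_def)
  have slow_smooth: "smooth_fun (\<lambda>s. slow_field \<gamma> \<alpha> u s k)" if "k > 0" for k
    using solution[OF that] by (intro smooth_slow_field \<gamma>) (simp add: scattering_solution_def)
  define g where "g = (\<lambda>k s. slow_field \<gamma> \<alpha> u s k - (\<Sum>i\<in>leading_indices \<beta>. ?E i s k))"
  have lead: "i \<in> indices" if "i \<in> leading_indices \<beta>" for i
    using that by (simp add: leading_indices_def)
  have sum_smooth: "smooth_fun (\<lambda>s. \<Sum>i\<in>leading_indices \<beta>. ?E i s k)" for k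
    by (rule smooth_fun_sum[OF finite_leading_indices]) (rule smooth_expansion_term[OF expansion_data lead])
  have g_smooth: "smooth_fun (g k)" if "k > 0" for k
    unfolding g_def by (rule smooth_fun_diff[OF slow_smooth[OF that] sum_smooth])
  have slow_per: "periodic_fun (2 * P) (\<lambda>s. slow_field \<gamma> \<alpha> u s k)" for k
    using \<gamma>(2) by (simp add: periodic_fun_def slow_field_def total_field_def)
  have sum_per: "periodic_fun (2 * P) (\<lambda>s. \<Sum>i\<in>leading_indices \<beta>. ?E i s k)" for k
    using periodic_expansion_term[OF expansion_data lead] unfolding periodic_fun_def by (intro allI sum.cong) auto
  have g_per: "periodic_fun (2 * P) (g k)" for k
    using slow_per[of k] sum_per[of k] by (simp add: periodic_fun_def g_def)
  have "\<exists>C>0. \<forall>k\<ge>1. \<forall>m\<le>N. \<forall>s\<in>{0..2 * P}.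
    norm (nderiv m (\<lambda>s. slow_field \<gamma> \<alpha> u s k - (\<Sum>i\<in>leading_indices \<beta>. ?E i s k)) s)
      \<le> C * k powr (- real \<beta> / 3) * layer_rate Z \<Lambda> k s ^ m"
    by (rule slow_remainder_bound_on_period[OF expansion_data P expansion slow_smooth \<Lambda>(2)])
  then obtain C0 where C0: "C0 > 0" and C0_bound: "\<forall>k\<ge>1. \<forall>m\<le>N. \<forall>s\<in>{0..2 * P}.
    norm (nderiv m (\<lambda>s. slow_field \<gamma> \<alpha> u s k - (\<Sum>i\<in>leading_indices \<beta>. ?E i s k)) s)
      \<le> C0 * k powr (- real \<beta> / 3) * layer_rate Z \<Lambda> k s ^ m"
    by (elim exE conjE) (rule that)
  have g_bound: "norm (nderiv m (g k) s) \<le> C0 * k powr (- real \<beta> / 3) * layer_rate Z \<Lambda> k s ^ m"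
    if "k \<ge> 1" "m \<le> N" for k m s
  proof -
    obtain z where z: "s + of_int z * (2 * P) \<in> {0..<0 + 2 * P}"
      using shift_into_period[of "2 * P" s 0] P by auto
    have "nderiv m (g k) (s + of_int z * (2 * P)) = nderiv m (g k) s"
      using that by (intro periodic_fun_int periodic_fun_nderiv g_smooth g_per) simp
    moreover have "layer_rate Z \<Lambda> k (s + of_int z * (2 * P)) = layer_rate Z \<Lambda> k s"
      by (simp only: layer_rate_def periodic_fun_int[OF Z(2)])
    moreover have "norm (nderiv m (g k) (s + of_int z * (2 * P)))
        \<le> C0 * k powr (- real \<beta> / 3) * layer_rate Z \<Lambda> k (s + of_int z * (2 * P)) ^ m"
      using C0_bound[rule_format, OF that, of "s + of_int z * (2 * P)"] z unfolding g_def by simp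
    ultimately show ?thesis by simp
  qed
  \<comment> \<open>Between two consecutive shadow boundary points \<open>Z\<close> has a fixed sign, also where the shadow region leaves \<open>[0, 2P]\<close>.\<close>
  have Z_neg_left: "Z s < 0" if "t 2 - 2 * P < s" "s < t 1" for s
  proof (cases "s \<ge> 0")
    case True
    then show ?thesis using that by (intro Zneg) auto
  next
    case False
    have "Z (s + 2 * P) < 0" using that False t by (intro Zneg) auto
    then show ?thesis using Z(2) by (simp add: periodic_fun_def)
  qed
  have Z_neg_right: "Z s < 0" if "t 2 < s" "s < t 1 + 2 * P" for s
    using Z_neg_left[of "s - 2 * P"] that Z(2)[unfolded periodic_fun_def, rule_format, of "s - 2 * P"] by simp
  obtain c1 where c1: "c1 > 0" "\<And>s. s \<in> {t 1 - \<zeta>' 1..t 1 + \<xi>' 1} \<Longrightarrow> c1 * \<bar>s - t 1\<bar> \<le> \<bar>Z s\<bar>"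
  proof -
    have "Z s \<noteq> 0" if "s \<in> {t 1 - \<zeta>' 1..t 1 + \<xi>' 1}" "s \<noteq> t 1" for s
      using Z_neg_left[of s] Zpos[of s] that reg by (cases "s < t 1") force+
    from simple_zero_lower_bound[OF Z(1) Zzero(1,2) this] that show ?thesis by blast
  qed
  obtain c2 where c2: "c2 > 0" "\<And>s. s \<in> {t 2 - \<xi>' 2..t 2 + \<zeta>' 2} \<Longrightarrow> c2 * \<bar>s - t 2\<bar> \<le> \<bar>Z s\<bar>"
  proof -
    have "Z s \<noteq> 0" if "s \<in> {t 2 - \<xi>' 2..t 2 + \<zeta>' 2}" "s \<noteq> t 2" for s
      using Z_neg_right[of s] Zpos[of s] that reg by (cases "s < t 2") force+
    from simple_zero_lower_bound[OF Z(1) Zzero(3,4) this] that show ?thesis by blast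
  qed
  define c where "c = min c1 c2"
  have c: "c > 0" using c1 c2 by (simp add: c_def)
  have Z1: "c * \<bar>s - t 1\<bar> \<le> \<bar>Z s\<bar>" if "s \<in> {t 1 - \<zeta>' 1..t 1 + \<xi>' 1}" for s
    by (rule order_trans[OF mult_right_mono c1(2)[OF that]]) (auto simp: c_def)
  have Z2: "c * \<bar>s - t 2\<bar> \<le> \<bar>Z s\<bar>" if "s \<in> {t 2 - \<xi>' 2..t 2 + \<zeta>' 2}" for s
    by (rule order_trans[OF mult_right_mono c2(2)[OF that]]) (auto simp: c_def)
  let ?I = "\<lambda>k j. region t \<xi> \<xi>' \<zeta> \<zeta>' k j"
  let ?inv = "\<lambda>k j. the_inv_into (?I k j) (change_of_var t \<xi> \<xi>' \<zeta> \<zeta>' k j)"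
  define \<tau> where "\<tau> = (\<lambda>k (d :: nat \<Rightarrow> nat) j. (if j \<le> 4 then ln k ^ n j else 1) / real (d j) ^ n j)"
  have "\<forall>j\<in>{1..6}. \<exists>K. K > 0 \<and> (\<forall>k\<ge>k\<^sub>0. \<forall>(g :: real \<Rightarrow> complex) B d.
     smooth_fun g \<longrightarrow> B > 0 \<longrightarrow> d \<ge> 1 \<longrightarrow> d + 1 \<ge> n j \<longrightarrow>
     (\<forall>m\<le>n j. \<forall>s\<in>?I k j. norm (nderiv m g s) \<le> B * layer_rate Z \<Lambda> k s ^ m) \<longrightarrow>
     poly_approximable (?I k j) (change_of_var t \<xi> \<xi>' \<zeta> \<zeta>' k j) d g
       ((K * B * sqrt (ln k) * ((if j \<le> 4 then ln k ^ n j else 1) / real d ^ n j))\<^sup>2))"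
    by (rule ballI) (rule galerkin_region_approximation[OF regions k0 \<Lambda>(1) c Z1 Z2])
  from bchoice[OF this] obtain K where K: "\<forall>j\<in>{1..6}. K j > 0 \<and> (\<forall>k\<ge>k\<^sub>0. \<forall>(g :: real \<Rightarrow> complex) B d.
     smooth_fun g \<longrightarrow> B > 0 \<longrightarrow> d \<ge> 1 \<longrightarrow> d + 1 \<ge> n j \<longrightarrow>
     (\<forall>m\<le>n j. \<forall>s\<in>?I k j. norm (nderiv m g s) \<le> B * layer_rate Z \<Lambda> k s ^ m) \<longrightarrow>
     poly_approximable (?I k j) (change_of_var t \<xi> \<xi>' \<zeta> \<zeta>' k j) d g
       ((K j * B * sqrt (ln k) * ((if j \<le> 4 then ln k ^ n j else 1) / real d ^ n j))\<^sup>2))" ..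
  define KS where "KS = (\<Sum>j\<in>{1..6}. K j)"
  have Kpos: "K j > 0" if "j \<in> {1..6}" for j using K that by blast
  have KS: "K j \<le> KS" if "j \<in> {1..6}" for j
    unfolding KS_def using that Kpos by (intro member_le_sum) (auto simp: less_imp_le)
  have KSpos: "KS > 0" using KS[of 1] Kpos[of 1] by simp
  define L where "L = t 1 - \<zeta>' 1"
  have L: "- (2 * P) \<le> L" "L \<le> 2 * P" "t 2 + \<zeta>' 2 = L + 2 * P"
    using reg t by (auto simp: L_def)
  show ?thesis
  proof (intro exI[of _ "2 * C0 * KS"] conjI allI impI)
    show "2 * C0 * KS > 0" using C0 KSpos by simp
    fix k :: real and d :: "nat \<Rightarrow> nat" and \<rho> :: "real \<Rightarrow> complex"
    assume k: "k \<ge> k\<^sub>0" and d: "\<forall>j\<in>{1..6}. 1 \<le> d j \<and> int (n j) - 1 \<le> int (d j)"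
      and sol: "galerkin_solution P (galerkin_space P \<gamma> \<alpha> t \<xi> \<xi>' \<zeta> \<zeta>' k d) (R k)
            (\<lambda>s. f k s - R k (\<lambda>s. \<sigma> s k) s) \<rho>"
    have k1: "k > 1" using k k0 by simp
    have lnk: "ln k > 0" using k1 by simp
    define B where "B = C0 * k powr (- real \<beta> / 3)"
    have B: "B > 0" using C0 k1 by (simp add: B_def)
    define X where "X = (\<lambda>j. K j * B * sqrt (ln k) * \<tau> k d j)"
    have \<tau>: "\<tau> k d j \<ge> 0" for j using lnk by (simp add: \<tau>_def)
    have "\<forall>j\<in>{1..6}. \<exists>p. degree p \<le> d j \<and> continuous_on (?I k j) (?inv k j) \<and>
        integral (?I k j) (\<lambda>s. (norm (g k s - poly p (complex_of_real (?inv k j s))))\<^sup>2) \<le> (X j)\<^sup>2"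
    proof
      fix j :: nat assume j: "j \<in> {1..6}"
      have dj: "1 \<le> d j" "n j \<le> d j + 1" using d[rule_format, OF j] by auto
      have "\<forall>m\<le>n j. \<forall>s\<in>?I k j. norm (nderiv m (g k) s) \<le> B * layer_rate Z \<Lambda> k s ^ m"
        using g_bound[of k] N[OF j] k1 by (simp add: B_def)
      then show "\<exists>p. degree p \<le> d j \<and> continuous_on (?I k j) (?inv k j) \<and>
        integral (?I k j) (\<lambda>s. (norm (g k s - poly p (complex_of_real (?inv k j s))))\<^sup>2) \<le> (X j)\<^sup>2"
        using K[rule_format, OF j, THEN conjunct2, rule_format, OF k g_smooth B dj] k1
        unfolding poly_approximable_def X_def \<tau>_def by simp
    qed
    from bchoice[OF this] obtain p where p: "\<forall>j\<in>{1..6}. degree (p j) \<le> d j \<and> continuous_on (?I k j) (?inv k j) \<and>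
        integral (?I k j) (\<lambda>s. (norm (g k s - poly (p j) (complex_of_real (?inv k j s))))\<^sup>2) \<le> (X j)\<^sup>2" ..
    let ?l = "left_end t \<xi> \<xi>' \<zeta> \<zeta>' k" and ?r = "right_end t \<xi> \<xi>' \<zeta> \<zeta>' k"
    let ?\<theta> = "\<lambda>s. k * (\<alpha> \<bullet> \<gamma> s)"
    let ?q = "\<lambda>j s. poly (p j) (complex_of_real (?inv k j s))"
    have cont_\<theta>: "continuous_on UNIV ?\<theta>"
      by (intro continuous_intros smooth_fun_continuous_on_0[OF \<gamma>(1)])
    have per_\<theta>: "periodic_fun (2 * P) ?\<theta>"
      using \<gamma>(2) by (simp add: periodic_fun_def)
    have "\<exists>v\<in>L2 P. (AE s in lborel. s \<in> {L..L + 2 * P} \<longrightarrow>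
        v s = exp (\<i> * complex_of_real (?\<theta> s)) * (\<Sum>j\<in>{1..6}. indicator {?l j..?r j} s * ?q j s)) \<and>
      L2_norm P (\<lambda>s. exp (\<i> * complex_of_real (?\<theta> s)) * g k s - v s) \<le> 2 * (\<Sum>j\<in>{1..6}. X j)"
    proof (rule piecewise_approximation[OF P L(1,2)])
      show "?l 3 = L" "?r 4 = L + 2 * P"
        using region_chain(6,7)[OF regions k1] L(3) by (simp_all add: L_def)
      show "continuous_on {?l j..?r j} (?q j)" if "j \<in> {1..6}" for j
        using p[rule_format, OF that] unfolding region_def by (intro continuous_intros) auto
      show "integral {?l j..?r j} (\<lambda>s. (norm (g k s - ?q j s))\<^sup>2) \<le> (X j)\<^sup>2" if "j \<in> {1..6}" for j
        using p[rule_format, OF that] unfolding region_def by simp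
      show "X j \<ge> 0" if "j \<in> {1..6}" for j
        using Kpos[OF that] B lnk \<tau> by (simp add: X_def)
      show "continuous_on UNIV (g k)"
        using k1 by (intro smooth_fun_continuous_on_0 g_smooth) simp
    qed (fact region_chain[OF regions k1] g_per cont_\<theta> per_\<theta>)+
    then obtain v where v: "v \<in> L2 P"
      "AE s in lborel. s \<in> {L..L + 2 * P} \<longrightarrow>
        v s = exp (\<i> * complex_of_real (?\<theta> s)) * (\<Sum>j\<in>{1..6}. indicator {?l j..?r j} s * ?q j s)"
      "L2_norm P (\<lambda>s. exp (\<i> * complex_of_real (?\<theta> s)) * g k s - v s) \<le> 2 * (\<Sum>j\<in>{1..6}. X j)"
      by blast
    have v_space: "v \<in> galerkin_space P \<gamma> \<alpha> t \<xi> \<xi>' \<zeta> \<zeta>' k d"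
      unfolding galerkin_space_def mem_Collect_eq
    proof (intro conjI exI[of _ p])
      show "\<forall>j\<in>{1..6}. degree (p j) \<le> d j" using p by blast
      show "AE s in lborel. s \<in> {t 1 - \<zeta>' 1 .. t 2 + \<zeta>' 2} \<longrightarrow>
           v s = exp (\<i> * complex_of_real (?\<theta> s)) * (\<Sum>j\<in>{1..6}. indicator (?I k j) s * ?q j s)"
        using v(2) unfolding region_def L(3) L_def .
    qed (rule v(1))
    have \<sigma>_eq: "\<sigma> s k = exp (\<i> * complex_of_real (?\<theta> s)) * (\<Sum>i\<in>leading_indices \<beta>. ?E i s k)" for s
      by (simp add: sigma sigma_def)
    have \<eta>_eq: "\<eta> s k = exp (\<i> * complex_of_real (?\<theta> s)) * slow_field \<gamma> \<alpha> u s k" for s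
      by (simp add: eta slow_field_def exp_minus)
    have L2_exp: "(\<lambda>s. exp (\<i> * complex_of_real (?\<theta> s)) * h s) \<in> L2 P"
      if "smooth_fun h" "periodic_fun (2 * P) h" for h
    proof (rule continuous_periodic_L2)
      show "continuous_on UNIV (\<lambda>s. exp (\<i> * complex_of_real (?\<theta> s)) * h s)"
        by (intro continuous_on_mult continuous_on_exp continuous_on_of_real continuous_on_const cont_\<theta>
            smooth_fun_continuous_on_0[OF that(1)])
      show "periodic_fun (2 * P) (\<lambda>s. exp (\<i> * complex_of_real (?\<theta> s)) * h s)"
        using that(2) \<gamma>(2) by (simp add: periodic_fun_def)
    qed
    have \<eta>L: "(\<lambda>s. \<eta> s k) \<in> L2 P"
      unfolding \<eta>_eq using k1 by (intro L2_exp slow_smooth slow_per) simp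
    have \<sigma>L: "(\<lambda>s. \<sigma> s k) \<in> L2 P"
      unfolding \<sigma>_eq by (rule L2_exp[OF sum_smooth sum_per])
    have "L2_norm P (\<lambda>s. \<eta> s k - (\<sigma> s k + \<rho> s)) \<le> C\<^sub>R k / c\<^sub>R k * L2_norm P (\<lambda>s. (\<eta> s k - \<sigma> s k) - v s)"
    proof (rule galerkin_quasi_optimal[OF operator[OF k] \<eta>L \<sigma>L rhs[OF k] equation[OF k] _ _ sol v_space])
      show "galerkin_space P \<gamma> \<alpha> t \<xi> \<xi>' \<zeta> \<zeta>' k d \<subseteq> L2 P"
        by (auto simp: galerkin_space_def)
    qed (rule galerkin_space_diff)
    also have "(\<lambda>s. (\<eta> s k - \<sigma> s k) - v s) = (\<lambda>s. exp (\<i> * complex_of_real (?\<theta> s)) * g k s - v s)"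
      unfolding \<eta>_eq \<sigma>_eq g_def by (simp add: algebra_simps)
    also have "C\<^sub>R k / c\<^sub>R k * L2_norm P (\<lambda>s. exp (\<i> * complex_of_real (?\<theta> s)) * g k s - v s) \<le>
        C\<^sub>R k / c\<^sub>R k * (2 * (KS * B * sqrt (ln k) * (\<Sum>j\<in>{1..6}. \<tau> k d j)))"
    proof (rule mult_left_mono)
      have "(\<Sum>j\<in>{1..6}. X j) \<le> (\<Sum>j\<in>{1..6}. KS * B * sqrt (ln k) * \<tau> k d j)"
        unfolding X_def using KS B lnk \<tau> by (intro sum_mono mult_right_mono) auto
      then show "L2_norm P (\<lambda>s. exp (\<i> * complex_of_real (?\<theta> s)) * g k s - v s) \<le>
          2 * (KS * B * sqrt (ln k) * (\<Sum>j\<in>{1..6}. \<tau> k d j))"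
        using v(3) unfolding sum_distrib_left[symmetric] by linarith
      show "0 \<le> C\<^sub>R k / c\<^sub>R k"
        using operator[OF k] by (simp add: continuous_coercive_def)
    qed
    also have "(\<Sum>j\<in>{1..6}. \<tau> k d j) = (\<Sum>j=1..4. ln k ^ n j * real (d j) powi (- int (n j)))
             + (\<Sum>j=5..6. real (d j) powi (- int (n j)))"
    proof -
      have "{1..6} = {1..4} \<union> {5..6 :: nat}" by auto
      then have "(\<Sum>j\<in>{1..6}. \<tau> k d j) = (\<Sum>j=1..4. \<tau> k d j) + (\<Sum>j=5..6. \<tau> k d j)"
        by (simp add: sum.union_disjoint)
      also have "(\<Sum>j=1..4. \<tau> k d j) = (\<Sum>j=1..4. ln k ^ n j * real (d j) powi (- int (n j)))"
        by (rule sum.cong) (auto simp: \<tau>_def power_int_minus divide_inverse)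
      also have "(\<Sum>j=5..6. \<tau> k d j) = (\<Sum>j=5..6. real (d j) powi (- int (n j)))"
        by (rule sum.cong) (auto simp: \<tau>_def power_int_minus divide_inverse)
      finally show ?thesis .
    qed
    finally show "L2_norm P (\<lambda>s. \<eta> s k - (\<sigma> s k + \<rho> s))
         \<le> 2 * C0 * KS * (C\<^sub>R k / c\<^sub>R k) * k powr (- real \<beta> / 3) * sqrt (ln k) *
            ((\<Sum>j=1..4. ln k ^ n j * real (d j) powi (- int (n j)))
             + (\<Sum>j=5..6. real (d j) powi (- int (n j))))"
      by (simp only: B_def mult_ac)
  qed
qed

end
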